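(* Let $\varphi:\bar D\times[0,T]\to\mathbf{R}$ be Lebesgue measurable with $\varphi\in X_1^0$, and let $\zeta:\bar D\to\mathbf{R}$ be Lebesgue measurable with $\zeta\in L_2(D)$. Put $$V(x,s)=\int_s^{\tau^{x,s}}\varphi(y^{x,s}(t),t)\,dt,\qquad U(x,s)=\zeta(y^{x,s}(T))\,\mathrm{Ind}\{\tilde\tau^{x,s}>T\}.$$ Then the functions $V(\cdot,s)$ and $U(\cdot,s)$ are weakly continuous and strongly left-continuous with respect to $s$ (on $[0,T]$) in $L_2(D)$. Moreover, $$\sup_{s\in[0,T]}\|V(\cdot,s)\|_{L_2(D)}\le c_0\int_0^T\|\varphi(\cdot,t)\|_{L_2(D)}\,dt,$$ $$\sup_{s\in[0,T]}\|U(\cdot,s)\|_{L_2(D)}\le c_0\|\zeta\|_{L_2(D)},$$ where $$c_0=\exp\frac12\int_0^T\sup_{x\in D}\left|\sum_{i=1}^n\frac{\partial f_i}{\partial x_i}(x,t)\right|dt .$$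
   Context: Setting: $D\subset\mathbf{R}^n$ is a bounded simply connected domain with $C^1$-smooth boundary $\partial D$, $\bar D=D\cup\partial D$; $T>0$; $f=(f_1,\dots,f_n):\mathbf{R}^n\times\mathbf{R}\to\mathbf{R}^n$, $f=f(x,t)$, is bounded and continuous and has continuous first-order partial derivatives with respect to $x$. For $x\in D$ and $s\in[0,T]$, $y^{x,s}(t)$, $t\ge s$, is the solution of $\frac{dy}{dt}(t)=f(y(t),t)$, $y(s)=x$; $\tilde\tau^{x,s}=\inf\{t:t\ge s,\ y^{x,s}(t)\notin D\}$ ($\inf\emptyset=+\infty$) and $\tau^{x,s}=\min\{T,\tilde\tau^{x,s}\}$. $\mathrm{Ind}\{\tilde\tau^{x,s}>T\}$ equals $1$ if $\tilde\tau^{x,s}>T$ and $0$ otherwise (so $U(x,s)=0$ if $\tilde\tau^{x,s}\le T$). $X_1^0$ is the space of functions $u:[0,T]\to L_2(D)$ with finite norm $\int_0^T\|u(\cdot,t)\|_{L_2(D)}dt$; Lebesgue measurable functions on $\bar D\times[0,T]$ are regarded as elements of it. Strong left-continuity of $s\mapsto g(\cdot,s)$ in $L_2(D)$ means $\|g(\cdot,s)-g(\cdot,\theta)\|_{L_2(D)}\to0$ as $\theta\to s-0$; weak continuity means that $s\mapsto(g(\cdot,s),\xi)_{L_2(D)}$ is continuous for every $\xi\in L_2(D)$. *)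

theory Defs
  imports "HOL-Analysis.Analysis"
begin

definition partial_deriv :: "(real^'n \<Rightarrow> real) \<Rightarrow> 'n \<Rightarrow> real^'n \<Rightarrow> real" where
  "partial_deriv g j x = deriv (\<lambda>h. g (x + h *\<^sub>R axis j 1)) 0"

definition has_partial_deriv :: "(real^'n \<Rightarrow> real) \<Rightarrow> 'n \<Rightarrow> real^'n \<Rightarrow> bool" where
  "has_partial_deriv g j x \<longleftrightarrow> (\<lambda>h. g (x + h *\<^sub>R axis j 1)) differentiable (at 0)"

text \<open>Near each boundary point, and up to relabelling and reversing a coordinate axis,
  the set is the region above the graph of a \<open>C\<^sup>1\<close> function \<open>\<gamma>\<close> of the coordinates
  other than the \<open>k\<close>-th one; \<open>\<gamma>\<close> is encoded as a function on the whole space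
  that does not depend on the \<open>k\<close>-th coordinate.\<close>

definition C1_boundary :: "(real^'n) set \<Rightarrow> bool" where
  "C1_boundary D \<longleftrightarrow>
     (\<forall>p\<in>frontier D. \<exists>r>0. \<exists>k. \<exists>\<sigma>\<in>{1, -1}. \<exists>\<gamma> \<gamma>'.
        (\<forall>x. (\<gamma> has_derivative (\<lambda>h. \<gamma>' x \<bullet> h)) (at x)) \<and>
        continuous_on UNIV \<gamma>' \<and>
        (\<forall>x z. (\<forall>i. i \<noteq> k \<longrightarrow> x $ i = z $ i) \<longrightarrow> \<gamma> x = \<gamma> z) \<and>
        D \<inter> ball p r = {x \<in> ball p r. \<sigma> * x $ k > \<gamma> x})"

definition in_L2 :: "'a::euclidean_space set \<Rightarrow> ('a \<Rightarrow> real) \<Rightarrow> bool" where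
  "in_L2 D g \<longleftrightarrow> g \<in> borel_measurable (lebesgue_on D) \<and>
                 integrable (lebesgue_on D) (\<lambda>x. (g x)\<^sup>2)"

definition L2_inner :: "'a::euclidean_space set \<Rightarrow> ('a \<Rightarrow> real) \<Rightarrow> ('a \<Rightarrow> real) \<Rightarrow> real" where
  "L2_inner D g h = (LINT x|lebesgue_on D. g x * h x)"

definition L2_nrm :: "'a::euclidean_space set \<Rightarrow> ('a \<Rightarrow> real) \<Rightarrow> real" where
  "L2_nrm D g = sqrt (LINT x|lebesgue_on D. (g x)\<^sup>2)"

text \<open>A measurable function of \<open>(x, t)\<close> has sections in \<open>L\<^sub>2(D)\<close> only for almost every \<open>t\<close>;
  as usual the exceptional null set is disregarded.\<close>

definition in_X1 :: "'a::euclidean_space set \<Rightarrow> real \<Rightarrow> ('a \<Rightarrow> real \<Rightarrow> real) \<Rightarrow> bool" where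
  "in_X1 D T u \<longleftrightarrow> (AE t in lebesgue_on {0..T}. in_L2 D (\<lambda>x. u x t)) \<and>
                   integrable (lebesgue_on {0..T}) (\<lambda>t. L2_nrm D (\<lambda>x. u x t))"

definition X1_nrm :: "'a::euclidean_space set \<Rightarrow> real \<Rightarrow> ('a \<Rightarrow> real \<Rightarrow> real) \<Rightarrow> real" where
  "X1_nrm D T u = (LINT t|lebesgue_on {0..T}. L2_nrm D (\<lambda>x. u x t))"

definition weakly_continuous_L2 ::
    "'a::euclidean_space set \<Rightarrow> real \<Rightarrow> ('a \<Rightarrow> real \<Rightarrow> real) \<Rightarrow> bool" where
  "weakly_continuous_L2 D T g \<longleftrightarrow>
     (\<forall>s\<in>{0..T}. in_L2 D (\<lambda>x. g x s)) \<and>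
     (\<forall>\<xi>. in_L2 D \<xi> \<longrightarrow> continuous_on {0..T} (\<lambda>s. L2_inner D (\<lambda>x. g x s) \<xi>))"

definition strongly_left_continuous_L2 ::
    "'a::euclidean_space set \<Rightarrow> real \<Rightarrow> ('a \<Rightarrow> real \<Rightarrow> real) \<Rightarrow> bool" where
  "strongly_left_continuous_L2 D T g \<longleftrightarrow>
     (\<forall>s\<in>{0..T}. in_L2 D (\<lambda>x. g x s)) \<and>
     (\<forall>\<theta>\<in>{0<..T}. ((\<lambda>s. L2_nrm D (\<lambda>x. g x s - g x \<theta>)) \<longlongrightarrow> 0) (at_left \<theta>))"

definition solves_ivp ::
    "(real^'n \<Rightarrow> real \<Rightarrow> real^'n) \<Rightarrow> real^'n \<Rightarrow> real \<Rightarrow> (real \<Rightarrow> real^'n) \<Rightarrow> bool" where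
  "solves_ivp f x s \<eta> \<longleftrightarrow> \<eta> s = x \<and>
     (\<forall>t\<ge>s. (\<eta> has_vector_derivative f (\<eta> t) t) (at t within {s..}))"

text \<open>The infimum is taken in \<^typ>\<open>ereal\<close>, so it is \<open>\<infinity>\<close> if the path never leaves \<open>D\<close>.\<close>

definition exit_time :: "'a set \<Rightarrow> real \<Rightarrow> (real \<Rightarrow> 'a) \<Rightarrow> ereal" where
  "exit_time D s \<eta> = (INF t\<in>{t. t \<ge> s \<and> \<eta> t \<notin> D}. ereal t)"

definition truncated_exit_time :: "'a set \<Rightarrow> real \<Rightarrow> real \<Rightarrow> (real \<Rightarrow> 'a) \<Rightarrow> real" where
  "truncated_exit_time D T s \<eta> = real_of_ereal (min (ereal T) (exit_time D s \<eta>))"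

definition V_fun :: "'a set \<Rightarrow> real \<Rightarrow> ('a \<Rightarrow> real \<Rightarrow> real \<Rightarrow> 'a) \<Rightarrow> ('a \<Rightarrow> real \<Rightarrow> real)
    \<Rightarrow> 'a \<Rightarrow> real \<Rightarrow> real" where
  "V_fun D T y \<phi> x s =
     (LINT t:{s..truncated_exit_time D T s (y x s)}|lebesgue. \<phi> (y x s t) t)"

definition U_fun :: "'a set \<Rightarrow> real \<Rightarrow> ('a \<Rightarrow> real \<Rightarrow> real \<Rightarrow> 'a) \<Rightarrow> ('a \<Rightarrow> real)
    \<Rightarrow> 'a \<Rightarrow> real \<Rightarrow> real" where
  "U_fun D T y \<zeta> x s =
     \<zeta> (y x s T) * (if exit_time D s (y x s) > ereal T then 1 else 0)"

definition const_c0 :: "(real^'n) set \<Rightarrow> real \<Rightarrow> (real^'n \<Rightarrow> real \<Rightarrow> real^'n) \<Rightarrow> real" where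
  "const_c0 D T f = exp (1/2 * (LINT t:{0..T}|lebesgue.
     (SUP x\<in>D. \<bar>\<Sum>i\<in>UNIV. partial_deriv (\<lambda>z. f z t $ i) i x\<bar>)))"

end

theory Submission
  imports Defs
begin

text \<open>
  Let \<open>\<Phi> s t\<close> send a point \<open>x\<close> to \<open>y x s t\<close>, and let \<open>E s t\<close> be the set of the points of \<open>D\<close>
  whose path stays in \<open>D\<close> during \<open>[s, t]\<close>. Put \<open>P s t g x = g (\<Phi> s t x)\<close> for \<open>x \<in> E s t\<close> and
  \<open>P s t g x = 0\<close> otherwise. Then
    \<open>U(\<cdot>, s) = P s T \<zeta>\<close> and \<open>V(\<cdot>, s) = \<integral>\<^sub>s\<^sup>T P s t \<phi>(\<cdot>, t) dt\<close>,
  so that the claim is one about the operators \<open>P s t\<close>, called \<open>pull\<close> below.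

  \<^item> The norm of \<open>P s t\<close> is at most \<open>c\<^sub>0\<close>. By Liouville's formula the Jacobian determinant of
    \<open>\<Phi> s t\<close> at \<open>x\<close> is \<open>exp\<close> of the integral of \<open>div f\<close> along the path of \<open>x\<close>
    (\<open>y_derivative_and_det\<close>). For \<open>x \<in> E s t\<close> the path runs in \<open>D\<close>, and the exponent is bounded by
    the integral of \<open>sup\<^sub>D \<bar>div f\<bar>\<close>. Hence \<open>\<Phi> s t\<close>, which is injective, changes volumes on \<open>E s t\<close>
    by a bounded factor in either direction (\<open>staying_volume_distortion\<close>). This bounds \<open>P s t\<close>, and the
    estimate of \<open>V\<close> follows with Minkowski's integral inequality.

  \<^item> For each \<open>g\<close> in \<open>L\<^sub>2(D)\<close>, \<open>P s t g\<close> is close to \<open>g\<close> in norm when \<open>t - s\<close> is small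
    (\<open>pull_L2_close\<close>). For continuous functions supported inside \<open>D\<close> this holds because the speed
    is bounded, and these functions are dense.

  \<^item> For each \<open>\<xi>\<close> in \<open>L\<^sub>2(D)\<close>, the inner products of \<open>P s t g\<close> and of \<open>g\<close> with \<open>\<xi>\<close> differ by a small
    multiple of the norm of \<open>g\<close>, uniformly in \<open>g\<close> (\<open>pull_inner_close\<close>). A change of variables
    moves the flow from \<open>g\<close> to a continuous test function, at the price of a volume factor near \<open>1\<close>.

  Both \<open>U\<close> and \<open>V\<close> satisfy \<open>g(s) = P s r (g(r)) + w\<close> for \<open>s \<le> r\<close>, where \<open>w\<close> tends to zero with
  \<open>r - s\<close>; it is zero for \<open>U\<close>, and for \<open>V\<close> it is the integral over \<open>[s, r]\<close>. When \<open>s\<close> increases to a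
  fixed \<open>r\<close>, the second fact applies to the single function \<open>g(r)\<close>: this is strong left-continuity.
  When \<open>r\<close> decreases to a fixed \<open>s\<close>, the function \<open>g(r)\<close> changes as well, and only the third fact is
  uniform enough; it gives weak continuity, from both sides.

  The function \<open>\<phi>\<close> is only Lebesgue measurable. Since the preimages of null sets under \<open>\<Phi> s t\<close> are
  null sets, it can be replaced by a Borel measurable representative (\<open>AE_along_paths\<close>).
\<close>

section \<open>Square-integrable functions\<close>

lemma ennreal_power2_le_imp_le:
  fixes a b :: ennreal
  assumes "a\<^sup>2 \<le> b\<^sup>2"
  shows "a \<le> b"
proof (cases b)
  case (real u)
  then have "a\<^sup>2 \<noteq> top"
    using assms by (auto simp: ennreal_power top_unique)
  then have "a \<noteq> top"
    by (auto simp: power2_eq_square)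
  then obtain v where "a = ennreal v" "0 \<le> v"
    by (cases a) auto
  then show ?thesis
    using assms real by (auto simp: ennreal_power intro: power2_le_imp_le)
qed simp

text \<open>For exponent two Minkowski's integral inequality needs no duality: the square of the inner
  integral is a double integral in \<open>(t, u)\<close>. By Tonelli's theorem the integration in \<open>x\<close> can be
  done first, and the Cauchy--Schwarz inequality bounds its result by \<open>\<beta> t * \<beta> u\<close>.\<close>

lemma nn_integral_Minkowski_square:
  fixes h :: "'a \<times> 'b \<Rightarrow> ennreal"
  assumes "sigma_finite_measure M" "sigma_finite_measure N"
    and h[measurable]: "h \<in> borel_measurable (M \<Otimes>\<^sub>M N)"
    and \<beta>[measurable]: "\<beta> \<in> borel_measurable N"
    and le: "AE t in N. (\<integral>\<^sup>+x. (h (x, t))\<^sup>2 \<partial>M) \<le> (\<beta> t)\<^sup>2"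
  shows "(\<integral>\<^sup>+x. (\<integral>\<^sup>+t. h (x, t) \<partial>N)\<^sup>2 \<partial>M) \<le> (\<integral>\<^sup>+t. \<beta> t \<partial>N)\<^sup>2"
proof -
  interpret M: sigma_finite_measure M by fact
  interpret N: sigma_finite_measure N by fact
  interpret MN: pair_sigma_finite M N ..
  have "(\<integral>\<^sup>+x. (\<integral>\<^sup>+t. h (x, t) \<partial>N)\<^sup>2 \<partial>M)
      = (\<integral>\<^sup>+x. \<integral>\<^sup>+t. \<integral>\<^sup>+u. h (x, t) * h (x, u) \<partial>N \<partial>N \<partial>M)"
  proof (rule nn_integral_cong)
    fix x assume [measurable]: "x \<in> space M"
    show "(\<integral>\<^sup>+t. h (x, t) \<partial>N)\<^sup>2 = (\<integral>\<^sup>+t. \<integral>\<^sup>+u. h (x, t) * h (x, u) \<partial>N \<partial>N)"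
      by (simp add: power2_eq_square nn_integral_cmult nn_integral_multc)
  qed
  also have "\<dots> = (\<integral>\<^sup>+t. \<integral>\<^sup>+x. \<integral>\<^sup>+u. h (x, t) * h (x, u) \<partial>N \<partial>M \<partial>N)"
    by (rule MN.Fubini'[symmetric]) measurable
  also have "\<dots> = (\<integral>\<^sup>+t. \<integral>\<^sup>+u. \<integral>\<^sup>+x. h (x, t) * h (x, u) \<partial>M \<partial>N \<partial>N)"
    by (intro nn_integral_cong MN.Fubini'[symmetric]) measurable
  also have "\<dots> \<le> (\<integral>\<^sup>+t. \<integral>\<^sup>+u. \<beta> t * \<beta> u \<partial>N \<partial>N)"
  proof (rule nn_integral_mono_AE)
    show "AE t in N. (\<integral>\<^sup>+u. \<integral>\<^sup>+x. h (x, t) * h (x, u) \<partial>M \<partial>N) \<le> (\<integral>\<^sup>+u. \<beta> t * \<beta> u \<partial>N)"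
      using le AE_space
    proof eventually_elim
      case t: (elim t)
      show ?case
      proof (rule nn_integral_mono_AE)
        show "AE u in N. (\<integral>\<^sup>+x. h (x, t) * h (x, u) \<partial>M) \<le> \<beta> t * \<beta> u"
          using le AE_space
        proof eventually_elim
          case u: (elim u)
          have [measurable]: "t \<in> space N" "u \<in> space N" by fact+
          have "(\<integral>\<^sup>+x. h (x, t) * h (x, u) \<partial>M)\<^sup>2
              \<le> (\<integral>\<^sup>+x. (h (x, t))\<^sup>2 \<partial>M) * (\<integral>\<^sup>+x. (h (x, u))\<^sup>2 \<partial>M)"
            by (rule Cauchy_Schwarz_nn_integral) measurable
          also have "\<dots> \<le> (\<beta> t)\<^sup>2 * (\<beta> u)\<^sup>2"
            using t u by (intro mult_mono) auto
          finally show ?case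
            by (rule ennreal_power2_le_imp_le[unfolded power_mult_distrib, where b = "\<beta> t * \<beta> u", unfolded power_mult_distrib])
        qed
      qed
    qed
  qed
  also have "\<dots> = (\<integral>\<^sup>+t. \<beta> t \<partial>N)\<^sup>2"
    by (simp add: power2_eq_square nn_integral_cmult nn_integral_multc)
  finally show ?thesis .
qed

lemma L2_nrm_nonneg [simp]: "0 \<le> L2_nrm D g"
  by (simp add: L2_nrm_def)

lemma L2_nrm_power2: "(L2_nrm D g)\<^sup>2 = (LINT x|lebesgue_on D. (g x)\<^sup>2)"
  by (simp add: L2_nrm_def)

lemma nn_integral_power2_L2:
  "in_L2 D g \<Longrightarrow> (\<integral>\<^sup>+x. ennreal ((g x)\<^sup>2) \<partial>lebesgue_on D) = ennreal ((L2_nrm D g)\<^sup>2)"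
  unfolding in_L2_def L2_nrm_power2 by (subst nn_integral_eq_integral) auto

text \<open>Estimates are obtained for nonnegative integrals, which always exist; this lemma turns them into
  square-integrability and a bound of the norm.\<close>

lemma in_L2_bound:
  assumes g: "g \<in> borel_measurable (lebesgue_on D)" and c: "0 \<le> c"
    and le: "(\<integral>\<^sup>+x. ennreal ((g x)\<^sup>2) \<partial>lebesgue_on D) \<le> ennreal (c\<^sup>2)"
  shows "in_L2 D g" "L2_nrm D g \<le> c"
proof -
  have "integrable (lebesgue_on D) (\<lambda>x. (g x)\<^sup>2)"
  proof (rule integrableI_bounded)
    show "(\<integral>\<^sup>+ x. ennreal (norm ((g x)\<^sup>2)) \<partial>lebesgue_on D) < \<infinity>"
      using le by (simp add: le_less_trans ennreal_less_top)
  qed (use g in simp)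
  then show *: "in_L2 D g"
    using g by (simp add: in_L2_def)
  have "ennreal ((L2_nrm D g)\<^sup>2) \<le> ennreal (c\<^sup>2)"
    using le nn_integral_power2_L2[OF *] by simp
  then show "L2_nrm D g \<le> c"
    using c by (auto intro: power2_le_imp_le)
qed

lemma
  assumes g: "in_L2 D g" and h: "in_L2 D h"
  shows L2_mult_integrable: "integrable (lebesgue_on D) (\<lambda>x. g x * h x)"
    and in_L2_add: "in_L2 D (\<lambda>x. g x + h x)"
    and in_L2_diff: "in_L2 D (\<lambda>x. g x - h x)"
proof -
  have [measurable]: "g \<in> borel_measurable (lebesgue_on D)" "h \<in> borel_measurable (lebesgue_on D)"
    and gi: "integrable (lebesgue_on D) (\<lambda>x. (g x)\<^sup>2)" and hi: "integrable (lebesgue_on D) (\<lambda>x. (h x)\<^sup>2)"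
    using g h by (auto simp: in_L2_def)
  show gh: "integrable (lebesgue_on D) (\<lambda>x. g x * h x)"
  proof (rule Bochner_Integration.integrable_bound)
    show "integrable (lebesgue_on D) (\<lambda>x. (g x)\<^sup>2 + (h x)\<^sup>2)"
      using gi hi by simp
    have "\<bar>a * b\<bar> \<le> a\<^sup>2 + b\<^sup>2" for a b :: real
    proof -
      have "2 * (\<bar>a\<bar> * \<bar>b\<bar>) \<le> a\<^sup>2 + b\<^sup>2" "0 \<le> \<bar>a\<bar> * \<bar>b\<bar>"
        using sum_squares_bound[of "\<bar>a\<bar>" "\<bar>b\<bar>"] by (simp_all add: mult.assoc)
      then show ?thesis
        unfolding abs_mult by linarith
    qed
    then show "AE x in lebesgue_on D. norm (g x * h x) \<le> norm ((g x)\<^sup>2 + (h x)\<^sup>2)"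
      by simp
  qed measurable
  show "in_L2 D (\<lambda>x. g x + h x)" "in_L2 D (\<lambda>x. g x - h x)"
    unfolding in_L2_def power2_sum power2_diff using gi hi gh
    by (auto simp: mult.assoc)
qed

lemma L2_inner_add:
  assumes "in_L2 D g" "in_L2 D h" "in_L2 D \<xi>"
  shows "L2_inner D (\<lambda>x. g x + h x) \<xi> = L2_inner D g \<xi> + L2_inner D h \<xi>"
  unfolding L2_inner_def using assms by (simp add: distrib_right L2_mult_integrable)

lemma L2_inner_diff:
  assumes "in_L2 D g" "in_L2 D h" "in_L2 D \<xi>"
  shows "L2_inner D (\<lambda>x. g x - h x) \<xi> = L2_inner D g \<xi> - L2_inner D h \<xi>"
  unfolding L2_inner_def using assms by (simp add: left_diff_distrib L2_mult_integrable)

lemma L2_inner_commute: "L2_inner D g h = L2_inner D h g"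
  by (simp add: L2_inner_def mult.commute)

lemma L2_Cauchy_Schwarz_abs:
  assumes g: "in_L2 D g" and h: "in_L2 D h"
  shows "(LINT x|lebesgue_on D. \<bar>g x * h x\<bar>) \<le> L2_nrm D g * L2_nrm D h"
proof -
  have [measurable]: "g \<in> borel_measurable (lebesgue_on D)" "h \<in> borel_measurable (lebesgue_on D)"
    using g h by (auto simp: in_L2_def)
  have "ennreal ((LINT x|lebesgue_on D. \<bar>g x * h x\<bar>)\<^sup>2)
      = (\<integral>\<^sup>+x. ennreal \<bar>g x\<bar> * ennreal \<bar>h x\<bar> \<partial>lebesgue_on D)\<^sup>2"
    by (simp add: ennreal_power[symmetric] abs_mult ennreal_mult[symmetric]
        nn_integral_eq_integral[OF integrable_abs[OF L2_mult_integrable[OF g h]], unfolded abs_mult])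
  also have "\<dots> \<le> (\<integral>\<^sup>+x. (ennreal \<bar>g x\<bar>)\<^sup>2 \<partial>lebesgue_on D) * (\<integral>\<^sup>+x. (ennreal \<bar>h x\<bar>)\<^sup>2 \<partial>lebesgue_on D)"
    by (rule Cauchy_Schwarz_nn_integral) measurable
  also have "\<dots> = ennreal ((L2_nrm D g * L2_nrm D h)\<^sup>2)"
    using nn_integral_power2_L2[OF g] nn_integral_power2_L2[OF h]
    by (simp add: ennreal_power power_mult_distrib ennreal_mult)
  finally have "(LINT x|lebesgue_on D. \<bar>g x * h x\<bar>)\<^sup>2 \<le> (L2_nrm D g * L2_nrm D h)\<^sup>2"
    by (simp add: ennreal_le_iff)
  then show ?thesis
    by (rule power2_le_imp_le) simp
qed

lemma L2_Cauchy_Schwarz: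
  assumes "in_L2 D g" "in_L2 D h"
  shows "\<bar>L2_inner D g h\<bar> \<le> L2_nrm D g * L2_nrm D h"
  unfolding L2_inner_def
  by (rule order_trans[OF integral_abs_bound L2_Cauchy_Schwarz_abs[OF assms]])

lemma L2_nrm_minus: "L2_nrm D (\<lambda>x. - g x) = L2_nrm D g"
  by (simp add: L2_nrm_def)

lemma L2_nrm_triangle:
  assumes g: "in_L2 D g" and h: "in_L2 D h"
  shows "L2_nrm D (\<lambda>x. g x + h x) \<le> L2_nrm D g + L2_nrm D h"
proof (rule power2_le_imp_le)
  have "(L2_nrm D (\<lambda>x. g x + h x))\<^sup>2 = (L2_nrm D g)\<^sup>2 + 2 * L2_inner D g h + (L2_nrm D h)\<^sup>2"
    unfolding L2_nrm_power2 L2_inner_def power2_sum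
    using g h L2_mult_integrable[OF g h] by (simp add: in_L2_def mult.assoc)
  also have "\<dots> \<le> (L2_nrm D g)\<^sup>2 + 2 * (L2_nrm D g * L2_nrm D h) + (L2_nrm D h)\<^sup>2"
    using L2_Cauchy_Schwarz[OF g h] by simp
  finally show "(L2_nrm D (\<lambda>x. g x + h x))\<^sup>2 \<le> (L2_nrm D g + L2_nrm D h)\<^sup>2"
    by (simp add: power2_sum)
qed simp

lemma L2_nrm_triangle_diff:
  assumes "in_L2 D g" "in_L2 D h"
  shows "L2_nrm D (\<lambda>x. g x - h x) \<le> L2_nrm D g + L2_nrm D h"
  using L2_nrm_triangle[of D g "\<lambda>x. - h x"] assms by (simp add: L2_nrm_minus in_L2_def)

lemma lebesgue_on_measurable_AE_cong:
  fixes g h :: "'a::euclidean_space \<Rightarrow> real"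
  assumes D: "D \<in> sets lebesgue" and g: "g \<in> borel_measurable (lebesgue_on D)"
    and eq: "AE x in lebesgue_on D. g x = h x"
  shows "h \<in> borel_measurable (lebesgue_on D)"
proof -
  have "(\<lambda>x. if x \<in> D then g x else 0) \<in> borel_measurable lebesgue"
    using g D by (subst borel_measurable_if) auto
  moreover have "AE x in lebesgue. (if x \<in> D then g x else 0) = (if x \<in> D then h x else 0)"
    using eq D by (auto simp: AE_restrict_space_iff elim: eventually_mono)
  ultimately have "(\<lambda>x. if x \<in> D then h x else 0) \<in> borel_measurable lebesgue"
    by (rule borel_measurable_AE)
  then show ?thesis
    using D by (subst (asm) borel_measurable_if) auto
qed

lemma L2_AE_cong:
  fixes g h :: "'a::euclidean_space \<Rightarrow> real"
  assumes D: "D \<in> sets lebesgue" and g: "g \<in> borel_measurable (lebesgue_on D)"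
    and eq: "AE x in lebesgue_on D. g x = h x"
  shows "in_L2 D g \<longleftrightarrow> in_L2 D h" "L2_nrm D g = L2_nrm D h"
    "in_L2 D \<xi> \<Longrightarrow> L2_inner D g \<xi> = L2_inner D h \<xi>"
proof -
  note [measurable] = g lebesgue_on_measurable_AE_cong[OF assms]
  have eq2: "AE x in lebesgue_on D. (g x)\<^sup>2 = (h x)\<^sup>2"
    using eq by eventually_elim simp
  show "in_L2 D g \<longleftrightarrow> in_L2 D h"
    unfolding in_L2_def using eq2 by (subst integrable_cong_AE[OF _ _ eq2]) auto
  show "L2_nrm D g = L2_nrm D h"
    unfolding L2_nrm_def by (subst integral_cong_AE[OF _ _ eq2]) auto
  assume "in_L2 D \<xi>"
  then have [measurable]: "\<xi> \<in> borel_measurable (lebesgue_on D)"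
    by (simp add: in_L2_def)
  show "L2_inner D g \<xi> = L2_inner D h \<xi>"
    unfolding L2_inner_def by (rule integral_cong_AE) (use eq in auto)
qed

text \<open>Both notions of continuity depend only on the sections modulo null sets. The proofs can therefore
  work with Borel measurable representatives, which can be composed with continuous maps.\<close>

lemma weakly_continuous_L2_AE_cong:
  fixes g h :: "'a::euclidean_space \<Rightarrow> real \<Rightarrow> real"
  assumes D: "D \<in> sets lebesgue" and g: "weakly_continuous_L2 D T g"
    and eq: "\<And>s. s \<in> {0..T} \<Longrightarrow> AE x in lebesgue_on D. g x s = h x s"
  shows "weakly_continuous_L2 D T h"
proof -
  have gL: "in_L2 D (\<lambda>x. g x s)" if "s \<in> {0..T}" for s
    using g that by (auto simp: weakly_continuous_L2_def)
  have gm: "(\<lambda>x. g x s) \<in> borel_measurable (lebesgue_on D)" if "s \<in> {0..T}" for s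
    using gL[OF that] by (simp add: in_L2_def)
  have "continuous_on {0..T} (\<lambda>s. L2_inner D (\<lambda>x. h x s) \<xi>)" if \<xi>: "in_L2 D \<xi>" for \<xi>
  proof -
    have "continuous_on {0..T} (\<lambda>s. L2_inner D (\<lambda>x. g x s) \<xi>)"
      using g \<xi> by (simp add: weakly_continuous_L2_def)
    then show ?thesis
      by (rule continuous_on_eq) (rule L2_AE_cong(3)[OF D gm eq \<xi>])
  qed
  then show ?thesis
    unfolding weakly_continuous_L2_def using L2_AE_cong(1)[OF D gm eq] gL by blast
qed

lemma strongly_left_continuous_L2_AE_cong:
  fixes g h :: "'a::euclidean_space \<Rightarrow> real \<Rightarrow> real"
  assumes D: "D \<in> sets lebesgue" and g: "strongly_left_continuous_L2 D T g"
    and eq: "\<And>s. s \<in> {0..T} \<Longrightarrow> AE x in lebesgue_on D. g x s = h x s"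
  shows "strongly_left_continuous_L2 D T h"
proof -
  have gL: "in_L2 D (\<lambda>x. g x s)" if "s \<in> {0..T}" for s
    using g that by (auto simp: strongly_left_continuous_L2_def)
  have gm: "(\<lambda>x. g x s) \<in> borel_measurable (lebesgue_on D)" if "s \<in> {0..T}" for s
    using gL[OF that] by (simp add: in_L2_def)
  have "((\<lambda>s. L2_nrm D (\<lambda>x. h x s - h x \<theta>)) \<longlongrightarrow> 0) (at_left \<theta>)" if \<theta>: "\<theta> \<in> {0<..T}" for \<theta>
  proof -
    have "((\<lambda>s. L2_nrm D (\<lambda>x. g x s - g x \<theta>)) \<longlongrightarrow> 0) (at_left \<theta>)"
      using g \<theta> by (auto simp: strongly_left_continuous_L2_def)
    then show ?thesis
    proof (rule Lim_transform_eventually)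
      show "\<forall>\<^sub>F s in at_left \<theta>. L2_nrm D (\<lambda>x. g x s - g x \<theta>) = L2_nrm D (\<lambda>x. h x s - h x \<theta>)"
      proof (rule eventually_mono[OF eventually_at_left_real[of 0 \<theta>]])
        show "0 < \<theta>" using \<theta> by simp
      next
        fix s assume s: "s \<in> {0<..<\<theta>}"
        have "AE x in lebesgue_on D. g x s = h x s" "AE x in lebesgue_on D. g x \<theta> = h x \<theta>"
          using eq s \<theta> by auto
        then have "AE x in lebesgue_on D. g x s - g x \<theta> = h x s - h x \<theta>"
          by eventually_elim simp
        then show "L2_nrm D (\<lambda>x. g x s - g x \<theta>) = L2_nrm D (\<lambda>x. h x s - h x \<theta>)"
          using gm[of s] gm[of \<theta>] s \<theta> by (intro L2_AE_cong(2)[OF D]) auto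
      qed
    qed
  qed
  moreover have "in_L2 D (\<lambda>x. h x s)" if "s \<in> {0..T}" for s
    using L2_AE_cong(1)[OF D gm[OF that] eq[OF that]] gL[OF that] by simp
  ultimately show ?thesis
    unfolding strongly_left_continuous_L2_def by blast
qed

lemma L2_nrm_tendsto_0_dominated:
  fixes g :: "'a::euclidean_space \<Rightarrow> real" and k :: "nat \<Rightarrow> 'a \<Rightarrow> real"
  assumes [measurable]: "g \<in> borel_measurable (lebesgue_on D)"
      "\<And>n. k n \<in> borel_measurable (lebesgue_on D)"
    and lim: "AE x in lebesgue_on D. (\<lambda>n. k n x) \<longlonglongrightarrow> g x"
    and w: "in_L2 D w"
    and le: "\<And>n. AE x in lebesgue_on D. \<bar>g x - k n x\<bar> \<le> \<bar>w x\<bar>"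
  shows "(\<lambda>n. L2_nrm D (\<lambda>x. g x - k n x)) \<longlonglongrightarrow> 0"
proof -
  have "(\<lambda>n. LINT x|lebesgue_on D. (g x - k n x)\<^sup>2) \<longlonglongrightarrow> (LINT x|lebesgue_on D. 0)"
  proof (rule integral_dominated_convergence)
    show "integrable (lebesgue_on D) (\<lambda>x. (w x)\<^sup>2)"
      using w by (simp add: in_L2_def)
    show "AE x in lebesgue_on D. (\<lambda>n. (g x - k n x)\<^sup>2) \<longlonglongrightarrow> 0"
      using lim
    proof eventually_elim
      case (elim x)
      have "(\<lambda>n. (g x - k n x)\<^sup>2) \<longlonglongrightarrow> (g x - g x)\<^sup>2"
        by (intro tendsto_intros elim)
      then show ?case by simp
    qed
    show "AE x in lebesgue_on D. norm ((g x - k n x)\<^sup>2) \<le> (w x)\<^sup>2" for n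
      using le[of n] by eventually_elim (simp add: abs_le_square_iff)
  qed measurable
  from tendsto_real_sqrt[OF this] show ?thesis
    by (simp add: L2_nrm_def)
qed

lemma in_L2_bounded:
  fixes k :: "'a::euclidean_space \<Rightarrow> real"
  assumes D: "D \<in> lmeasurable" and [measurable]: "k \<in> borel_measurable (lebesgue_on D)"
    and le: "\<And>x. x \<in> D \<Longrightarrow> \<bar>k x\<bar> \<le> c"
  shows "in_L2 D k"
  unfolding in_L2_def
proof
  interpret finite_measure "lebesgue_on D"
    by (rule finite_measure_lebesgue_on[OF D])
  show "integrable (lebesgue_on D) (\<lambda>x. (k x)\<^sup>2)"
  proof (rule integrable_const_bound)
    show "AE x in lebesgue_on D. norm ((k x)\<^sup>2) \<le> c\<^sup>2"
    proof (rule AE_I2)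
      fix x assume "x \<in> space (lebesgue_on D)"
      then have "\<bar>k x\<bar> \<le> c" using le by simp
      then show "norm ((k x)\<^sup>2) \<le> c\<^sup>2"
        using power_mono[of "\<bar>k x\<bar>" c 2] by simp
    qed
  qed measurable
qed fact

text \<open>The distance of the support to the complement of \<open>D\<close> is expressed with closed balls because it
  is compared with bounds on the displacement of points.\<close>

definition compactly_inside :: "'a::euclidean_space set \<Rightarrow> ('a \<Rightarrow> real) \<Rightarrow> bool" where
  "compactly_inside D k \<longleftrightarrow>
     continuous_on UNIV k \<and> (\<exists>\<epsilon>>0. \<forall>x. \<not> cball x \<epsilon> \<subseteq> D \<longrightarrow> k x = 0)"

lemma compactly_inside_bounded:
  fixes D :: "'a::euclidean_space set"
  assumes "bounded D" "compactly_inside D k"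
  obtains c where "0 \<le> c" "\<And>x. \<bar>k x\<bar> \<le> c"
proof -
  obtain \<epsilon> where k: "continuous_on UNIV k" and \<epsilon>: "0 < \<epsilon>" "\<And>x. \<not> cball x \<epsilon> \<subseteq> D \<Longrightarrow> k x = 0"
    using assms(2) by (auto simp: compactly_inside_def)
  have "compact (k ` closure D)"
    using assms(1) k by (intro compact_continuous_image) (auto intro: continuous_on_subset)
  then obtain c where c: "\<And>x. x \<in> closure D \<Longrightarrow> \<bar>k x\<bar> \<le> c"
    by (metis bounded_real compact_imp_bounded imageI)
  have "\<bar>k x\<bar> \<le> max c 0" for x
  proof (cases "x \<in> D")
    case True
    then show ?thesis using c[of x] closure_subset[of D] by auto
  next
    case False
    then have "\<not> cball x \<epsilon> \<subseteq> D" using \<epsilon>(1) by (meson centre_in_cball less_imp_le subsetD)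
    then show ?thesis using \<epsilon>(2) by simp
  qed
  then show ?thesis using that[of "max c 0"] by simp
qed

lemma compactly_inside_in_L2:
  fixes D :: "'a::euclidean_space set"
  assumes "open D" "bounded D" "compactly_inside D k"
  shows "in_L2 D k"
proof -
  obtain c where "\<And>x. \<bar>k x\<bar> \<le> c"
    using compactly_inside_bounded[OF assms(2,3)] by blast
  moreover have "k \<in> borel_measurable (lebesgue_on D)"
    using assms(1,3) by (intro continuous_imp_measurable_on_sets_lebesgue)
      (auto simp: compactly_inside_def intro: continuous_on_subset)
  ultimately show ?thesis
    using assms by (intro in_L2_bounded) (auto intro: lmeasurable_open)
qed

text \<open>Truncation reduces the claim to bounded functions. A measurable function is an almost everywhere
  limit of continuous functions; truncated at the same level and multiplied by cutoff functions
  they converge in \<open>L\<^sub>2(D)\<close> by dominated convergence, as \<open>D\<close> has finite measure.\<close>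

lemma compactly_inside_dense_in_L2:
  fixes D :: "'a::euclidean_space set"
  assumes D: "open D" "bounded D" and g: "in_L2 D g" and e: "0 < e"
  obtains k where "compactly_inside D k" "L2_nrm D (\<lambda>x. g x - k x) < e"
proof -
  have Dl: "D \<in> lmeasurable" using D by (rule lmeasurable_open[rotated])
  then have Ds: "D \<in> sets lebesgue" by blast
  have gm[measurable]: "g \<in> borel_measurable (lebesgue_on D)" using g by (simp add: in_L2_def)
  define clamp where "clamp m r = max (- m) (min m r)" for m r :: real
  have clamp_cont: "continuous_on UNIV (clamp m)" for m
    unfolding clamp_def by (intro continuous_intros)
  have [measurable]: "clamp m \<in> borel_measurable borel" for m
    using clamp_cont by (rule borel_measurable_continuous_onI)
  have "(\<lambda>m. L2_nrm D (\<lambda>x. g x - clamp (real m) (g x))) \<longlonglongrightarrow> 0"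
  proof (rule L2_nrm_tendsto_0_dominated[OF gm _ _ g])
    show "AE x in lebesgue_on D. (\<lambda>m. clamp (real m) (g x)) \<longlonglongrightarrow> g x"
    proof (rule AE_I2, rule tendsto_eventually)
      fix x
      show "\<forall>\<^sub>F m in sequentially. clamp (real m) (g x) = g x"
        using eventually_ge_at_top[of "nat \<lceil>\<bar>g x\<bar>\<rceil>"]
      proof eventually_elim
        case (elim m)
        then have "\<bar>g x\<bar> \<le> real m" by linarith
        then show ?case by (auto simp: clamp_def)
      qed
    qed
    show "AE x in lebesgue_on D. \<bar>g x - clamp (real m) (g x)\<bar> \<le> \<bar>g x\<bar>" for m
      by (rule AE_I2) (auto simp: clamp_def min_def max_def)
  qed measurable
  then obtain m where m: "L2_nrm D (\<lambda>x. g x - clamp (real m) (g x)) < e / 2"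
    using order_tendstoD(2)[of _ 0 sequentially "e / 2"] e by (force simp: eventually_sequentially)
  let ?g = "\<lambda>x. clamp (real m) (g x)"
  obtain N G where N: "negligible N" and G: "\<And>n::nat. continuous_on UNIV (G n)"
    and lim: "\<And>x. x \<notin> N \<Longrightarrow> (\<lambda>n. G n x) \<longlonglongrightarrow> (if x \<in> D then g x else 0)"
    using gm unfolding measurable_on_iff_borel_measurable[OF Ds, symmetric] measurable_on_def by blast
  have "D \<noteq> UNIV" using D(2) not_bounded_UNIV by metis
  then have "- D \<noteq> {}" by blast
  have "closed (- D)" using D(1) by auto
  \<comment> \<open>zero at distance at most \<open>1 / n\<close> from the complement, one at distance at least \<open>2 / n\<close>\<close>
  define cutoff where "cutoff n x = min 1 (max 0 (real n * infdist x (- D) - 1))" for n x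
  have cutoff_cont: "continuous_on UNIV (cutoff n)" for n
    unfolding cutoff_def by (intro continuous_intros)
  have cutoff_lim: "(\<lambda>n. cutoff n x) \<longlonglongrightarrow> 1" if "x \<in> D" for x
  proof (rule tendsto_eventually)
    have pos: "infdist x (- D) > 0"
      using that \<open>- D \<noteq> {}\<close> \<open>closed (- D)\<close> infdist_pos_not_in_closed by blast
    show "\<forall>\<^sub>F n in sequentially. cutoff n x = 1"
      using eventually_ge_at_top[of "nat \<lceil>2 / infdist x (- D)\<rceil>"]
    proof eventually_elim
      case (elim n)
      then have "2 / infdist x (- D) \<le> real n" by linarith
      then show ?case using pos by (simp add: cutoff_def field_simps)
    qed
  qed
  define k where "k n x = cutoff n x * clamp (real m) (G n x)" for n x
  have inside: "compactly_inside D (k n)" if "n > 0" for n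
    unfolding compactly_inside_def
  proof (intro conjI exI[of _ "1 / real n"] allI impI)
    show "continuous_on UNIV (k n)"
      unfolding k_def by (intro continuous_intros cutoff_cont continuous_on_compose2[OF clamp_cont] G) auto
    fix x assume "\<not> cball x (1 / real n) \<subseteq> D"
    then obtain z where "dist x z \<le> 1 / real n" "z \<in> - D" by (auto simp: subset_iff)
    then have "infdist x (- D) \<le> 1 / real n" using infdist_le2 by blast
    then show "k n x = 0" using that by (simp add: k_def cutoff_def field_simps)
  qed (use that in simp)
  have [measurable]: "k n \<in> borel_measurable (lebesgue_on D)" for n
  proof -
    have "continuous_on D (k n)"
      unfolding k_def using cutoff_cont G clamp_cont
      by (intro continuous_intros continuous_on_compose2[OF clamp_cont])
        (auto intro: continuous_on_subset)
    then show ?thesis using Ds by (rule continuous_imp_measurable_on_sets_lebesgue)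
  qed
  have "(\<lambda>n. L2_nrm D (\<lambda>x. ?g x - k n x)) \<longlonglongrightarrow> 0"
  proof (rule L2_nrm_tendsto_0_dominated)
    show "in_L2 D (\<lambda>x. 2 * real m)"
      by (rule in_L2_bounded[OF Dl, where c = "2 * real m"]) auto
    have "AE x in lebesgue_on D. x \<notin> N"
      using AE_not_in[of N lebesgue] N Ds by (auto simp: AE_restrict_space_iff negligible_iff_null_sets elim: eventually_mono)
    then show "AE x in lebesgue_on D. (\<lambda>n. k n x) \<longlonglongrightarrow> ?g x"
      using AE_space
    proof eventually_elim
      case (elim x)
      have "(\<lambda>n. k n x) \<longlonglongrightarrow> 1 * clamp (real m) (g x)"
        unfolding k_def using elim lim[of x] cutoff_lim[of x]
        by (intro tendsto_mult continuous_on_tendsto_compose[OF clamp_cont]) auto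
      then show ?case by simp
    qed
    show "AE x in lebesgue_on D. \<bar>?g x - k n x\<bar> \<le> \<bar>2 * real m\<bar>" for n
    proof (rule AE_I2)
      fix x
      have 1: "\<bar>clamp (real m) r\<bar> \<le> real m" for r by (auto simp: clamp_def)
      have 2: "0 \<le> cutoff n x" "cutoff n x \<le> 1" by (auto simp: cutoff_def)
      have "\<bar>k n x\<bar> \<le> 1 * real m"
        unfolding k_def abs_mult using 1 2 by (intro mult_mono) auto
      then show "\<bar>?g x - k n x\<bar> \<le> \<bar>2 * real m\<bar>"
        using 1[of "g x"] by linarith
    qed
  qed measurable
  then have "\<forall>\<^sub>F n in sequentially. L2_nrm D (\<lambda>x. ?g x - k n x) < e / 2"
    using order_tendstoD(2)[of _ 0 sequentially "e / 2"] e by simp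
  then obtain n where n: "n > 0" "L2_nrm D (\<lambda>x. ?g x - k n x) < e / 2"
    using eventually_conj[OF eventually_gt_at_top[of "0::nat"]] eventually_happens'[of sequentially]
    by (metis (mono_tags, lifting) sequentially_bot)
  have g2: "in_L2 D ?g"
    by (rule in_L2_bounded[OF Dl, where c = "real m"]) (measurable, auto simp: clamp_def)
  have "L2_nrm D (\<lambda>x. (g x - ?g x) + (?g x - k n x))
      \<le> L2_nrm D (\<lambda>x. g x - ?g x) + L2_nrm D (\<lambda>x. ?g x - k n x)"
    using g g2 compactly_inside_in_L2[OF D inside[OF n(1)]] by (intro L2_nrm_triangle in_L2_diff)
  then have "L2_nrm D (\<lambda>x. g x - k n x) < e"
    using m n(2) by simp
  then show ?thesis using that inside[OF n(1)] by blast
qed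

section \<open>Volumes of differentiable images over an arbitrary finite index type\<close>

text \<open>The change of variables theorem speaks of vectors over a well-ordered finite index type. This
  copy of an arbitrary finite type has such an order.\<close>

typedef (overloaded) ('n::finite) idx = "{..<CARD('n)}"
  by (rule exI[of _ 0]) simp

instantiation idx :: (finite) wellorder
begin

definition less_eq_idx where "i \<le> j \<longleftrightarrow> Rep_idx i \<le> Rep_idx j"
definition less_idx where "i < j \<longleftrightarrow> Rep_idx i < Rep_idx j"

instance
proof
  fix P :: "'a idx \<Rightarrow> bool" and a
  assume step: "\<And>x. (\<And>y. y < x \<Longrightarrow> P y) \<Longrightarrow> P x"
  show "P a"
    by (induction "Rep_idx a" arbitrary: a rule: less_induct) (auto intro: step simp: less_idx_def)
qed (auto simp: less_eq_idx_def less_idx_def Rep_idx_inject)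

end

lemma bij_Rep_idx: "bij_betw (Rep_idx :: 'n::finite idx \<Rightarrow> nat) UNIV {..<CARD('n)}"
  by (rule bij_betwI[where g = Abs_idx]) (use Rep_idx in \<open>auto simp: Rep_idx_inverse Abs_idx_inverse\<close>)

instance idx :: (finite) finite
proof
  have "bij_betw (Rep_idx :: 'a idx \<Rightarrow> nat) UNIV {..<CARD('a)}"
    by (rule bij_Rep_idx)
  then show "finite (UNIV :: 'a idx set)"
    using bij_betw_finite by blast
qed

lemma ex_bij_idx: "\<exists>e :: 'n::finite idx \<Rightarrow> 'n. bij e"
proof -
  have "bij_betw (Rep_idx :: 'n idx \<Rightarrow> nat) UNIV {..<CARD('n)}"
    by (rule bij_Rep_idx)
  then have "CARD('n idx) = CARD('n)"
    by (simp add: bij_betw_same_card)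
  then show ?thesis
    by (intro finite_same_card_bij) auto
qed

definition reindex :: "('m \<Rightarrow> 'n) \<Rightarrow> 'a^'n \<Rightarrow> 'a^'m" where
  "reindex e x = (\<chi> i. x $ e i)"

lemma reindex_nth [simp]: "reindex e x $ i = x $ e i"
  by (simp add: reindex_def)

lemma linear_reindex: "linear (reindex e :: real^'n \<Rightarrow> real^'m)"
  by (intro linearI) (simp_all add: vec_eq_iff)

lemma reindex_reindex_inv:
  assumes "bij e"
  shows "reindex e (reindex (inv e) x) = x" "reindex (inv e) (reindex e z) = z"
  using assms by (simp_all add: vec_eq_iff bij_is_inj bij_is_surj surj_f_inv_f)

text \<open>A renaming of coordinates maps boxes to boxes with the same side lengths.\<close>

lemma lborel_distr_reindex:
  fixes e :: "'m::finite \<Rightarrow> 'n::finite"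
  assumes e: "bij e"
  shows "distr lborel borel (reindex e :: real^'n \<Rightarrow> real^'m) = lborel"
proof (rule lborel_eqI[symmetric])
  have cont: "continuous_on UNIV (reindex e :: real^'n \<Rightarrow> real^'m)"
    by (rule linear_continuous_on) (simp add: linear_conv_bounded_linear[symmetric] linear_reindex)
  then have [measurable]: "(reindex e :: real^'n \<Rightarrow> real^'m) \<in> borel_measurable borel"
    by (rule borel_measurable_continuous_onI)
  fix l u :: "real^'m"
  assume lu: "\<And>b. b \<in> Basis \<Longrightarrow> l \<bullet> b \<le> u \<bullet> b"
  have le: "l $ i \<le> u $ i" for i
    using lu[of "axis i 1"] by (simp add: axis_in_Basis_iff inner_axis)
  have box: "(reindex e :: real^'n \<Rightarrow> real^'m) -` box l u = box (reindex (inv e) l) (reindex (inv e) u)"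
    using e by (auto simp: mem_box_cart) (metis bij_inv_eq_iff)+
  have "emeasure (distr lborel borel (reindex e)) (box l u)
      = emeasure lborel (box (reindex (inv e) l) (reindex (inv e) u))"
    by (simp add: emeasure_distr box)
  also have "\<dots> = ennreal (\<Prod>b\<in>Basis. (reindex (inv e) u - reindex (inv e) l) \<bullet> b)"
    by (rule emeasure_lborel_box) (auto simp: Basis_vec_def inner_axis le)
  also have "(\<Prod>b\<in>Basis. (reindex (inv e) u - reindex (inv e) l :: real^'n) \<bullet> b)
      = (\<Prod>i\<in>UNIV. u $ inv e i - l $ inv e i)"
    by (simp add: Basis_vec_def prod.UNION_disjoint axis_eq_axis inner_axis
        prod.reindex[of "\<lambda>i. axis i 1" UNIV, unfolded inj_on_def] UNION_singleton_eq_range)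
  also have "\<dots> = (\<Prod>i\<in>UNIV. u $ i - l $ i)"
    using e by (intro prod.reindex_bij_betw bij_imp_bij_inv)
  also have "\<dots> = (\<Prod>b\<in>Basis. (u - l) \<bullet> b)"
    by (simp add: Basis_vec_def axis_eq_axis inner_axis
        prod.reindex[of "\<lambda>i. axis i 1" UNIV, unfolded inj_on_def] UNION_singleton_eq_range)
  finally show "emeasure (distr lborel borel (reindex e)) (box l u) = ennreal (\<Prod>b\<in>Basis. (u - l) \<bullet> b)" .
qed simp

text \<open>Conjugation with a renaming of the coordinates leads to a map of vectors over a well-ordered index
  type, to which the change of variables theorem applies. The hypothesis is therefore about the
  determinant of the renamed derivative.\<close>

lemma measure_image_two_sided:
  fixes g :: "real^'n::finite \<Rightarrow> real^'n" and L :: "real^'n \<Rightarrow> real^'n \<Rightarrow> real^'n"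
    and e :: "'n idx \<Rightarrow> 'n"
  assumes e: "bij e"
    and B: "B \<in> sets borel" "bounded B" and gB: "g ` B \<in> sets borel" "bounded (g ` B)"
    and der: "\<And>x. x \<in> B \<Longrightarrow> (g has_derivative L x) (at x within B)" and inj: "inj_on g B"
    and c: "0 \<le> c1" "\<And>x. x \<in> B \<Longrightarrow> c1 \<le> \<bar>det (matrix (reindex e \<circ> L x \<circ> reindex (inv e)))\<bar>"
      "\<And>x. x \<in> B \<Longrightarrow> \<bar>det (matrix (reindex e \<circ> L x \<circ> reindex (inv e)))\<bar> \<le> c2"
  shows "c1 * measure lborel B \<le> measure lborel (g ` B)"
    "measure lborel (g ` B) \<le> c2 * measure lborel B"
proof -
  let ?p = "reindex e :: real^'n \<Rightarrow> real^('n idx)" and ?q = "reindex (inv e) :: real^('n idx) \<Rightarrow> real^'n"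
  have pq [simp]: "?p (?q x) = x" "?q (?p z) = z" for x z
    using reindex_reindex_inv[OF e] by auto
  have bl: "bounded_linear ?p" "bounded_linear ?q"
    by (simp_all add: linear_conv_bounded_linear[symmetric] linear_reindex)
  have [measurable]: "?p \<in> borel_measurable borel" "?q \<in> borel_measurable borel"
    using bl by (auto intro!: borel_measurable_continuous_onI linear_continuous_on)
  have im: "?p ` S = ?q -` S" for S
    by (auto simp: image_iff) (metis pq(1))
  have sets: "?p ` S \<in> sets borel" if "S \<in> sets borel" for S
    unfolding im using measurable_sets[of ?q borel borel S] that by simp
  have meas: "measure lborel (?p ` S) = measure lborel S" if "S \<in> sets borel" for S
  proof -
    have "measure lborel S = measure (distr lborel borel ?q) S"
      using lborel_distr_reindex[OF bij_imp_bij_inv[OF e]] by simp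
    also have "\<dots> = measure lborel (?q -` S)"
      using that by (simp add: measure_distr)
    finally show ?thesis
      by (simp add: im)
  qed
  let ?h = "?p \<circ> g \<circ> ?q" and ?h' = "\<lambda>z. ?p \<circ> L (?q z) \<circ> ?q"
  have hB: "?h ` (?p ` B) = ?p ` (g ` B)"
    by (simp add: image_comp comp_def)
  have der': "(?h has_derivative ?h' z) (at z within ?p ` B)" if "z \<in> ?p ` B" for z
  proof -
    have "(g has_derivative L (?q z)) (at (?q z) within ?q ` (?p ` B))"
      using der[of "?q z"] that by (auto simp: image_comp comp_def)
    then have "(g \<circ> ?q has_derivative L (?q z) \<circ> ?q) (at z within ?p ` B)"
      by (intro diff_chain_within[OF bounded_linear_imp_has_derivative[OF bl(2)]])
    from diff_chain_within[OF this bounded_linear_imp_has_derivative[OF bl(1)]] show ?thesis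
      by (simp add: comp_assoc)
  qed
  have inj': "inj_on ?h (?p ` B)"
    using inj by (auto simp: inj_on_def) (metis pq(2))
  have fin: "?h ` (?p ` B) \<in> lmeasurable" "?p ` B \<in> lmeasurable"
    unfolding hB using sets[OF gB(1)] sets[OF B(1)] bounded_linear_image[OF gB(2) bl(1)] bounded_linear_image[OF B(2) bl(1)]
    by (auto intro!: bounded_set_imp_lmeasurable)
  define m where "m = measure lebesgue (?h ` (?p ` B))"
  have int: "((\<lambda>x. \<bar>det (matrix (?h' x))\<bar>) has_integral m) (?p ` B)"
    using has_measure_differentiable_image[OF _ der' inj', of m] fin m_def by (simp add: fmeasurableD)
  have m: "m = measure lborel (g ` B)"
    unfolding m_def hB using sets[OF gB(1)] meas[OF gB(1)] by simp
  have const: "((\<lambda>x. c) has_integral c * measure lborel B) (?p ` B)" for c :: real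
    using has_integral_mult_right[OF has_integral_measure_lborel[OF sets[OF B(1)]], of c]
      bounded_linear_image[OF B(2) bl(1)] meas[OF B(1)]
    by (auto simp: less_top[symmetric] dest: emeasure_bounded_finite)
  show "c1 * measure lborel B \<le> measure lborel (g ` B)"
    unfolding m[symmetric] by (rule has_integral_le[OF const int]) (use c(2) in auto)
  show "measure lborel (g ` B) \<le> c2 * measure lborel B"
    unfolding m[symmetric] by (rule has_integral_le[OF int const]) (use c(3) in auto)
qed


lemma matrix_reindex_conj:
  fixes L :: "real^'n \<Rightarrow> real^'n" and e :: "'m::finite \<Rightarrow> 'n::finite"
  assumes "bij e"
  shows "matrix (reindex e \<circ> L \<circ> reindex (inv e)) = (\<chi> i j. L (axis (e j) 1) $ e i)"
proof -
  have "reindex (inv e) (axis j 1 :: real^'m) = axis (e j) 1" for j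
    using assms by (auto simp: vec_eq_iff axis_def bij_is_surj surj_f_inv_f bij_is_inj)
  then show ?thesis
    by (simp add: matrix_def)
qed

section \<open>Partial derivatives, determinants and differential inequalities\<close>

text \<open>The increment is built up one coordinate at a time, by induction over the set of the coordinates
  used so far. The mean value theorem compares each step with the partial derivative at \<open>x\<close>, to
  which the partial derivative at the intermediate point is close by continuity.\<close>

lemma has_derivative_of_continuous_partials:
  fixes g :: "real^'n \<Rightarrow> real"
  assumes part: "\<And>j x. has_partial_deriv g j x"
    and cont: "\<And>j. continuous_on UNIV (partial_deriv g j)"
  shows "(g has_derivative (\<lambda>h. \<Sum>j\<in>UNIV. partial_deriv g j x * h $ j)) (at x)"
proof -
  have deriv: "((\<lambda>t. g (w + t *\<^sub>R axis j 1)) has_real_derivative partial_deriv g j (w + t *\<^sub>R axis j 1)) (at t)"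
    for w t j
  proof -
    have "(\<lambda>h. g ((w + t *\<^sub>R axis j 1) + h *\<^sub>R axis j 1)) differentiable (at 0)"
      using part[of j "w + t *\<^sub>R axis j 1"] unfolding has_partial_deriv_def .
    then have "((\<lambda>h. g ((w + t *\<^sub>R axis j 1) + h *\<^sub>R axis j 1)) has_real_derivative
        partial_deriv g j (w + t *\<^sub>R axis j 1)) (at 0)"
      unfolding partial_deriv_def by (metis DERIV_deriv_iff_real_differentiable)
    then have "((\<lambda>h. g (w + (h + t) *\<^sub>R axis j 1)) has_real_derivative
        partial_deriv g j (w + t *\<^sub>R axis j 1)) (at 0)"
      by (simp add: algebra_simps)
    then show ?thesis
      using DERIV_at_within_shift[of "\<lambda>s. g (w + s *\<^sub>R axis j 1)" _ t 0 UNIV]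
      by (simp add: add.commute)
  qed
  \<comment> \<open>\<open>P S h\<close> keeps the coordinates of \<open>h\<close> that belong to \<open>S\<close>\<close>
  define P :: "'n set \<Rightarrow> real^'n \<Rightarrow> real^'n" where "P S h = (\<chi> j. if j \<in> S then h $ j else 0)" for S h
  have "\<forall>\<epsilon>>0. \<exists>d>0. \<forall>h. norm h < d \<longrightarrow>
      \<bar>g (x + P S h) - g x - (\<Sum>j\<in>S. partial_deriv g j x * h $ j)\<bar> \<le> \<epsilon> * norm h" for S
    using finite[of S]
  proof (induction S rule: finite_induct)
    case empty
    have "P {} h = 0" for h by (simp add: P_def vec_eq_iff)
    then show ?case by (auto intro: exI[of _ 1])
  next
    case (insert j S)
    show ?case
    proof (intro allI impI)
      fix \<epsilon> :: real assume "\<epsilon> > 0"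
      then have e2: "\<epsilon> / 2 > 0" by simp
      with insert.IH obtain d1 where d1: "d1 > 0" "\<And>h. norm h < d1 \<Longrightarrow>
          \<bar>g (x + P S h) - g x - (\<Sum>j\<in>S. partial_deriv g j x * h $ j)\<bar> \<le> \<epsilon> / 2 * norm h"
        by blast
      obtain d2 where d2: "d2 > 0"
          "\<And>w. dist w x < d2 \<Longrightarrow> dist (partial_deriv g j w) (partial_deriv g j x) < \<epsilon> / 2"
        using cont[of j] e2 unfolding continuous_on_iff by blast
      show "\<exists>d>0. \<forall>h. norm h < d \<longrightarrow> \<bar>g (x + P (insert j S) h) - g x
          - (\<Sum>j\<in>insert j S. partial_deriv g j x * h $ j)\<bar> \<le> \<epsilon> * norm h"
      proof (intro exI[of _ "min d1 d2"] conjI allI impI)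
        fix h :: "real^'n" assume h: "norm h < min d1 d2"
        let ?w = "x + P S h" and ?D = "partial_deriv g j x"
        define q where "q t = g (?w + t *\<^sub>R axis j 1) - t * ?D" for t
        have "norm (q (h $ j) - q 0) \<le> \<epsilon> / 2 * norm (h $ j - 0)"
        proof (rule field_differentiable_bound[of "closed_segment 0 (h $ j)"])
          fix t assume t: "t \<in> closed_segment 0 (h $ j)"
          show "(q has_real_derivative partial_deriv g j (?w + t *\<^sub>R axis j 1) - ?D)
              (at t within closed_segment 0 (h $ j))"
            unfolding q_def
            by (intro DERIV_subset[OF DERIV_diff[OF deriv DERIV_cmult_right[OF DERIV_ident, simplified]]]) auto
          have "\<bar>t\<bar> \<le> \<bar>h $ j\<bar>"
            using t by (auto simp: closed_segment_eq_real_ivl split: if_splits)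
          then have "norm (P S h + t *\<^sub>R axis j 1) \<le> norm h"
            using insert.hyps(2) by (intro norm_le_componentwise_cart) (auto simp: P_def axis_def)
          then have "dist (?w + t *\<^sub>R axis j 1) x < d2"
            using h by (simp add: dist_norm add.assoc)
          then show "norm (partial_deriv g j (?w + t *\<^sub>R axis j 1) - ?D) \<le> \<epsilon> / 2"
            using d2(2) by (simp add: dist_norm less_imp_le)
        qed auto
        also have "\<dots> \<le> \<epsilon> / 2 * norm h"
          using e2 by (intro mult_left_mono) (auto simp: component_le_norm_cart)
        finally have b1: "\<bar>g (?w + h $ j *\<^sub>R axis j 1) - g ?w - ?D * h $ j\<bar> \<le> \<epsilon> / 2 * norm h"
          by (simp add: q_def algebra_simps)
        have e1: "?w + h $ j *\<^sub>R axis j 1 = x + P (insert j S) h"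
          using insert.hyps(2) by (auto simp: vec_eq_iff P_def axis_def)
        have b2: "\<bar>g ?w - g x - (\<Sum>j\<in>S. partial_deriv g j x * h $ j)\<bar> \<le> \<epsilon> / 2 * norm h"
          using d1(2) h by simp
        have e3: "\<epsilon> * norm h = \<epsilon> / 2 * norm h + \<epsilon> / 2 * norm h"
          by simp
        have e2: "(\<Sum>j\<in>insert j S. partial_deriv g j x * h $ j)
            = ?D * h $ j + (\<Sum>j\<in>S. partial_deriv g j x * h $ j)"
          using insert.hyps by simp
        show "\<bar>g (x + P (insert j S) h) - g x
            - (\<Sum>j\<in>insert j S. partial_deriv g j x * h $ j)\<bar> \<le> \<epsilon> * norm h"
          unfolding e1[symmetric] e2 using b1 b2 e3 by linarith
      qed (use d1 d2 in simp)
    qed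
  qed
  from this[of UNIV] have main: "\<forall>\<epsilon>>0. \<exists>d>0. \<forall>h. norm h < d \<longrightarrow>
      \<bar>g (x + h) - g x - (\<Sum>j\<in>UNIV. partial_deriv g j x * h $ j)\<bar> \<le> \<epsilon> * norm h"
    by (simp add: P_def)
  have "bounded_linear (\<lambda>h::real^'n. \<Sum>j\<in>UNIV. partial_deriv g j x * h $ j)"
    by (intro bounded_linear_sum bounded_linear_const_mult bounded_linear_vec_nth)
  then show ?thesis
    unfolding has_derivative_at_alt
  proof (intro conjI allI impI)
    fix \<epsilon> :: real assume "\<epsilon> > 0"
    then obtain d where d: "d > 0" "\<And>h. norm h < d \<Longrightarrow>
        \<bar>g (x + h) - g x - (\<Sum>j\<in>UNIV. partial_deriv g j x * h $ j)\<bar> \<le> \<epsilon> * norm h"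
      using main by blast
    show "\<exists>d>0. \<forall>z. norm (z - x) < d \<longrightarrow>
        norm (g z - g x - (\<Sum>j\<in>UNIV. partial_deriv g j x * (z - x) $ j)) \<le> \<epsilon> * norm (z - x)"
      using d(1) d(2)[of "_ - x"] by (auto intro!: exI[of _ d])
  qed
qed

lemma det_replace_row:
  fixes M :: "real^'n^'n"
  shows "det (\<chi> r. if r = i then M $ k else M $ r) = (if k = i then det M else 0)"
proof (cases "k = i")
  case True
  then have "(\<chi> r. if r = i then M $ k else M $ r) = M"
    by (simp add: vec_eq_iff)
  then show ?thesis using True by simp
next
  case False
  then show ?thesis
    by (simp add: det_identical_rows[of i k] row_def vec_eq_iff)
qed

text \<open>By the product rule the derivative is a sum of determinants in each of which one row, the \<open>i\<close>-th
  say, is replaced by that of \<open>A ** M t\<close>. That row is a combination of the rows of \<open>M t\<close>, of which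
  only the \<open>i\<close>-th contributes, with the coefficient \<open>A $ i $ i\<close>.\<close>

lemma has_derivative_det_linear_ode:
  fixes M :: "real \<Rightarrow> real^'n^'n" and A :: "real^'n^'n"
  assumes M: "\<And>i j. ((\<lambda>t. M t $ i $ j) has_real_derivative (A ** M t) $ i $ j) (at t within S)"
  shows "((\<lambda>t. det (M t)) has_real_derivative trace A * det (M t)) (at t within S)"
proof -
  let ?U = "UNIV :: 'n set"
  let ?R = "\<lambda>i k. (\<chi> r. if r = i then M t $ k else M t $ r) :: real^'n^'n"
  have prod: "((\<lambda>t. \<Prod>i\<in>?U. M t $ i $ p i) has_real_derivative
      (\<Sum>i\<in>?U. \<Sum>k\<in>?U. A $ i $ k * (\<Prod>r\<in>?U. ?R i k $ r $ p r))) (at t within S)" for p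
  proof -
    have eq: "(A ** M t) $ i $ p i * y * (\<Prod>r\<in>?U - {i}. M t $ r $ p r)
        = (\<Sum>k\<in>?U. A $ i $ k * (\<Prod>r\<in>?U. ?R i k $ r $ p r)) * y" for i y
    proof -
      have "(\<Prod>r\<in>?U. ?R i k $ r $ p r) = M t $ k $ p i * (\<Prod>r\<in>?U - {i}. M t $ r $ p r)" for k
        by (subst prod.remove[of ?U i]) (auto intro!: prod.cong)
      then show ?thesis
        by (simp add: matrix_matrix_mult_def sum_distrib_left sum_distrib_right mult_ac)
    qed
    show ?thesis
      unfolding has_field_derivative_def
    proof (rule has_derivative_eq_rhs[OF has_derivative_prod])
      show "((\<lambda>t. M t $ i $ p i) has_derivative (*) ((A ** M t) $ i $ p i)) (at t within S)" for i
        using M[of i "p i"] by (simp add: has_field_derivative_def)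
      show "(\<lambda>y. \<Sum>i\<in>?U. (A ** M t) $ i $ p i * y * (\<Prod>r\<in>?U - {i}. M t $ r $ p r))
          = (*) (\<Sum>i\<in>?U. \<Sum>k\<in>?U. A $ i $ k * (\<Prod>r\<in>?U. ?R i k $ r $ p r))"
        unfolding eq by (rule ext) (rule sum_distrib_right[symmetric])
    qed
  qed
  have "((\<lambda>t. det (M t)) has_real_derivative
      (\<Sum>p | p permutes ?U. of_int (sign p) * (\<Sum>i\<in>?U. \<Sum>k\<in>?U. A $ i $ k * (\<Prod>r\<in>?U. ?R i k $ r $ p r))))
      (at t within S)"
    unfolding det_def by (intro DERIV_sum DERIV_cmult prod)
  also have "(\<Sum>p | p permutes ?U. of_int (sign p) * (\<Sum>i\<in>?U. \<Sum>k\<in>?U. A $ i $ k * (\<Prod>r\<in>?U. ?R i k $ r $ p r)))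
      = (\<Sum>i\<in>?U. \<Sum>k\<in>?U. A $ i $ k * det (?R i k))"
    unfolding det_def sum_distrib_left
    by (subst sum.swap, rule sum.cong[OF refl], subst sum.swap) (simp add: mult_ac)
  also have "\<dots> = trace A * det (M t)"
    unfolding det_replace_row by (simp add: trace_def sum_distrib_right if_distrib cong: if_cong)
  finally show ?thesis .
qed

text \<open>Liouville's formula: the determinant times \<open>exp\<close> of minus the integral has derivative zero.\<close>

lemma det_linear_ode:
  fixes M A :: "real \<Rightarrow> real^'n^'n"
  assumes M: "\<And>t i j. t \<in> {a..b} \<Longrightarrow>
      ((\<lambda>t. M t $ i $ j) has_real_derivative (A t ** M t) $ i $ j) (at t within {a..b})"
    and A: "continuous_on {a..b} (\<lambda>t. trace (A t))" and init: "M a = mat 1" and t: "t \<in> {a..b}"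
  shows "det (M t) = exp (integral {a..t} (\<lambda>r. trace (A r)))"
proof -
  let ?I = "\<lambda>t. integral {a..t} (\<lambda>r. trace (A r))"
  have "\<exists>c. \<forall>t\<in>{a..b}. det (M t) * exp (- ?I t) = c"
  proof (rule has_field_derivative_zero_constant)
    fix r assume r: "r \<in> {a..b}"
    have "(?I has_real_derivative trace (A r)) (at r within {a..b})"
      using integral_has_real_derivative[OF A r] .
    note [derivative_intros] = this has_derivative_det_linear_ode[OF M[OF r]]
    show "((\<lambda>t. det (M t) * exp (- ?I t)) has_real_derivative 0) (at r within {a..b})"
      by (auto intro!: derivative_eq_intros)
  qed simp
  then obtain c where c: "\<And>t. t \<in> {a..b} \<Longrightarrow> det (M t) * exp (- ?I t) = c" by blast
  have "c = 1" using c[of a] t init by simp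
  then show ?thesis using c[OF t] by (simp add: exp_minus field_simps)
qed

text \<open>The squared norm, unlike the norm, is differentiable also where \<open>u\<close> vanishes. The estimate
  \<open>2 * norm (u r) * \<epsilon> \<le> (norm (u r))\<^sup>2 + \<epsilon>\<^sup>2\<close> makes its differential inequality linear and is the
  source of the \<open>1\<close> in the exponent.\<close>

lemma Gronwall_power2:
  fixes u u' :: "real \<Rightarrow> 'a::real_inner"
  assumes u: "\<And>r. r \<in> {a..b} \<Longrightarrow> (u has_vector_derivative u' r) (at r within {a..b})"
    and le: "\<And>r. r \<in> {a..b} \<Longrightarrow> norm (u' r) \<le> L * norm (u r) + \<epsilon>"
    and "0 \<le> \<epsilon>" "0 \<le> L" and t: "t \<in> {a..b}"
  shows "(norm (u t))\<^sup>2 \<le> exp ((2 * L + 1) * (t - a)) * ((norm (u a))\<^sup>2 + \<epsilon>\<^sup>2 * (t - a))"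
proof -
  let ?K = "2 * L + 1"
  define q where "q r = exp (- ?K * (r - a)) * (u r \<bullet> u r) - \<epsilon>\<^sup>2 * (r - a)" for r
  have "q t \<le> q a"
  proof (rule DERIV_nonpos_imp_decreasing_open[where f = q and a = a and b = t])
    show "a \<le> t" using t by simp
    show "continuous_on {a..t} q"
      unfolding q_def using t
      by (intro continuous_intros continuous_on_subset[OF continuous_on_vector_derivative[OF u]]) auto
    fix r assume r: "a < r" "r < t"
    then have "(u has_vector_derivative u' r) (at r)"
      using u[of r] t by (simp add: at_within_Icc_at)
    then have du: "(u has_derivative (\<lambda>h. h *\<^sub>R u' r)) (at r)"
      by (simp add: has_vector_derivative_def)
    have dn: "((\<lambda>r. u r \<bullet> u r) has_real_derivative 2 * (u r \<bullet> u' r)) (at r)"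
      unfolding has_field_derivative_def
    proof (rule has_derivative_eq_rhs[OF has_derivative_inner[OF du du]])
      show "(\<lambda>h. u r \<bullet> h *\<^sub>R u' r + (h *\<^sub>R u' r) \<bullet> u r) = (*) (2 * (u r \<bullet> u' r))"
        by (rule ext) (simp add: inner_commute[of "u' r" "u r"])
    qed
    have de: "((\<lambda>r. exp (- ?K * (r - a))) has_real_derivative exp (- ?K * (r - a)) * - ?K) (at r)"
      by (auto intro!: derivative_eq_intros)
    have dl: "((\<lambda>r. \<epsilon>\<^sup>2 * (r - a)) has_real_derivative \<epsilon>\<^sup>2) (at r)"
      by (auto intro!: derivative_eq_intros)
    have "(q has_real_derivative exp (- ?K * (r - a)) * (2 * (u r \<bullet> u' r) - ?K * (u r \<bullet> u r)) - \<epsilon>\<^sup>2) (at r)"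
      unfolding q_def
      by (rule DERIV_cong[OF DERIV_diff[OF DERIV_mult'[OF de dn] dl]]) algebra
    moreover have "exp (- ?K * (r - a)) * (2 * (u r \<bullet> u' r) - ?K * (u r \<bullet> u r)) \<le> \<epsilon>\<^sup>2"
    proof -
      have "u r \<bullet> u' r \<le> norm (u r) * norm (u' r)"
        by (rule norm_cauchy_schwarz)
      also have "\<dots> \<le> norm (u r) * (L * norm (u r) + \<epsilon>)"
        using le[of r] r t by (intro mult_left_mono) auto
      finally have "2 * (u r \<bullet> u' r) \<le> 2 * L * (norm (u r))\<^sup>2 + 2 * norm (u r) * \<epsilon>"
        by (simp add: power2_eq_square algebra_simps)
      also have "\<dots> \<le> ?K * (u r \<bullet> u r) + \<epsilon>\<^sup>2"
        using sum_squares_bound[of "norm (u r)" \<epsilon>] by (simp add: power2_norm_eq_inner algebra_simps)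
      finally have "2 * (u r \<bullet> u' r) - ?K * (u r \<bullet> u r) \<le> \<epsilon>\<^sup>2" by simp
      then have "exp (- ?K * (r - a)) * (2 * (u r \<bullet> u' r) - ?K * (u r \<bullet> u r)) \<le> exp (- ?K * (r - a)) * \<epsilon>\<^sup>2"
        by (rule mult_left_mono) simp
      also have "\<dots> \<le> 1 * \<epsilon>\<^sup>2"
        using r \<open>0 \<le> L\<close> by (intro mult_right_mono) (auto intro!: mult_nonpos_nonneg)
      finally show ?thesis by simp
    qed
    ultimately show "\<exists>y. (q has_real_derivative y) (at r) \<and> y \<le> 0"
      by (intro exI conjI) auto
  qed
  then have "exp (- ?K * (t - a)) * (norm (u t))\<^sup>2 \<le> (norm (u a))\<^sup>2 + \<epsilon>\<^sup>2 * (t - a)"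
    by (simp add: q_def power2_norm_eq_inner)
  then have "exp (?K * (t - a)) * (exp (- ?K * (t - a)) * (norm (u t))\<^sup>2)
      \<le> exp (?K * (t - a)) * ((norm (u a))\<^sup>2 + \<epsilon>\<^sup>2 * (t - a))"
    by (rule mult_left_mono) simp
  moreover have "exp (?K * (t - a)) * exp (- ?K * (t - a)) = 1"
    unfolding exp_add[symmetric] by (simp add: algebra_simps)
  ultimately show ?thesis
    by (simp only: mult.assoc[symmetric] mult_1_left)
qed

section \<open>Vector fields with continuous spatial derivatives\<close>

definition space_jacobian :: "(real^'n \<Rightarrow> real \<Rightarrow> real^'n) \<Rightarrow> real^'n \<Rightarrow> real \<Rightarrow> real^'n^'n" where
  "space_jacobian f x t = (\<chi> i j. partial_deriv (\<lambda>z. f z t $ i) j x)"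

lemma norm_matrix_vector_le_component:
  fixes A :: "real^'n^'m"
  assumes "\<And>i j. \<bar>A $ i $ j\<bar> \<le> B"
  shows "norm (A *v h) \<le> real CARD('m) * real CARD('n) * B * norm h"
proof -
  have "norm (A *v h) \<le> onorm ((*v) A) * norm h"
    by (rule onorm[OF matrix_vector_mul_bounded_linear])
  also have "\<dots> \<le> real CARD('m) * real CARD('n) * B * norm h"
    using onorm_le_matrix_component[of A B] assms by (intro mult_right_mono) auto
  finally show ?thesis .
qed

locale C1_field =
  fixes f :: "real^'n \<Rightarrow> real \<Rightarrow> real^'n"
  assumes f_partials: "\<And>i j x t. has_partial_deriv (\<lambda>z. f z t $ i) j x"
    and f_partials_cont: "\<And>i j. continuous_on UNIV (\<lambda>(x, t). partial_deriv (\<lambda>z. f z t $ i) j x)"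
begin

lemma has_derivative_space_jacobian: "((\<lambda>z. f z t) has_derivative (\<lambda>h. space_jacobian f x t *v h)) (at x)"
proof -
  have "((\<lambda>z. f z t $ i) has_derivative (\<lambda>h. \<Sum>j\<in>UNIV. partial_deriv (\<lambda>z. f z t $ i) j x * h $ j)) (at x)" for i
  proof (rule has_derivative_of_continuous_partials[OF f_partials])
    fix j
    show "continuous_on UNIV (partial_deriv (\<lambda>z. f z t $ i) j)"
      using continuous_on_compose2[OF f_partials_cont[of i j], of UNIV "\<lambda>x. (x, t)"]
      by (simp add: continuous_on_Pair)
  qed
  then show ?thesis
    by (subst has_derivative_componentwise_within)
      (auto simp: Basis_vec_def inner_axis space_jacobian_def matrix_vector_mult_def)
qed

lemma continuous_on_jacobian_component:
  "continuous_on UNIV (\<lambda>p. space_jacobian f (fst p) (snd p) $ i $ j)"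
  using f_partials_cont[of i j] by (simp add: space_jacobian_def case_prod_beta)

lemma jacobian_uniform_bound:
  assumes "compact K"
  obtains L where "0 \<le> L" "\<And>x t h. x \<in> K \<Longrightarrow> t \<in> {0..T} \<Longrightarrow> norm (space_jacobian f x t *v h) \<le> L * norm h"
proof -
  have "\<exists>B. \<forall>p\<in>K \<times> {0..T}. \<bar>space_jacobian f (fst p) (snd p) $ i $ j\<bar> \<le> B" for i j
  proof -
    have "compact ((\<lambda>p. space_jacobian f (fst p) (snd p) $ i $ j) ` (K \<times> {0..T}))"
      by (intro compact_continuous_image compact_Times assms compact_Icc
          continuous_on_subset[OF continuous_on_jacobian_component]) auto
    then show ?thesis
      by (auto dest!: compact_imp_bounded simp: bounded_real)
  qed
  then obtain B where B: "\<And>i j p. p \<in> K \<times> {0..T} \<Longrightarrow> \<bar>space_jacobian f (fst p) (snd p) $ i $ j\<bar> \<le> B i j"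
    by metis
  define C where "C = (\<Sum>i\<in>UNIV. \<Sum>j\<in>UNIV. \<bar>B i j\<bar>)"
  have "B i j \<le> C" for i j
  proof -
    have "\<bar>B i j\<bar> \<le> (\<Sum>j\<in>UNIV. \<bar>B i j\<bar>)" by (rule member_le_sum) auto
    also have "\<dots> \<le> C" unfolding C_def by (rule member_le_sum) (auto intro: sum_nonneg)
    finally show ?thesis by simp
  qed
  then have "\<bar>space_jacobian f x t $ i $ j\<bar> \<le> C" if "x \<in> K" "t \<in> {0..T}" for x t i j
    using B[of "(x, t)" i j] that by (force intro: order_trans)
  then have "norm (space_jacobian f x t *v h) \<le> real CARD('n) * real CARD('n) * C * norm h"
    if "x \<in> K" "t \<in> {0..T}" for x t h
    using that by (intro norm_matrix_vector_le_component)
  moreover have "0 \<le> C" unfolding C_def by (intro sum_nonneg) auto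
  ultimately show ?thesis
    by (intro that[of "real CARD('n) * real CARD('n) * C"]) auto
qed

lemma field_Lipschitz:
  assumes "convex K" "t \<in> {0..T}" "x \<in> K" "z \<in> K"
    and L: "\<And>x h. x \<in> K \<Longrightarrow> norm (space_jacobian f x t *v h) \<le> L * norm h"
  shows "norm (f x t - f z t) \<le> L * norm (x - z)"
  using assms(1) by (rule differentiable_bound)
    (use assms has_derivative_at_withinI[OF has_derivative_space_jacobian] in \<open>auto intro!: onorm_le\<close>)

text \<open>The spatial Jacobian is uniformly continuous on the compact set, so the error of the
  linearisation is small uniformly in the base point and in time. This is what makes the flow
  differentiable in the starting point.\<close>

lemma uniform_linearisation:
  assumes K: "compact K" "convex K" and \<epsilon>: "0 < \<epsilon>"
  obtains d where "0 < d" "\<And>x z t. x \<in> K \<Longrightarrow> z \<in> K \<Longrightarrow> t \<in> {0..T} \<Longrightarrow> norm (z - x) < d \<Longrightarrow>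
    norm (f z t - f x t - space_jacobian f x t *v (z - x)) \<le> \<epsilon> * norm (z - x)"
proof -
  define N where "N = real CARD('n) * real CARD('n)"
  have N: "N > 0" by (simp add: N_def)
  have "\<exists>d>0. \<forall>x\<in>K. \<forall>z\<in>K. \<forall>t\<in>{0..T}. norm (z - x) < d \<longrightarrow>
      \<bar>space_jacobian f z t $ i $ j - space_jacobian f x t $ i $ j\<bar> < \<epsilon> / N" for i j
  proof -
    have "uniformly_continuous_on (K \<times> {0..T}) (\<lambda>p. space_jacobian f (fst p) (snd p) $ i $ j)"
      by (intro compact_uniformly_continuous compact_Times K compact_Icc
          continuous_on_subset[OF continuous_on_jacobian_component]) auto
    then obtain d where d: "d > 0" "\<And>p q. p \<in> K \<times> {0..T} \<Longrightarrow> q \<in> K \<times> {0..T} \<Longrightarrow> dist q p < d \<Longrightarrow>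
        dist (space_jacobian f (fst q) (snd q) $ i $ j) (space_jacobian f (fst p) (snd p) $ i $ j) < \<epsilon> / N"
      using uniformly_continuous_onE[of _ _ "\<epsilon> / N"] divide_pos_pos[OF \<epsilon> N] by blast
    show ?thesis
      using d(1) d(2)[of "(_, _)" "(_, _)"]
      by (intro exI[of _ d]) (auto simp: dist_norm)
  qed
  then obtain d where d: "\<And>i j. d i j > 0" "\<And>i j x z t. x \<in> K \<Longrightarrow> z \<in> K \<Longrightarrow> t \<in> {0..T} \<Longrightarrow>
      norm (z - x) < d i j \<Longrightarrow> \<bar>space_jacobian f z t $ i $ j - space_jacobian f x t $ i $ j\<bar> < \<epsilon> / N"
    by metis
  define \<delta> where "\<delta> = Min (range (\<lambda>(i, j). d i j))"
  have \<delta>: "\<delta> > 0" "\<And>i j. \<delta> \<le> d i j"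
    unfolding \<delta>_def using d(1) by (auto intro!: Min_le)
  show ?thesis
  proof (rule that[OF \<delta>(1)])
    fix x z t assume xz: "x \<in> K" "z \<in> K" "t \<in> {0..T}" "norm (z - x) < \<delta>"
    have "norm (f z t - f x t - space_jacobian f x t *v (z - x)) \<le> norm (z - x) * \<epsilon>"
    proof (rule differentiable_bound_linearization[where S = "closed_segment x z" and f = "\<lambda>w. f w t"
          and f' = "\<lambda>w h. space_jacobian f w t *v h" and ?x0.0 = x])
      show "x + r *\<^sub>R (z - x) \<in> closed_segment x z" if "r \<in> {0..1}" for r
        using that by (auto simp: closed_segment_def intro!: exI[of _ r]) (simp add: algebra_simps)
      show "((\<lambda>w. f w t) has_derivative (\<lambda>h. space_jacobian f w t *v h)) (at w within closed_segment x z)" for w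
        by (rule has_derivative_at_withinI[OF has_derivative_space_jacobian])
      fix w assume w: "w \<in> closed_segment x z"
      have "w \<in> K" using w xz K(2) by (meson closed_segment_subset subsetD)
      moreover have "norm (w - x) < \<delta>" using segment_bound(1)[OF w] xz by simp
      ultimately have "\<bar>(space_jacobian f w t - space_jacobian f x t) $ i $ j\<bar> \<le> \<epsilon> / N" for i j
        using d(2)[of x w t i j] xz \<delta>(2)[of i j] by simp
      then have "onorm ((*v) (space_jacobian f w t - space_jacobian f x t)) \<le> N * (\<epsilon> / N)"
        unfolding N_def by (rule onorm_le_matrix_component)
      moreover have "(\<lambda>h. space_jacobian f w t *v h) - (\<lambda>h. space_jacobian f x t *v h)
          = (*v) (space_jacobian f w t - space_jacobian f x t)"
        by (rule ext) (simp add: matrix_vector_mult_diff_rdistrib)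
      ultimately show "onorm ((\<lambda>h. space_jacobian f w t *v h) - (\<lambda>h. space_jacobian f x t *v h)) \<le> \<epsilon>"
        using N by simp
    qed simp
    then show "norm (f z t - f x t - space_jacobian f x t *v (z - x)) \<le> \<epsilon> * norm (z - x)"
      by (simp add: mult.commute)
  qed
qed

end

section \<open>Differentiability of the flow and its Jacobian determinant\<close>

text \<open>What the flow needs of the vector field: a bound \<open>M\<close> of the speed, and Lipschitz continuity and
  uniform linearisation on a ball that contains up to time \<open>T\<close> all paths started in \<open>D\<close>. The paths
  may leave \<open>D\<close>.\<close>

locale bounded_flow =
  fixes D :: "(real^'n) set" and T :: real and f :: "real^'n \<Rightarrow> real \<Rightarrow> real^'n"
    and J :: "real^'n \<Rightarrow> real \<Rightarrow> real^'n^'n"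
    and y :: "real^'n \<Rightarrow> real \<Rightarrow> real \<Rightarrow> real^'n" and M L R :: real
  assumes open_D: "open D" and T_nonneg: "0 \<le> T"
    and M_nonneg: "0 \<le> M" and f_le: "\<And>x t. norm (f x t) \<le> M"
    and R: "\<And>x. x \<in> D \<Longrightarrow> norm x + M * T \<le> R"
    and L_nonneg: "0 \<le> L"
    and f_Lipschitz: "\<And>x z t. x \<in> cball 0 R \<Longrightarrow> z \<in> cball 0 R \<Longrightarrow> t \<in> {0..T} \<Longrightarrow>
      norm (f x t - f z t) \<le> L * norm (x - z)"
    and J_le: "\<And>x t h. x \<in> cball 0 R \<Longrightarrow> t \<in> {0..T} \<Longrightarrow> norm (J x t *v h) \<le> L * norm h"
    and f_linearisation: "\<And>\<epsilon>. 0 < \<epsilon> \<Longrightarrow> \<exists>d>0. \<forall>x\<in>cball 0 R. \<forall>z\<in>cball 0 R. \<forall>t\<in>{0..T}.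
      norm (z - x) < d \<longrightarrow> norm (f z t - f x t - J x t *v (z - x)) \<le> \<epsilon> * norm (z - x)"
    and J_cont: "\<And>i j. continuous_on UNIV (\<lambda>p. J (fst p) (snd p) $ i $ j)"
    and y_solves: "\<And>x s. x \<in> D \<Longrightarrow> s \<in> {0..T} \<Longrightarrow> solves_ivp f x s (y x s)"
begin

lemma y_start: "x \<in> D \<Longrightarrow> s \<in> {0..T} \<Longrightarrow> y x s s = x"
  using y_solves by (auto simp: solves_ivp_def)

lemma y_derivative:
  assumes "x \<in> D" "s \<in> {0..T}" "r \<in> S" "S \<subseteq> {s..}"
  shows "(y x s has_vector_derivative f (y x s r) r) (at r within S)"
proof (rule has_vector_derivative_within_subset[OF _ assms(4)])
  show "(y x s has_vector_derivative f (y x s r) r) (at r within {s..})"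
    using y_solves[OF assms(1,2)] assms(3,4) by (auto simp: solves_ivp_def)
qed

lemma y_continuous:
  assumes "x \<in> D" "s \<in> {0..T}" "S \<subseteq> {s..}"
  shows "continuous_on S (y x s)"
  using y_derivative[OF assms(1,2) _ assms(3)] by (rule continuous_on_vector_derivative)

lemma y_speed:
  assumes x: "x \<in> D" "s \<in> {0..T}" and r: "s \<le> r" "r \<le> r'"
  shows "norm (y x s r' - y x s r) \<le> M * (r' - r)"
proof (cases "r = r'")
  case False
  then have "r < r'" using r by simp
  then obtain t where t: "t \<in> {r<..<r'}"
      "norm (y x s r' - y x s r) \<le> norm ((r' - r) *\<^sub>R f (y x s t) t)"
  proof (rule mvt_general[where f = "y x s" and f' = "\<lambda>t h. h *\<^sub>R f (y x s t) t", elim_format])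
    show "continuous_on {r..r'} (y x s)" using r by (intro y_continuous x) auto
    show "(y x s has_derivative (\<lambda>h. h *\<^sub>R f (y x s t) t)) (at t)" if "r < t" "t < r'" for t
    proof -
      have "{r<..<r'} \<subseteq> {s..}" using r by auto
      then show ?thesis
        using y_derivative[OF x, of t "{r<..<r'}"] that
        by (simp add: has_vector_derivative_def at_within_open[of t "{r<..<r'}"])
    qed
  qed blast
  then show ?thesis
    using r f_le[of "y x s t" t] by (auto intro: order_trans mult_left_mono simp: mult.commute)
qed simp

lemma y_in_ball:
  assumes x: "x \<in> D" "s \<in> {0..T}" and r: "r \<in> {s..T}"
  shows "y x s r \<in> cball 0 R"
proof -
  have "norm (y x s r - x) \<le> M * (r - s)"
    using y_speed[OF x, of s r] y_start[OF x] r by simp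
  also have "\<dots> \<le> M * T" using M_nonneg x r by (intro mult_left_mono) auto
  finally have "norm (y x s r) \<le> norm x + M * T"
    using norm_triangle_sub[of "y x s r" x] by linarith
  then show ?thesis using R[OF x(1)] by simp
qed

text \<open>A common bound for the square roots of the exponential factors of \<open>Gronwall_power2\<close> at all times
  up to \<open>T\<close>.\<close>

definition growth :: real where "growth = exp ((L + 1) * T)"

lemma growth_pos: "0 < growth" by (simp add: growth_def)

lemma Gronwall_growth:
  fixes u u' :: "real \<Rightarrow> real^'n"
  assumes u: "\<And>r. r \<in> {a..b} \<Longrightarrow> (u has_vector_derivative u' r) (at r within {a..b})"
    and le: "\<And>r. r \<in> {a..b} \<Longrightarrow> norm (u' r) \<le> L * norm (u r) + \<epsilon>"
    and \<epsilon>: "0 \<le> \<epsilon>" and ab: "0 \<le> a" "b \<le> T" and t: "t \<in> {a..b}"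
  shows "norm (u t) \<le> growth * (norm (u a) + \<epsilon> * sqrt T)"
proof (rule power2_le_imp_le)
  have "(norm (u t))\<^sup>2 \<le> exp ((2 * L + 1) * (t - a)) * ((norm (u a))\<^sup>2 + \<epsilon>\<^sup>2 * (t - a))"
    by (rule Gronwall_power2[OF u le \<epsilon> L_nonneg t])
  also have "\<dots> \<le> growth\<^sup>2 * (norm (u a) + \<epsilon> * sqrt T)\<^sup>2"
  proof (rule mult_mono)
    have "(2 * L + 1) * (t - a) \<le> (2 * L + 2) * T"
      using L_nonneg ab t by (intro mult_mono) auto
    then show "exp ((2 * L + 1) * (t - a)) \<le> growth\<^sup>2"
      unfolding growth_def by (simp add: exp_double[symmetric] algebra_simps)
    have "(norm (u a))\<^sup>2 + \<epsilon>\<^sup>2 * (t - a) \<le> (norm (u a))\<^sup>2 + (\<epsilon> * sqrt T)\<^sup>2"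
      using ab t T_nonneg by (auto simp: power_mult_distrib intro!: mult_left_mono)
    also have "\<dots> \<le> (norm (u a) + \<epsilon> * sqrt T)\<^sup>2"
      using \<epsilon> T_nonneg by (simp add: power2_sum)
    finally show "(norm (u a))\<^sup>2 + \<epsilon>\<^sup>2 * (t - a) \<le> (norm (u a) + \<epsilon> * sqrt T)\<^sup>2" .
  qed (use t in auto)
  finally show "(norm (u t))\<^sup>2 \<le> (growth * (norm (u a) + \<epsilon> * sqrt T))\<^sup>2"
    by (simp add: power_mult_distrib)
qed (use \<epsilon> T_nonneg growth_pos in auto)

lemma solutions_close:
  assumes p: "\<And>r. r \<in> {a..b} \<Longrightarrow> (p has_vector_derivative f (p r) r) (at r within {a..b})"
      "\<And>r. r \<in> {a..b} \<Longrightarrow> p r \<in> cball 0 R"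
    and q: "\<And>r. r \<in> {a..b} \<Longrightarrow> (q has_vector_derivative f (q r) r) (at r within {a..b})"
      "\<And>r. r \<in> {a..b} \<Longrightarrow> q r \<in> cball 0 R"
    and ab: "0 \<le> a" "b \<le> T" and t: "t \<in> {a..b}"
  shows "norm (p t - q t) \<le> growth * norm (p a - q a)"
proof -
  have "norm (p t - q t) \<le> growth * (norm (p a - q a) + 0 * sqrt T)"
  proof (rule Gronwall_growth[where u = "\<lambda>r. p r - q r" and u' = "\<lambda>r. f (p r) r - f (q r) r", OF _ _ _ ab t])
    fix r assume r: "r \<in> {a..b}"
    show "((\<lambda>r. p r - q r) has_vector_derivative f (p r) r - f (q r) r) (at r within {a..b})"
      by (intro has_vector_derivative_diff p(1) q(1) r)
    show "norm (f (p r) r - f (q r) r) \<le> L * norm (p r - q r) + 0"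
      using f_Lipschitz[OF p(2) q(2)] r ab by simp
  qed simp
  then show ?thesis by simp
qed

lemma y_close:
  assumes "x \<in> D" "z \<in> D" "s \<in> {0..T}" "r \<in> {s..T}"
  shows "norm (y x s r - y z s r) \<le> growth * norm (x - z)"
  using solutions_close[of s T "y x s" "y z s" r] assms y_derivative y_in_ball y_start
  by simp

lemma y_flow:
  assumes x: "x \<in> D" and s: "s \<in> {0..T}" and r: "r \<in> {s..T}" "y x s r \<in> D" and t: "t \<in> {r..T}"
  shows "y (y x s r) r t = y x s t"
proof -
  have "norm (y (y x s r) r t - y x s t) \<le> growth * norm (y (y x s r) r r - y x s r)"
    using x s r t by (intro solutions_close[of r T] y_derivative y_in_ball) auto
  then show ?thesis using y_start[OF r(2)] s r by simp
qed

text \<open>Gronwall's inequality applied to the difference of two paths run backwards in time.\<close>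

lemma y_inj:
  assumes x: "x \<in> D" "z \<in> D" and s: "s \<in> {0..T}" and r: "r \<in> {s..T}" and eq: "y x s r = y z s r"
  shows "x = z"
proof -
  let ?u = "\<lambda>\<rho>. y x s (s + r - \<rho>) - y z s (s + r - \<rho>)"
  let ?u' = "\<lambda>\<rho>. - (f (y x s (s + r - \<rho>)) (s + r - \<rho>) - f (y z s (s + r - \<rho>)) (s + r - \<rho>))"
  have d: "((\<lambda>\<rho>. y w s (s + r - \<rho>)) has_vector_derivative - f (y w s (s + r - \<rho>)) (s + r - \<rho>)) (at \<rho> within {s..r})"
    if "w \<in> D" "\<rho> \<in> {s..r}" for w \<rho>
  proof -
    have im: "(\<lambda>\<rho>. s + r - \<rho>) ` {s..r} \<subseteq> {s..}" by auto
    have 1: "((\<lambda>\<rho>. s + r - \<rho>) has_vector_derivative -1) (at \<rho> within {s..r})"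
      by (auto intro!: derivative_eq_intros)
    have 2: "(y w s has_vector_derivative f (y w s (s + r - \<rho>)) (s + r - \<rho>))
        (at (s + r - \<rho>) within (\<lambda>\<rho>. s + r - \<rho>) ` {s..r})"
      by (rule y_derivative[OF that(1) s _ im]) (use that in auto)
    have "((y w s \<circ> (\<lambda>\<rho>. s + r - \<rho>)) has_vector_derivative -1 *\<^sub>R f (y w s (s + r - \<rho>)) (s + r - \<rho>)) (at \<rho> within {s..r})"
      using vector_diff_chain_within[OF 1 2] .
    then show ?thesis by (simp add: o_def)
  qed
  have "norm (?u r) \<le> growth * (norm (?u s) + 0 * sqrt T)"
  proof (rule Gronwall_growth[where u = ?u and u' = ?u'])
    fix \<rho> assume \<rho>: "\<rho> \<in> {s..r}"
    show "(?u has_vector_derivative ?u' \<rho>) (at \<rho> within {s..r})"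
      using has_vector_derivative_diff[OF d[OF x(1) \<rho>] d[OF x(2) \<rho>]] by simp
    have "y x s (s + r - \<rho>) \<in> cball 0 R" "y z s (s + r - \<rho>) \<in> cball 0 R"
      using \<rho> r s x by (intro y_in_ball; simp)+
    then show "norm (?u' \<rho>) \<le> L * norm (?u \<rho>) + 0"
      using f_Lipschitz[of "y x s (s + r - \<rho>)" "y z s (s + r - \<rho>)" "s + r - \<rho>"] \<rho> r s
      by (simp only: norm_minus_cancel add_0_right) auto
  qed (use s r in auto)
  then have "?u r = 0" using eq by simp
  then show ?thesis using y_start x s by simp
qed

text \<open>The variational equation is solved by the derivative of the flow, without recourse to an
  existence theorem. The difference quotients of the flow in direction \<open>axis j 1\<close> satisfy the
  equation up to an error that tends to zero uniformly; by Gronwall's inequality they form a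
  uniform Cauchy sequence, and their limit is an exact solution.\<close>

lemma ex_variational_column:
  assumes x: "x \<in> D" and s: "s \<in> {0..T}"
  obtains m where "m s = axis j 1" "\<And>r. r \<in> {s..T} \<Longrightarrow>
    (m has_vector_derivative J (y x s r) r *v m r) (at r within {s..T})"
proof -
  obtain \<rho> where \<rho>: "\<rho> > 0" "cball x \<rho> \<subseteq> D"
    using open_D x open_contains_cball by blast
  \<comment> \<open>step sizes that keep the displaced starting points in \<open>D\<close>\<close>
  define h where "h n = \<rho> / real (Suc n)" for n
  have h: "h n > 0" "h n \<le> \<rho>" for n using \<rho> by (auto simp: h_def field_simps)
  have h0: "h \<longlonglongrightarrow> 0" unfolding h_def by (rule LIMSEQ_Suc[OF lim_const_over_n])
  define z where "z n = x + h n *\<^sub>R axis j 1" for n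
  have z: "z n \<in> D" "norm (z n - x) = h n" for n
    using \<rho> h[of n] by (auto simp: z_def dist_norm subset_iff less_imp_le)
  define q where "q n r = (1 / h n) *\<^sub>R (y (z n) s r - y x s r)" for n r
  define q' where "q' n r = (1 / h n) *\<^sub>R (f (y (z n) s r) r - f (y x s r) r)" for n r
  have q_der: "(q n has_vector_derivative q' n r) (at r within {s..T})" if "r \<in> {s..T}" for n r
    unfolding q_def q'_def using that x s z
    by (intro bounded_linear.has_vector_derivative[OF bounded_linear_scaleR_right] has_vector_derivative_diff y_derivative) auto
  have q_start: "q n s = axis j 1" for n
    using x s z h[of n] y_start by (simp add: q_def z_def)
  have q_le: "norm (q n r) \<le> growth" if "r \<in> {s..T}" for n r
  proof -
    have "norm (y (z n) s r - y x s r) \<le> growth * h n"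
      using y_close[OF z(1) x s that] z(2) by metis
    then show ?thesis using h(1)[of n] by (simp add: q_def pos_divide_le_eq mult.commute)
  qed
  have J: "norm (J (y x s r) r *v w) \<le> L * norm w" if "r \<in> {s..T}" for r w
    using that x s by (intro J_le y_in_ball) auto
  have lin: "\<exists>N. \<forall>n\<ge>N. \<forall>r\<in>{s..T}. norm (q' n r - J (y x s r) r *v q n r) \<le> \<epsilon>" if "\<epsilon> > 0" for \<epsilon>
  proof -
    have "\<epsilon> / growth > 0" using that growth_pos by simp
    then obtain d where d: "d > 0" "\<And>w v t. w \<in> cball 0 R \<Longrightarrow> v \<in> cball 0 R \<Longrightarrow> t \<in> {0..T} \<Longrightarrow>
        norm (v - w) < d \<Longrightarrow> norm (f v t - f w t - J w t *v (v - w)) \<le> \<epsilon> / growth * norm (v - w)"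
      using f_linearisation by metis
    have "\<forall>\<^sub>F n in sequentially. h n < d / growth"
      using order_tendstoD(2)[OF h0] d(1) growth_pos by simp
    then obtain N where N: "\<And>n. n \<ge> N \<Longrightarrow> h n < d / growth"
      by (auto simp: eventually_sequentially)
    show ?thesis
    proof (intro exI[of _ N] allI impI ballI)
      fix n r assume n: "n \<ge> N" and r: "r \<in> {s..T}"
      have "norm (y (z n) s r - y x s r) \<le> growth * h n"
        using y_close[OF z(1) x s r] z(2) by metis
      moreover have "growth * h n < d"
        using N[OF n] growth_pos by (simp add: field_simps)
      ultimately have "norm (f (y (z n) s r) r - f (y x s r) r - J (y x s r) r *v (y (z n) s r - y x s r))
          \<le> \<epsilon> / growth * norm (y (z n) s r - y x s r)"
        using r s x z(1) by (intro d(2) y_in_ball) auto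
      then have "(1 / h n) * norm (f (y (z n) s r) r - f (y x s r) r - J (y x s r) r *v (y (z n) s r - y x s r))
          \<le> (1 / h n) * (\<epsilon> / growth * norm (y (z n) s r - y x s r))"
        using h(1)[of n] by (intro mult_left_mono) auto
      moreover have "q' n r - J (y x s r) r *v q n r
          = (1 / h n) *\<^sub>R (f (y (z n) s r) r - f (y x s r) r - J (y x s r) r *v (y (z n) s r - y x s r))"
        by (simp only: q_def q'_def matrix_vector_mult_scaleR scaleR_diff_right[symmetric])
      ultimately have "norm (q' n r - J (y x s r) r *v q n r) \<le> \<epsilon> / growth * norm (q n r)"
        using h(1)[of n] by (simp add: q_def mult.commute)
      also have "\<dots> \<le> \<epsilon> / growth * growth"
        using q_le[OF r] that growth_pos by (intro mult_left_mono) auto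
      finally show "norm (q' n r - J (y x s r) r *v q n r) \<le> \<epsilon>"
        using growth_pos by simp
    qed
  qed
  have "uniformly_Cauchy_on {s..T} q"
    unfolding uniformly_Cauchy_on_def
  proof (intro allI impI)
    fix e :: real assume e: "e > 0"
    \<comment> \<open>Gronwall's inequality turns the error \<open>2 * \<epsilon>\<close> of two quotients into at most \<open>e / 2\<close>\<close>
    define \<epsilon> where "\<epsilon> = e / (4 * growth * (sqrt T + 1))"
    have \<epsilon>: "\<epsilon> > 0" using e growth_pos T_nonneg by (simp add: \<epsilon>_def add_nonneg_pos)
    obtain N where N: "\<And>n r. n \<ge> N \<Longrightarrow> r \<in> {s..T} \<Longrightarrow> norm (q' n r - J (y x s r) r *v q n r) \<le> \<epsilon>"
      using lin[OF \<epsilon>] by blast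
    show "\<exists>N. \<forall>r\<in>{s..T}. \<forall>k\<ge>N. \<forall>n\<ge>N. dist (q k r) (q n r) < e"
    proof (intro exI[of _ N] ballI allI impI)
      fix r k n assume r: "r \<in> {s..T}" and kn: "k \<ge> N" "n \<ge> N"
      have "norm (q k r - q n r) \<le> growth * (norm (q k s - q n s) + 2 * \<epsilon> * sqrt T)"
      proof (rule Gronwall_growth[where u = "\<lambda>r. q k r - q n r" and u' = "\<lambda>r. q' k r - q' n r", OF _ _ _ _ _ r])
        fix \<theta> assume \<theta>: "\<theta> \<in> {s..T}"
        show "((\<lambda>r. q k r - q n r) has_vector_derivative q' k \<theta> - q' n \<theta>) (at \<theta> within {s..T})"
          by (intro has_vector_derivative_diff q_der \<theta>)
        let ?J = "J (y x s \<theta>) \<theta>"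
        have eq: "q' k \<theta> - q' n \<theta> = ?J *v (q k \<theta> - q n \<theta>)
            + ((q' k \<theta> - ?J *v q k \<theta>) - (q' n \<theta> - ?J *v q n \<theta>))"
          by (simp add: matrix_vector_mult_diff_distrib)
        have "norm (q' k \<theta> - q' n \<theta>) \<le> norm (?J *v (q k \<theta> - q n \<theta>))
            + (norm (q' k \<theta> - ?J *v q k \<theta>) + norm (q' n \<theta> - ?J *v q n \<theta>))"
          unfolding eq by (rule order_trans[OF norm_triangle_ineq add_left_mono[OF norm_triangle_ineq4]])
        also have "\<dots> \<le> L * norm (q k \<theta> - q n \<theta>) + (\<epsilon> + \<epsilon>)"
          by (rule add_mono[OF J[OF \<theta>] add_mono[OF N[OF kn(1) \<theta>] N[OF kn(2) \<theta>]]])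
        finally show "norm (q' k \<theta> - q' n \<theta>) \<le> L * norm (q k \<theta> - q n \<theta>) + 2 * \<epsilon>"
          by simp
      qed (use \<epsilon> s in auto)
      also have "\<dots> = growth * (2 * \<epsilon> * sqrt T)" by (simp add: q_start)
      also have "\<dots> \<le> growth * (2 * \<epsilon> * (sqrt T + 1))"
        using growth_pos \<epsilon> by (intro mult_left_mono) auto
      also have "\<dots> = e / 2"
      proof -
        have "growth * (sqrt T + 1) \<noteq> 0" using growth_pos T_nonneg by (simp add: add_nonneg_eq_0_iff)
        then show ?thesis by (simp add: \<epsilon>_def field_simps)
      qed
      finally show "dist (q k r) (q n r) < e" using e by (simp add: dist_norm)
    qed
  qed
  then obtain m where m: "uniform_limit {s..T} q m sequentially"
    using Cauchy_uniformly_convergent uniformly_convergent_on_def by blast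
  have "\<exists>g. \<forall>r\<in>{s..T}. (\<lambda>n. q n r) \<longlonglongrightarrow> g r \<and>
      (g has_derivative (\<lambda>k. k *\<^sub>R (J (y x s r) r *v m r))) (at r within {s..T})"
  proof (rule has_derivative_sequence)
    show "(q n has_derivative (\<lambda>k. k *\<^sub>R q' n r)) (at r within {s..T})" if "r \<in> {s..T}" for n r
      using q_der[OF that] by (simp add: has_vector_derivative_def)
    show "(\<lambda>n. q n s) \<longlonglongrightarrow> axis j 1" by (simp add: q_start)
    fix e :: real assume e: "e > 0"
    obtain N where N: "\<And>n r. n \<ge> N \<Longrightarrow> r \<in> {s..T} \<Longrightarrow> norm (q' n r - J (y x s r) r *v q n r) \<le> e / 2"
      using lin[of "e / 2"] e by (meson half_gt_zero)
    have "e / (2 * (L + 1)) > 0" using e L_nonneg by simp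
    then have "\<forall>\<^sub>F n in sequentially. \<forall>r\<in>{s..T}. dist (q n r) (m r) < e / (2 * (L + 1))"
      using m by (auto simp: uniform_limit_iff)
    then show "\<forall>\<^sub>F n in sequentially. \<forall>r\<in>{s..T}. \<forall>k. norm (k *\<^sub>R q' n r - k *\<^sub>R (J (y x s r) r *v m r)) \<le> e * norm k"
      using eventually_ge_at_top[of N]
    proof eventually_elim
      case (elim n)
      show ?case
      proof (intro ballI allI)
        fix r k assume r: "r \<in> {s..T}"
        let ?J = "J (y x s r) r"
        have "norm (?J *v (q n r - m r)) \<le> L * norm (q n r - m r)"
          by (rule J[OF r])
        also have "\<dots> \<le> (L + 1) * (e / (2 * (L + 1)))"
          using elim(1) r L_nonneg by (intro mult_mono) (auto simp: dist_norm less_imp_le)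
        also have "\<dots> = e / 2" using L_nonneg by (simp add: field_simps)
        finally have 1: "norm (?J *v (q n r - m r)) \<le> e / 2" .
        have eq: "q' n r - ?J *v m r = (q' n r - ?J *v q n r) + ?J *v (q n r - m r)"
          by (simp add: matrix_vector_mult_diff_distrib)
        have "norm (q' n r - ?J *v m r) \<le> e / 2 + e / 2"
          unfolding eq by (rule order_trans[OF norm_triangle_ineq add_mono[OF N[OF elim(2) r] 1]])
        then have "norm (q' n r - ?J *v m r) \<le> e" by simp
        then have "\<bar>k\<bar> * norm (q' n r - ?J *v m r) \<le> \<bar>k\<bar> * e"
          by (rule mult_left_mono) simp
        then show "norm (k *\<^sub>R q' n r - k *\<^sub>R (?J *v m r)) \<le> e * norm k"
          by (simp add: scaleR_diff_right[symmetric] mult.commute)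
      qed
    qed
  qed (use s in auto)
  then obtain g where g: "\<And>r. r \<in> {s..T} \<Longrightarrow> (\<lambda>n. q n r) \<longlonglongrightarrow> g r"
      "\<And>r. r \<in> {s..T} \<Longrightarrow> (g has_derivative (\<lambda>k. k *\<^sub>R (J (y x s r) r *v m r))) (at r within {s..T})"
    by blast
  have gm: "g r = m r" if "r \<in> {s..T}" for r
    using LIMSEQ_unique[OF g(1)[OF that] tendsto_uniform_limitI[OF m that]] .
  show ?thesis
  proof (rule that)
    have "(\<lambda>n. q n s) \<longlonglongrightarrow> axis j 1" by (simp add: q_start)
    then show "m s = axis j 1"
      using LIMSEQ_unique[OF tendsto_uniform_limitI[OF m, of s]] s by auto
    show "(m has_vector_derivative J (y x s r) r *v m r) (at r within {s..T})" if "r \<in> {s..T}" for r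
      unfolding has_vector_derivative_def
      by (rule has_derivative_transform[OF that _ g(2)[OF that]]) (simp add: gm)
  qed
qed

lemma ex_variational_matrix:
  assumes x: "x \<in> D" and s: "s \<in> {0..T}"
  obtains W :: "real \<Rightarrow> real^'n^'n" where "W s = mat 1"
    "\<And>r i j. r \<in> {s..T} \<Longrightarrow>
      ((\<lambda>r. W r $ i $ j) has_real_derivative (J (y x s r) r ** W r) $ i $ j) (at r within {s..T})"
proof -
  have "\<exists>m. m s = axis j 1 \<and> (\<forall>r\<in>{s..T}.
      (m has_vector_derivative J (y x s r) r *v m r) (at r within {s..T}))" for j
    using ex_variational_column[OF x s, of j] by metis
  then obtain m where m: "\<And>j. m j s = axis j 1" "\<And>j r. r \<in> {s..T} \<Longrightarrow>
      (m j has_vector_derivative J (y x s r) r *v m j r) (at r within {s..T})"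
    by metis
  show ?thesis
  proof (rule that[of "\<lambda>r. \<chi> i j. m j r $ i"])
    show "(\<chi> i j. m j s $ i) = mat 1"
      by (auto simp: m(1) vec_eq_iff mat_def axis_def)
    fix r i j assume r: "r \<in> {s..T}"
    have "((\<lambda>r. m j r $ i) has_vector_derivative (J (y x s r) r *v m j r) $ i) (at r within {s..T})"
      by (rule bounded_linear.has_vector_derivative[OF bounded_linear_vec_nth m(2)[OF r]])
    then show "((\<lambda>r. (\<chi> i j. m j r $ i) $ i $ j) has_real_derivative
        (J (y x s r) r ** (\<chi> i j. m j r $ i)) $ i $ j) (at r within {s..T})"
      by (simp add: has_real_derivative_iff_has_vector_derivative matrix_matrix_mult_def matrix_vector_mult_def)
  qed
qed

text \<open>The difference of the true increment of the flow and its linear prediction \<open>W t *v v\<close> starts at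
  zero and satisfies the variational equation up to an error \<open>o(norm v)\<close>; Gronwall's inequality
  keeps it of this order.\<close>

lemma y_has_derivative:
  assumes x: "x \<in> D" and s: "s \<in> {0..T}" and t: "t \<in> {s..T}"
    and W: "W s = mat 1" "\<And>r i j. r \<in> {s..T} \<Longrightarrow>
      ((\<lambda>r. W r $ i $ j) has_real_derivative (J (y x s r) r ** W r) $ i $ j) (at r within {s..T})"
  shows "((\<lambda>z. y z s t) has_derivative (\<lambda>v. W t *v v)) (at x within D)"
  unfolding has_derivative_within_alt
proof (intro conjI allI impI)
  show "bounded_linear (\<lambda>v. W t *v v)" by (rule matrix_vector_mul_bounded_linear)
  fix e :: real assume e: "e > 0"
  \<comment> \<open>one factor \<open>growth\<close> is that of \<open>y_close\<close>, the rest comes from \<open>Gronwall_growth\<close>\<close>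
  define \<epsilon> where "\<epsilon> = e / (growth * growth * (sqrt T + 1))"
  have sT: "sqrt T + 1 > 0" using T_nonneg by (simp add: add_nonneg_pos)
  have \<epsilon>: "\<epsilon> > 0" using e growth_pos sT by (simp add: \<epsilon>_def)
  obtain d where d: "d > 0" "\<And>w v t. w \<in> cball 0 R \<Longrightarrow> v \<in> cball 0 R \<Longrightarrow> t \<in> {0..T} \<Longrightarrow>
      norm (v - w) < d \<Longrightarrow> norm (f v t - f w t - J w t *v (v - w)) \<le> \<epsilon> * norm (v - w)"
    using f_linearisation[OF \<epsilon>] by metis
  show "\<exists>d>0. \<forall>z\<in>D. norm (z - x) < d \<longrightarrow> norm (y z s t - y x s t - W t *v (z - x)) \<le> e * norm (z - x)"
  proof (intro exI[of _ "d / growth"] conjI ballI impI)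
    show "d / growth > 0" using d(1) growth_pos by simp
    fix z assume z: "z \<in> D" "norm (z - x) < d / growth"
    let ?v = "z - x"
    let ?u = "\<lambda>r. y z s r - y x s r - W r *v ?v"
    let ?u' = "\<lambda>r. f (y z s r) r - f (y x s r) r - (J (y x s r) r ** W r) *v ?v"
    have "norm (?u t) \<le> growth * (norm (?u s) + (\<epsilon> * (growth * norm ?v)) * sqrt T)"
    proof (rule Gronwall_growth[where u = ?u and u' = ?u', OF _ _ _ _ _ t])
      fix r assume r: "r \<in> {s..T}"
      have "((\<lambda>r. W r *v ?v) has_vector_derivative (J (y x s r) r ** W r) *v ?v) (at r within {s..T})"
      proof (subst has_vector_derivative_def, subst has_derivative_componentwise_within, rule ballI)
        fix b :: "real^'n" assume "b \<in> Basis"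
        then obtain i where b: "b = axis i 1" by (auto simp: Basis_vec_def)
        have "((\<lambda>r. \<Sum>j\<in>UNIV. W r $ i $ j * ?v $ j) has_real_derivative
            (\<Sum>j\<in>UNIV. (J (y x s r) r ** W r) $ i $ j * ?v $ j)) (at r within {s..T})"
          by (intro DERIV_sum DERIV_cmult_right W(2) r)
        then show "((\<lambda>r. (W r *v ?v) \<bullet> b) has_derivative (\<lambda>k. (k *\<^sub>R ((J (y x s r) r ** W r) *v ?v)) \<bullet> b))
            (at r within {s..T})"
          by (simp add: b inner_axis matrix_vector_mult_def has_field_derivative_def mult_commute_abs)
      qed
      then show "(?u has_vector_derivative ?u' r) (at r within {s..T})"
        using z x s r by (intro has_vector_derivative_diff y_derivative) auto
      have close: "norm (y z s r - y x s r) \<le> growth * norm ?v"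
        by (rule y_close[OF z(1) x s r])
      also have "\<dots> < d" using z(2) growth_pos by (simp add: field_simps)
      finally have "norm (f (y z s r) r - f (y x s r) r - J (y x s r) r *v (y z s r - y x s r))
          \<le> \<epsilon> * norm (y z s r - y x s r)"
        using r s x z(1) by (intro d(2) y_in_ball) auto
      also have "\<dots> \<le> \<epsilon> * (growth * norm ?v)"
        using close \<epsilon> by (intro mult_left_mono) auto
      finally have 1: "norm (f (y z s r) r - f (y x s r) r - J (y x s r) r *v (y z s r - y x s r))
          \<le> \<epsilon> * (growth * norm ?v)" .
      have 2: "norm (J (y x s r) r *v ?u r) \<le> L * norm (?u r)"
        using r s x by (intro J_le y_in_ball) auto
      have eq: "?u' r = J (y x s r) r *v ?u r
          + (f (y z s r) r - f (y x s r) r - J (y x s r) r *v (y z s r - y x s r))"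
        by (simp add: matrix_vector_mult_diff_distrib matrix_vector_mul_assoc)
      show "norm (?u' r) \<le> L * norm (?u r) + \<epsilon> * (growth * norm ?v)"
        unfolding eq by (rule order_trans[OF norm_triangle_ineq add_mono[OF 2 1]])
    qed (use s \<epsilon> growth_pos in auto)
    also have "?u s = 0" using y_start x z s by (simp add: W(1))
    also have "growth * (norm (0::real^'n) + \<epsilon> * (growth * norm ?v) * sqrt T)
        \<le> growth * (\<epsilon> * (growth * norm ?v) * (sqrt T + 1))"
      using growth_pos \<epsilon> by (simp add: mult_left_mono)
    also have "\<dots> = e * norm ?v"
    proof -
      have "growth * growth * (sqrt T + 1) \<noteq> 0" using growth_pos sT by simp
      then have "\<epsilon> * (growth * growth * (sqrt T + 1)) = e"
        unfolding \<epsilon>_def by (rule nonzero_eq_divide_eq[THEN iffD1, OF _ refl])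
      from this[symmetric] show ?thesis by (simp only: mult_ac)
    qed
    finally show "norm (y z s t - y x s t - W t *v (z - x)) \<le> e * norm (z - x)" .
  qed
qed

definition field_div :: "real^'n \<Rightarrow> real \<Rightarrow> real" where
  "field_div x t = (\<Sum>i\<in>UNIV. J x t $ i $ i)"

lemma field_div_along_y_continuous:
  assumes "x \<in> D" "s \<in> {0..T}" "S \<subseteq> {s..}"
  shows "continuous_on S (\<lambda>r. field_div (y x s r) r)"
  unfolding field_div_def
proof (intro continuous_on_sum)
  fix i
  show "continuous_on S (\<lambda>r. J (y x s r) r $ i $ i)"
    using continuous_on_compose2[OF J_cont[of i i], of S "\<lambda>r. (y x s r, r)"]
      y_continuous[OF assms] by (simp add: continuous_on_Pair)
qed

text \<open>The determinant is that of the derivative in renamed coordinates, as in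
  \<open>measure_image_two_sided\<close>. A renaming does not change the trace, hence not the right-hand side of
  Liouville's formula.\<close>

lemma y_derivative_and_det:
  fixes e :: "'n idx \<Rightarrow> 'n"
  assumes e: "bij e" and x: "x \<in> D" and s: "s \<in> {0..T}" and t: "t \<in> {s..T}"
  obtains L' where "((\<lambda>z. y z s t) has_derivative L') (at x within D)"
    "det (matrix (reindex e \<circ> L' \<circ> reindex (inv e))) = exp (integral {s..t} (\<lambda>r. field_div (y x s r) r))"
proof -
  obtain W where W: "W s = mat 1" "\<And>r i j. r \<in> {s..T} \<Longrightarrow>
      ((\<lambda>r. W r $ i $ j) has_real_derivative (J (y x s r) r ** W r) $ i $ j) (at r within {s..T})"
    using ex_variational_matrix[OF x s] by metis
  let ?W = "\<lambda>r. (\<chi> i j. W r $ e i $ e j) :: real^('n idx)^('n idx)"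
  let ?A = "\<lambda>r. (\<chi> i j. J (y x s r) r $ e i $ e j) :: real^('n idx)^('n idx)"
  have tr: "trace (?A r) = field_div (y x s r) r" for r
    unfolding trace_def field_div_def using sum.reindex_bij_betw[OF e, of "\<lambda>i. J (y x s r) r $ i $ i"] by simp
  have "det (?W t) = exp (integral {s..t} (\<lambda>r. trace (?A r)))"
  proof (rule det_linear_ode[OF _ _ _ t])
    show "((\<lambda>r. ?W r $ i $ j) has_real_derivative (?A r ** ?W r) $ i $ j) (at r within {s..T})"
      if "r \<in> {s..T}" for r i j
      using W(2)[OF that, of "e i" "e j"]
        sum.reindex_bij_betw[OF e, of "\<lambda>k. J (y x s r) r $ e i $ k * W r $ k $ e j"]
      by (simp add: matrix_matrix_mult_def)
    show "continuous_on {s..T} (\<lambda>r. trace (?A r))"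
      unfolding tr using x s by (intro field_div_along_y_continuous) auto
    show "?W s = mat 1"
      using bij_is_inj[OF e] by (auto simp: W(1) vec_eq_iff mat_def inj_eq)
  qed
  moreover have "matrix (reindex e \<circ> (\<lambda>v. W t *v v) \<circ> reindex (inv e)) = ?W t"
    unfolding matrix_reindex_conj[OF e] by (simp add: matrix_vector_mult_basis column_def)
  ultimately show ?thesis
    using that[OF y_has_derivative[OF x s t W]] unfolding tr by simp
qed

end

section \<open>Maps of bounded volume distortion\<close>

text \<open>By invariance of domain the inverse of \<open>g\<close> is continuous on the open set \<open>g ` E\<close>, and \<open>g ` B\<close> is
  the preimage of \<open>B\<close> under it.\<close>

lemma borel_image_open_injective:
  fixes g :: "'a::euclidean_space \<Rightarrow> 'a"
  assumes E: "open E" and cont: "continuous_on E g" and inj: "inj_on g E"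
    and B: "B \<in> sets borel" "B \<subseteq> E"
  shows "g ` B \<in> sets borel"
proof -
  obtain h where h: "homeomorphism E (g ` E) g h"
    using invariance_of_domain_homeomorphism[OF E cont order_refl inj] .
  have op: "open (g ` E)" using invariance_of_domain[OF cont E inj] .
  have "(\<lambda>z. if z \<in> g ` E then h z else 0) \<in> borel_measurable borel"
    using op h by (intro borel_measurable_continuous_on_if) (auto simp: homeomorphism_def)
  then have "(\<lambda>z. if z \<in> g ` E then h z else 0) -` B \<inter> g ` E \<in> sets borel"
    using B op by (auto intro!: sets.Int measurable_sets_borel)
  also have "(\<lambda>z. if z \<in> g ` E then h z else 0) -` B \<inter> g ` E = g ` B"
  proof (intro equalityI subsetI)
    fix z assume "z \<in> (\<lambda>z. if z \<in> g ` E then h z else 0) -` B \<inter> g ` E"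
    then have z: "z \<in> g ` E" "h z \<in> B" by (simp_all split: if_splits)
    then show "z \<in> g ` B"
      using homeomorphism_apply2[OF h z(1)] by (metis imageI)
  next
    fix z assume "z \<in> g ` B"
    then obtain b where b: "b \<in> B" "z = g b" by blast
    then have "h z = b" using homeomorphism_apply1[OF h, of b] B(2) by auto
    then show "z \<in> (\<lambda>z. if z \<in> g ` E then h z else 0) -` B \<inter> g ` E"
      using b B(2) by auto
  qed
  finally show ?thesis .
qed

text \<open>The two inequalities contain everything about the Jacobian determinant that matters for square
  integrals, in a form that involves neither derivatives nor weights.\<close>

locale volume_distortion =
  fixes E :: "'a::euclidean_space set" and g :: "'a \<Rightarrow> 'a" and A :: real
  assumes open_E: "open E" and bounded_E: "bounded E" and bounded_image: "bounded (g ` E)"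
    and cont: "continuous_on E g" and inj: "inj_on g E" and A_nonneg: "0 \<le> A"
    and vol: "\<And>B. B \<in> sets borel \<Longrightarrow> B \<subseteq> E \<Longrightarrow>
      exp (- A) * measure lborel B \<le> measure lborel (g ` B) \<and> measure lborel (g ` B) \<le> exp A * measure lborel B"
begin

lemma borel_E [measurable]: "E \<in> sets borel"
  using open_E by simp

lemma open_image: "open (g ` E)"
  using invariance_of_domain[OF cont open_E inj] .

lemma borel_image_E [measurable]: "g ` E \<in> sets borel"
  using open_image by simp

lemma emeasure_image_bounds:
  assumes B: "B \<in> sets borel" "B \<subseteq> E"
  shows "emeasure lborel B \<le> ennreal (exp A) * emeasure lborel (g ` B)"
    "emeasure lborel (g ` B) \<le> ennreal (exp A) * emeasure lborel B"
proof -
  have "bounded B" "bounded (g ` B)"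
    using B(2) bounded_E bounded_image by (auto intro: bounded_subset)
  then have fin: "emeasure lborel B \<noteq> \<infinity>" "emeasure lborel (g ` B) \<noteq> \<infinity>"
    using emeasure_bounded_finite by (auto simp: less_top)
  have "measure lborel B \<le> exp A * measure lborel (g ` B)"
    using vol[OF B] by (simp add: exp_minus field_simps)
  then show "emeasure lborel B \<le> ennreal (exp A) * emeasure lborel (g ` B)"
    using fin by (simp add: emeasure_eq_ennreal_measure ennreal_mult[symmetric])
  show "emeasure lborel (g ` B) \<le> ennreal (exp A) * emeasure lborel B"
    using fin vol[OF B] by (simp add: emeasure_eq_ennreal_measure ennreal_mult[symmetric])
qed

text \<open>The value zero outside \<open>E\<close> makes the map Borel measurable on the whole space.\<close>

definition total_map where "total_map x = (if x \<in> E then g x else 0)"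

lemma total_map_measurable [measurable]: "total_map \<in> borel_measurable borel"
  unfolding total_map_def using cont by (intro borel_measurable_continuous_on_if) auto

lemma
  assumes k[measurable]: "k \<in> borel_measurable borel"
  shows nn_integral_image_le: "(\<integral>\<^sup>+x. k (g x) * indicator E x \<partial>lborel)
      \<le> ennreal (exp A) * (\<integral>\<^sup>+z. k z * indicator (g ` E) z \<partial>lborel)" (is "?l \<le> _ * ?r")
    and nn_integral_image_ge: "(\<integral>\<^sup>+z. k z * indicator (g ` E) z \<partial>lborel)
      \<le> ennreal (exp A) * (\<integral>\<^sup>+x. k (g x) * indicator E x \<partial>lborel)"
proof -
  let ?\<mu> = "distr (density lborel (indicator E)) borel total_map"
  let ?\<nu> = "density lborel (indicator (g ` E)) :: 'a measure"
  have \<mu>: "emeasure ?\<mu> S = emeasure lborel {x \<in> E. g x \<in> S}" if [measurable]: "S \<in> sets borel" for S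
  proof -
    have [measurable]: "total_map -` S \<in> sets borel"
      by (rule measurable_sets_borel[OF total_map_measurable that])
    have "emeasure ?\<mu> S = (\<integral>\<^sup>+x. indicator E x * indicator (total_map -` S) x \<partial>lborel)"
      by (simp add: emeasure_distr emeasure_density)
    also have "\<dots> = (\<integral>\<^sup>+x. indicator {x \<in> E. g x \<in> S} x \<partial>lborel)"
      by (intro nn_integral_cong) (auto simp: indicator_def total_map_def)
    also have "\<dots> = emeasure lborel {x \<in> E. g x \<in> S}"
    proof -
      have "{x \<in> E. g x \<in> S} = E \<inter> total_map -` S" by (auto simp: total_map_def)
      then show ?thesis by (simp add: measurable_sets_borel)
    qed
    finally show ?thesis .
  qed
  have \<nu>: "emeasure ?\<nu> S = emeasure lborel (g ` {x \<in> E. g x \<in> S})" if [measurable]: "S \<in> sets borel" for S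
  proof -
    have "emeasure ?\<nu> S = (\<integral>\<^sup>+z. indicator (g ` E \<inter> S) z \<partial>lborel)"
      by (simp add: emeasure_density indicator_inter_arith)
    also have "\<dots> = emeasure lborel (g ` E \<inter> S)" by simp
    also have "g ` E \<inter> S = g ` {x \<in> E. g x \<in> S}" by auto
    finally show ?thesis .
  qed
  have B: "{x \<in> E. g x \<in> S} \<in> sets borel" if [measurable]: "S \<in> sets borel" for S
  proof -
    have "{x \<in> E. g x \<in> S} = E \<inter> total_map -` S" by (auto simp: total_map_def)
    then show ?thesis by (simp add: measurable_sets_borel)
  qed
  have scale_le: "K \<le> scale_measure c N"
    if "sets K = sets borel" "sets N = sets borel" "\<And>S. S \<in> sets borel \<Longrightarrow> emeasure K S \<le> c * emeasure N S"
    for K N :: "'a measure" and c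
  proof -
    have "emeasure K S \<le> c * emeasure N S" for S
      using that by (cases "S \<in> sets borel") (auto simp: emeasure_notin_sets)
    moreover have "space K = space N" using that by (metis sets_eq_imp_space_eq)
    ultimately show ?thesis
      using that by (simp add: le_measure_iff le_fun_def space_scale_measure)
  qed
  have le: "?\<mu> \<le> scale_measure (ennreal (exp A)) ?\<nu>" "?\<nu> \<le> scale_measure (ennreal (exp A)) ?\<mu>"
    by (rule scale_le; use emeasure_image_bounds[OF B] in \<open>simp add: \<mu> \<nu>\<close>)+
  have l: "nn_integral ?\<mu> k = ?l"
    by (simp add: nn_integral_distr nn_integral_density)
      (intro nn_integral_cong, auto simp: total_map_def indicator_def)
  have r: "nn_integral ?\<nu> k = ?r"
    by (simp add: nn_integral_density mult.commute)
  show "?l \<le> ennreal (exp A) * ?r"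
    using nn_integral_mono_measure[OF _ le(1), of k] by (simp add: nn_integral_scale_measure l r)
  show "?r \<le> ennreal (exp A) * ?l"
    using nn_integral_mono_measure[OF _ le(2), of k] by (simp add: nn_integral_scale_measure l r)
qed

text \<open>For nonnegative integrands the two volume inequalities carry over to integrals, and
  \<open>1 - exp (- A) \<le> exp A - 1\<close> makes the resulting bound symmetric. The general case is the
  difference of the positive and the negative part.\<close>

lemma integral_image_close:
  fixes k :: "'a \<Rightarrow> real"
  assumes k[measurable]: "k \<in> borel_measurable borel"
    and int: "integrable lborel (\<lambda>z. k z * indicator (g ` E) z)"
  shows "integrable lborel (\<lambda>x. k (g x) * indicator E x)"
    and "\<bar>(LINT x|lborel. k (g x) * indicator E x) - (LINT z|lborel. k z * indicator (g ` E) z)\<bar>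
      \<le> (exp A - 1) * (LINT z|lborel. \<bar>k z\<bar> * indicator (g ` E) z)"
proof -
  have meas: "(\<lambda>x. p (g x) * indicator E x) \<in> borel_measurable borel"
    if [measurable]: "p \<in> borel_measurable borel" for p :: "'a \<Rightarrow> real"
  proof -
    have "(\<lambda>x. p (g x) * indicator E x) = (\<lambda>x. p (total_map x) * indicator E x)"
      by (auto simp: total_map_def indicator_def)
    then show ?thesis by simp
  qed
  have nonneg: "integrable lborel (\<lambda>x. p (g x) * indicator E x) \<and>
      \<bar>(LINT x|lborel. p (g x) * indicator E x) - (LINT z|lborel. p z * indicator (g ` E) z)\<bar>
      \<le> (exp A - 1) * (LINT z|lborel. p z * indicator (g ` E) z)"
    if [measurable]: "p \<in> borel_measurable borel" and p: "\<And>z. 0 \<le> p z"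
      and pint: "integrable lborel (\<lambda>z. p z * indicator (g ` E) z)" for p :: "'a \<Rightarrow> real"
  proof -
    let ?b = "LINT z|lborel. p z * indicator (g ` E) z"
    have b0: "0 \<le> ?b" using p by (intro Bochner_Integration.integral_nonneg) auto
    have ind: "ennreal (p w) * indicator S x = ennreal (p w * indicator S x)" for w x and S :: "'a set"
      by (auto simp: indicator_def)
    have b: "(\<integral>\<^sup>+z. ennreal (p z) * indicator (g ` E) z \<partial>lborel) = ennreal ?b"
      unfolding ind using p by (intro nn_integral_eq_integral pint) auto
    have le: "(\<integral>\<^sup>+x. ennreal (p (g x)) * indicator E x \<partial>lborel) \<le> ennreal (exp A * ?b)"
      using nn_integral_image_le[of "\<lambda>z. ennreal (p z)"] b b0 by (simp add: ennreal_mult)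
    have aint: "integrable lborel (\<lambda>x. p (g x) * indicator E x)"
    proof (rule integrableI_nonneg)
      show "(\<integral>\<^sup>+x. ennreal (p (g x) * indicator E x) \<partial>lborel) < \<infinity>"
        using le unfolding ind by (simp add: le_less_trans)
    qed (use meas p in auto)
    let ?a = "LINT x|lborel. p (g x) * indicator E x"
    have a0: "0 \<le> ?a" using p by (intro Bochner_Integration.integral_nonneg) auto
    have a: "(\<integral>\<^sup>+x. ennreal (p (g x)) * indicator E x \<partial>lborel) = ennreal ?a"
      unfolding ind using p by (intro nn_integral_eq_integral aint) auto
    have 1: "?a \<le> exp A * ?b"
      using le b0 unfolding a by simp
    have "ennreal ?b \<le> ennreal (exp A * ?a)"
      using nn_integral_image_ge[of "\<lambda>z. ennreal (p z)"] a0 unfolding a b by (simp add: ennreal_mult)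
    then have 2: "?b \<le> exp A * ?a"
      using a0 by simp
    have "?b - ?a \<le> (exp A - 1) * ?b"
    proof -
      have "exp (- A) * ?b \<le> exp (- A) * (exp A * ?a)"
        using 2 by (intro mult_left_mono) auto
      then have "exp (- A) * ?b \<le> ?a"
        by (simp add: mult.assoc[symmetric] exp_add[symmetric])
      moreover have "2 - exp A \<le> exp (- A)"
      proof -
        have uv: "exp A * exp (- A) = 1" by (simp add: exp_add[symmetric])
        have "0 \<le> (exp A - 1)\<^sup>2 * exp (- A)" by simp
        also have "\<dots> = exp A - 2 + exp (- A)" using uv by algebra
        finally show ?thesis by simp
      qed
      then have "(2 - exp A) * ?b \<le> exp (- A) * ?b"
        using b0 by (rule mult_right_mono)
      ultimately show ?thesis by (simp add: algebra_simps)
    qed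
    then show ?thesis using 1 aint by (simp add: algebra_simps abs_le_iff)
  qed
  let ?p = "\<lambda>z. max 0 (k z)" and ?n = "\<lambda>z. max 0 (- k z)"
  have ints: "integrable lborel (\<lambda>z. ?p z * indicator (g ` E) z)" "integrable lborel (\<lambda>z. ?n z * indicator (g ` E) z)"
    by (rule Bochner_Integration.integrable_bound[OF int]; auto simp: indicator_def)+
  note P = nonneg[of ?p, OF _ _ ints(1)] and N = nonneg[of ?n, OF _ _ ints(2)]
  have diff: "k w * c = ?p w * c - ?n w * c" and sum: "\<bar>k w\<bar> * c = ?p w * c + ?n w * c" for w c
    by (auto simp: max_def)
  show "integrable lborel (\<lambda>x. k (g x) * indicator E x)"
    unfolding diff using P N by simp
  show "\<bar>(LINT x|lborel. k (g x) * indicator E x) - (LINT z|lborel. k z * indicator (g ` E) z)\<bar>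
      \<le> (exp A - 1) * (LINT z|lborel. \<bar>k z\<bar> * indicator (g ` E) z)"
    unfolding diff sum using P N ints by (simp add: distrib_left) linarith
qed

text \<open>The part of a null set in the image has a preimage of measure zero, because \<open>g\<close> does not shrink
  volumes by more than the factor \<open>exp (- A)\<close>.\<close>

lemma AE_image:
  assumes "AE z in lebesgue. z \<in> g ` E \<longrightarrow> Q z"
  shows "AE x in lebesgue. x \<in> E \<longrightarrow> Q (g x)"
proof -
  have "AE z in lborel. z \<in> g ` E \<longrightarrow> Q z"
    using assms by (simp add: AE_completion_iff)
  then obtain N where N: "N \<in> null_sets lborel" "\<forall>z. z \<notin> N \<longrightarrow> z \<in> g ` E \<longrightarrow> Q z"
    by (auto elim!: AE_E3)
  then have [measurable]: "N \<in> sets borel" by auto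
  have "(\<integral>\<^sup>+z. indicator N z * indicator (g ` E) z \<partial>lborel) \<le> (\<integral>\<^sup>+z. indicator N z \<partial>lborel)"
    by (intro nn_integral_mono) (auto simp: indicator_def)
  also have "\<dots> = 0" using N(1) by auto
  finally have "(\<integral>\<^sup>+x. indicator N (g x) * indicator E x \<partial>lborel) = 0"
    using nn_integral_image_le[of "indicator N"] by simp
  moreover have "(\<lambda>x. indicator N (g x) * indicator E x :: ennreal) \<in> borel_measurable borel"
  proof -
    have "(\<lambda>x. indicator N (g x) * indicator E x :: ennreal) = (\<lambda>x. indicator N (total_map x) * indicator E x)"
      by (auto simp: total_map_def indicator_def)
    then show ?thesis by simp
  qed
  ultimately have "AE x in lborel. indicator N (g x) * indicator E x = (0::ennreal)"
    by (subst (asm) nn_integral_0_iff_AE) auto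
  then have "AE x in lborel. x \<in> E \<longrightarrow> Q (g x)"
    by eventually_elim (use N(2) in \<open>auto simp: indicator_def split: if_splits\<close>)
  then show ?thesis by (simp add: AE_completion_iff)
qed

end


section \<open>Composition with a killed flow\<close>

lemma nn_integral_lebesgue_on_eq_lborel:
  assumes "D \<in> sets borel"
  shows "(\<integral>\<^sup>+x. q x \<partial>lebesgue_on D) = (\<integral>\<^sup>+x. q x * indicator D x \<partial>lborel)"
  using assms by (subst nn_integral_restrict_space) (auto simp: nn_integral_completion)

lemma
  fixes q :: "'a::euclidean_space \<Rightarrow> real"
  assumes D: "D \<in> sets borel" and q[measurable]: "q \<in> borel_measurable borel" and 0: "\<And>x. x \<notin> D \<Longrightarrow> q x = 0"
  shows integral_lebesgue_on_eq_lborel: "(LINT x|lebesgue_on D. q x) = (LINT x|lborel. q x)"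
    and integrable_lebesgue_on_iff_lborel: "integrable (lebesgue_on D) q \<longleftrightarrow> integrable lborel q"
proof -
  have eq: "(\<lambda>x. indicator D x * q x) = q" using 0 by (auto simp: indicator_def fun_eq_iff)
  show "(LINT x|lebesgue_on D. q x) = (LINT x|lborel. q x)"
    using D by (subst integral_restrict_space) (auto simp: eq integral_completion)
  show "integrable (lebesgue_on D) q \<longleftrightarrow> integrable lborel q"
    using D by (subst integrable_restrict_space) (auto simp: eq integrable_completion)
qed

lemma AE_lebesgue_on_iff:
  "D \<in> sets lebesgue \<Longrightarrow> (AE x in lebesgue_on D. Q x) \<longleftrightarrow> (AE x in lebesgue. x \<in> D \<longrightarrow> Q x)"
  by (simp add: AE_restrict_space_iff)

lemma ex_borel_version:
  fixes k :: "'a::euclidean_space \<Rightarrow> real"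
  assumes D: "D \<in> sets borel" and k: "k \<in> borel_measurable (lebesgue_on D)"
  obtains k0 where "k0 \<in> borel_measurable borel" "\<And>x. x \<notin> D \<Longrightarrow> k0 x = 0"
    "AE x in lebesgue_on D. k x = k0 x"
proof -
  have Dl: "D \<in> sets lebesgue" using D by simp
  have "(\<lambda>x. if x \<in> D then k x else 0) \<in> borel_measurable lebesgue"
    using k Dl by (subst borel_measurable_if) auto
  then obtain k' where k': "k' \<in> borel_measurable lborel" "AE x in lborel. (if x \<in> D then k x else 0) = k' x"
    using completion_ex_borel_measurable_real by blast
  show ?thesis
  proof (rule that[of "\<lambda>x. if x \<in> D then k' x else 0"])
    show "(\<lambda>x. if x \<in> D then k' x else 0) \<in> borel_measurable borel"
      using k'(1) D by simp
    have "AE x in lebesgue. x \<in> D \<longrightarrow> k x = (if x \<in> D then k' x else 0)"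
      using AE_completion[OF k'(2)] by eventually_elim auto
    then show "AE x in lebesgue_on D. k x = (if x \<in> D then k' x else 0)"
      by (simp add: AE_lebesgue_on_iff[OF Dl])
  qed simp
qed

text \<open>A flow from which a point is removed when it leaves \<open>D\<close>; \<open>E s t\<close> consists of the points that
  survive from time \<open>s\<close> until time \<open>t\<close>. The exponent of the volume distortion is an increment of a
  continuous function \<open>\<alpha>\<close>, so it is small over short times.\<close>

locale killed_flow =
  fixes D :: "'a::euclidean_space set" and T :: real
    and E :: "real \<Rightarrow> real \<Rightarrow> 'a set" and \<Phi> :: "real \<Rightarrow> real \<Rightarrow> 'a \<Rightarrow> 'a"
    and \<alpha> :: "real \<Rightarrow> real" and M :: real
  assumes open_D: "open D" and bounded_D: "bounded D" and M_nonneg: "0 \<le> M"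
    and E_subset: "0 \<le> s \<Longrightarrow> s \<le> t \<Longrightarrow> t \<le> T \<Longrightarrow> E s t \<subseteq> D"
    and \<Phi>_in_D: "0 \<le> s \<Longrightarrow> s \<le> t \<Longrightarrow> t \<le> T \<Longrightarrow> x \<in> E s t \<Longrightarrow> \<Phi> s t x \<in> D"
    and E_flow: "0 \<le> s \<Longrightarrow> s \<le> r \<Longrightarrow> r \<le> t \<Longrightarrow> t \<le> T \<Longrightarrow> x \<in> E s t \<longleftrightarrow> x \<in> E s r \<and> \<Phi> s r x \<in> E r t"
    and \<Phi>_flow: "0 \<le> s \<Longrightarrow> s \<le> r \<Longrightarrow> r \<le> t \<Longrightarrow> t \<le> T \<Longrightarrow> x \<in> E s t \<Longrightarrow> \<Phi> s t x = \<Phi> r t (\<Phi> s r x)"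
    and \<Phi>_displacement: "0 \<le> s \<Longrightarrow> s \<le> t \<Longrightarrow> t \<le> T \<Longrightarrow> x \<in> E s t \<Longrightarrow> dist x (\<Phi> s t x) \<le> M * (t - s)"
    and E_large: "0 \<le> s \<Longrightarrow> s \<le> t \<Longrightarrow> t \<le> T \<Longrightarrow> cball x (M * (t - s)) \<subseteq> D \<Longrightarrow> x \<in> E s t"
    and distortion: "0 \<le> s \<Longrightarrow> s \<le> t \<Longrightarrow> t \<le> T \<Longrightarrow> volume_distortion (E s t) (\<Phi> s t) (\<alpha> t - \<alpha> s)"
    and \<alpha>_cont: "continuous_on {0..T} \<alpha>"
begin

lemma borel_D [measurable]: "D \<in> sets borel" and lmeasurable_D: "D \<in> lmeasurable"
  and lebesgue_D: "D \<in> sets lebesgue"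
  using open_D bounded_D lmeasurable_open by auto

lemma \<alpha>_mono: "0 \<le> s \<Longrightarrow> s \<le> t \<Longrightarrow> t \<le> T \<Longrightarrow> \<alpha> s \<le> \<alpha> t"
  using volume_distortion.A_nonneg[OF distortion[of s t]] by simp

text \<open>The composition operator of the killed flow.\<close>

definition pull :: "real \<Rightarrow> real \<Rightarrow> ('a \<Rightarrow> real) \<Rightarrow> 'a \<Rightarrow> real" where
  "pull s t k x = (if x \<in> E s t then k (\<Phi> s t x) else 0)"

lemma pull_diff: "pull s t (\<lambda>x. k x - l x) x = pull s t k x - pull s t l x"
  by (simp add: pull_def)

lemma pull_AE_cong:
  assumes st: "0 \<le> s" "s \<le> t" "t \<le> T" and eq: "AE x in lebesgue_on D. k x = l x"
  shows "AE x in lebesgue_on D. pull s t k x = pull s t l x"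
proof -
  interpret volume_distortion "E s t" "\<Phi> s t" "\<alpha> t - \<alpha> s" by (rule distortion[OF st])
  have "AE z in lebesgue. z \<in> \<Phi> s t ` E s t \<longrightarrow> k z = l z"
    using eq unfolding AE_lebesgue_on_iff[OF lebesgue_D]
    by eventually_elim (use \<Phi>_in_D[OF st] in auto)
  then have "AE x in lebesgue. x \<in> E s t \<longrightarrow> k (\<Phi> s t x) = l (\<Phi> s t x)"
    by (rule AE_image)
  then show ?thesis
    unfolding AE_lebesgue_on_iff[OF lebesgue_D] by eventually_elim (simp add: pull_def)
qed

lemma pull_borel:
  assumes st: "0 \<le> s" "s \<le> t" "t \<le> T" and k[measurable]: "k \<in> borel_measurable borel"
  shows "pull s t k \<in> borel_measurable borel"
proof -
  interpret volume_distortion "E s t" "\<Phi> s t" "\<alpha> t - \<alpha> s" by (rule distortion[OF st])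
  have "pull s t k = (\<lambda>x. if x \<in> E s t then k (total_map x) else 0)"
    by (auto simp: pull_def total_map_def)
  then show ?thesis by simp
qed

lemma nn_integral_pull_le:
  assumes st: "0 \<le> s" "s \<le> t" "t \<le> T" and k[measurable]: "k \<in> borel_measurable borel"
  shows "(\<integral>\<^sup>+x. ennreal ((pull s t k x)\<^sup>2) \<partial>lborel)
    \<le> ennreal (exp (\<alpha> t - \<alpha> s)) * (\<integral>\<^sup>+z. ennreal ((k z)\<^sup>2) * indicator D z \<partial>lborel)"
proof -
  interpret volume_distortion "E s t" "\<Phi> s t" "\<alpha> t - \<alpha> s" by (rule distortion[OF st])
  have "(\<integral>\<^sup>+x. ennreal ((pull s t k x)\<^sup>2) \<partial>lborel)
      = (\<integral>\<^sup>+x. ennreal ((k (\<Phi> s t x))\<^sup>2) * indicator (E s t) x \<partial>lborel)"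
    by (intro nn_integral_cong) (auto simp: pull_def indicator_def)
  also have "\<dots> \<le> ennreal (exp (\<alpha> t - \<alpha> s)) * (\<integral>\<^sup>+z. ennreal ((k z)\<^sup>2) * indicator (\<Phi> s t ` E s t) z \<partial>lborel)"
    by (rule nn_integral_image_le) measurable
  also have "\<dots> \<le> ennreal (exp (\<alpha> t - \<alpha> s)) * (\<integral>\<^sup>+z. ennreal ((k z)\<^sup>2) * indicator D z \<partial>lborel)"
    using \<Phi>_in_D[OF st] by (intro mult_left_mono nn_integral_mono) (auto simp: indicator_def)
  finally show ?thesis .
qed

lemma
  assumes st: "0 \<le> s" "s \<le> t" "t \<le> T" and k: "in_L2 D k"
  shows in_L2_pull: "in_L2 D (pull s t k)"
    and L2_nrm_pull_le: "L2_nrm D (pull s t k) \<le> exp ((\<alpha> t - \<alpha> s) / 2) * L2_nrm D k"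
proof -
  have km: "k \<in> borel_measurable (lebesgue_on D)" using k by (simp add: in_L2_def)
  obtain k0 where k0[measurable]: "k0 \<in> borel_measurable borel" and out: "\<And>x. x \<notin> D \<Longrightarrow> k0 x = 0"
    and eq: "AE x in lebesgue_on D. k x = k0 x"
    using ex_borel_version[OF borel_D km] by blast
  have k0L: "in_L2 D k0" "L2_nrm D k0 = L2_nrm D k"
    using L2_AE_cong[OF lebesgue_D km eq] k by auto
  have eq': "AE x in lebesgue_on D. pull s t k0 x = pull s t k x"
    using pull_AE_cong[OF st eq] by eventually_elim simp
  have m0: "pull s t k0 \<in> borel_measurable (lebesgue_on D)"
    using pull_borel[OF st k0] by (intro measurable_restrict_space1 measurable_completion) simp
  let ?c = "exp ((\<alpha> t - \<alpha> s) / 2) * L2_nrm D k"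
  have "(\<integral>\<^sup>+x. ennreal ((pull s t k0 x)\<^sup>2) \<partial>lebesgue_on D) \<le> (\<integral>\<^sup>+x. ennreal ((pull s t k0 x)\<^sup>2) \<partial>lborel)"
    unfolding nn_integral_lebesgue_on_eq_lborel[OF borel_D]
    by (intro nn_integral_mono) (auto simp: indicator_def)
  also have "\<dots> \<le> ennreal (exp (\<alpha> t - \<alpha> s)) * ennreal ((L2_nrm D k)\<^sup>2)"
    using nn_integral_pull_le[OF st k0] nn_integral_power2_L2[OF k0L(1)]
    by (simp add: nn_integral_lebesgue_on_eq_lborel k0L(2))
  also have "\<dots> = ennreal (?c\<^sup>2)"
    by (simp add: ennreal_mult[symmetric] power_mult_distrib exp_double[symmetric])
  finally have "in_L2 D (pull s t k0)" "L2_nrm D (pull s t k0) \<le> ?c"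
    using in_L2_bound[OF m0, of ?c] by auto
  then show "in_L2 D (pull s t k)" "L2_nrm D (pull s t k) \<le> ?c"
    using L2_AE_cong[OF lebesgue_D m0 eq'] by auto
qed

lemma one_in_L2: "in_L2 D (\<lambda>_. 1)"
  by (rule in_L2_bounded[OF lmeasurable_D, where c = 1]) auto

lemma L2_nrm_le_uniform:
  assumes "k \<in> borel_measurable (lebesgue_on D)" "0 \<le> c" "\<And>x. x \<in> D \<Longrightarrow> \<bar>k x\<bar> \<le> c"
  shows "L2_nrm D k \<le> c * L2_nrm D (\<lambda>_. 1)"
proof -
  have k: "in_L2 D k" by (rule in_L2_bounded[OF lmeasurable_D assms(1,3)])
  have c: "in_L2 D (\<lambda>_. c)" by (rule in_L2_bounded[OF lmeasurable_D, where c = c]) (use assms(2) in auto)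
  have "L2_nrm D k \<le> L2_nrm D (\<lambda>_. c)"
    unfolding L2_nrm_def
  proof (intro real_sqrt_le_mono integral_mono)
    fix x assume "x \<in> space (lebesgue_on D)"
    then show "(k x)\<^sup>2 \<le> c\<^sup>2"
      using power_mono[OF assms(3), of x 2] by simp
  qed (use k c in \<open>auto simp: in_L2_def\<close>)
  also have "\<dots> = c * L2_nrm D (\<lambda>_. 1)"
    using assms(2) by (simp add: L2_nrm_def real_sqrt_mult)
  finally show ?thesis .
qed

lemma compactly_inside_uniform:
  assumes k: "compactly_inside D k" and \<eta>: "0 < \<eta>"
  obtains \<epsilon> \<delta> where "0 < \<epsilon>" "\<And>x. \<not> cball x \<epsilon> \<subseteq> D \<Longrightarrow> k x = 0" "0 < \<delta>"
    "\<And>x z. x \<in> D \<Longrightarrow> z \<in> D \<Longrightarrow> dist x z < \<delta> \<Longrightarrow> \<bar>k z - k x\<bar> < \<eta>"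
proof -
  obtain \<epsilon> where kc: "continuous_on UNIV k" and \<epsilon>: "0 < \<epsilon>" "\<And>x. \<not> cball x \<epsilon> \<subseteq> D \<Longrightarrow> k x = 0"
    using k by (auto simp: compactly_inside_def)
  have "uniformly_continuous_on (closure D) k"
    using kc bounded_D by (intro compact_uniformly_continuous) (auto intro: continuous_on_subset)
  then obtain \<delta> where \<delta>: "0 < \<delta>" "\<And>x z. x \<in> closure D \<Longrightarrow> z \<in> closure D \<Longrightarrow> dist z x < \<delta> \<Longrightarrow> dist (k z) (k x) < \<eta>"
    using \<eta> unfolding uniformly_continuous_on_def by blast
  show ?thesis
  proof (rule that[OF \<epsilon> \<delta>(1)])
    show "\<bar>k z - k x\<bar> < \<eta>" if "x \<in> D" "z \<in> D" "dist x z < \<delta>" for x z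
      using \<delta>(2)[of x z] that closure_subset[of D] by (auto simp: dist_real_def dist_commute)
  qed auto
qed

lemma small_displacement:
  assumes "0 < d"
  obtains \<delta> where "0 < \<delta>" "\<And>s t. t - s < \<delta> \<Longrightarrow> M * (t - s) < d"
proof (rule that[of "d / (M + 1)"])
  show "0 < d / (M + 1)" using assms M_nonneg by simp
  fix s t :: real assume "t - s < d / (M + 1)"
  then have *: "(M + 1) * (t - s) < d" using M_nonneg by (simp add: field_simps)
  show "M * (t - s) < d"
  proof (cases "0 \<le> t - s")
    case True
    then show ?thesis using * by (simp add: distrib_right)
  next
    case False
    then have "M * (t - s) \<le> 0" using M_nonneg by (intro mult_nonneg_nonpos) auto
    then show ?thesis using assms by simp
  qed
qed

text \<open>Points move by at most \<open>M * (t - s)\<close>. For short times the surviving points are controlled by the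
  uniform continuity of \<open>k\<close>, and the removed ones are so close to the boundary that \<open>k\<close> vanishes
  at them.\<close>

lemma pull_compactly_inside_close:
  assumes k: "compactly_inside D k" and e: "0 < e"
  obtains \<delta> where "0 < \<delta>" "\<And>s t. 0 \<le> s \<Longrightarrow> s \<le> t \<Longrightarrow> t \<le> T \<Longrightarrow> t - s < \<delta> \<Longrightarrow>
    L2_nrm D (\<lambda>x. pull s t k x - k x) < e"
proof -
  define \<eta> where "\<eta> = e / (L2_nrm D (\<lambda>_. 1) + 1)"
  have pos: "0 < L2_nrm D (\<lambda>_. 1) + 1" by (simp add: add_nonneg_pos)
  have \<eta>: "0 < \<eta>" using e pos by (simp add: \<eta>_def)
  obtain \<epsilon> d where \<epsilon>: "0 < \<epsilon>" "\<And>x. \<not> cball x \<epsilon> \<subseteq> D \<Longrightarrow> k x = 0" and d: "0 < d"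
    "\<And>x z. x \<in> D \<Longrightarrow> z \<in> D \<Longrightarrow> dist x z < d \<Longrightarrow> \<bar>k z - k x\<bar> < \<eta>"
    using compactly_inside_uniform[OF k \<eta>] by metis
  obtain \<delta> where \<delta>: "0 < \<delta>" "\<And>s t. t - s < \<delta> \<Longrightarrow> M * (t - s) < min \<epsilon> d"
    using small_displacement[of "min \<epsilon> d"] \<epsilon>(1) d(1) by auto
  show ?thesis
  proof (rule that[OF \<delta>(1)])
    fix s t assume st: "0 \<le> s" "s \<le> t" "t \<le> T" "t - s < \<delta>"
    have small: "M * (t - s) < \<epsilon>" "M * (t - s) < d" using \<delta>(2)[OF st(4)] by auto
    have kL: "in_L2 D k" by (rule compactly_inside_in_L2[OF open_D bounded_D k])
    have "L2_nrm D (\<lambda>x. pull s t k x - k x) \<le> \<eta> * L2_nrm D (\<lambda>_. 1)"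
    proof (rule L2_nrm_le_uniform)
      show "(\<lambda>x. pull s t k x - k x) \<in> borel_measurable (lebesgue_on D)"
        using in_L2_diff[OF in_L2_pull[OF st(1-3) kL] kL] by (simp add: in_L2_def)
      fix x assume x: "x \<in> D"
      show "\<bar>pull s t k x - k x\<bar> \<le> \<eta>"
      proof (cases "x \<in> E s t")
        case True
        then have "dist x (\<Phi> s t x) < d" using \<Phi>_displacement[OF st(1-3)] small by fastforce
        then show ?thesis using d(2)[OF x \<Phi>_in_D[OF st(1-3) True]] True by (simp add: pull_def less_imp_le)
      next
        case False
        then have "\<not> cball x \<epsilon> \<subseteq> D"
          using E_large[OF st(1-3), of x] small cball_subset_cball_iff[of x "M * (t - s)" x \<epsilon>] by auto
        then show ?thesis using False \<epsilon>(2) \<eta> by (simp add: pull_def)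
      qed
    qed (use \<eta> in simp)
    also have "\<dots> < \<eta> * (L2_nrm D (\<lambda>_. 1) + 1)" using \<eta> by simp
    also have "\<dots> = e" using pos by (simp add: \<eta>_def)
    finally show "L2_nrm D (\<lambda>x. pull s t k x - k x) < e" .
  qed
qed

definition L2_factor where "L2_factor = exp ((\<alpha> T - \<alpha> 0) / 2)"

lemma L2_factor_pos: "0 < L2_factor" by (simp add: L2_factor_def)

lemma L2_factor_half: "(L2_factor + 1) * (e / (2 * (L2_factor + 1))) = e / 2"
proof -
  have "b * (e / (2 * b)) = e / 2" if "0 < b" for b :: real using that by simp
  then show ?thesis using L2_factor_pos by (metis add_pos_pos zero_less_one)
qed

lemma exp_le_L2_factor:
  assumes "0 \<le> s" "s \<le> t" "t \<le> T"
  shows "exp ((\<alpha> t - \<alpha> s) / 2) \<le> L2_factor"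
  using \<alpha>_mono[of 0 s] \<alpha>_mono[of t T] assms by (simp add: L2_factor_def)

text \<open>Approximation by functions supported inside \<open>D\<close>; the operators \<open>pull s t\<close> are bounded by
  \<open>L2_factor\<close> for all times.\<close>

lemma pull_L2_close:
  assumes g: "in_L2 D g" and e: "0 < e"
  obtains \<delta> where "0 < \<delta>" "\<And>s t. 0 \<le> s \<Longrightarrow> s \<le> t \<Longrightarrow> t \<le> T \<Longrightarrow> t - s < \<delta> \<Longrightarrow>
    L2_nrm D (\<lambda>x. pull s t g x - g x) < e"
proof -
  let ?\<epsilon> = "e / (2 * (L2_factor + 1))"
  have "0 < ?\<epsilon>" using e L2_factor_pos by simp
  then obtain k where k: "compactly_inside D k" "L2_nrm D (\<lambda>x. g x - k x) < ?\<epsilon>"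
    using compactly_inside_dense_in_L2[OF open_D bounded_D g] by blast
  have kL: "in_L2 D k" by (rule compactly_inside_in_L2[OF open_D bounded_D k(1)])
  obtain \<delta> where \<delta>: "0 < \<delta>" "\<And>s t. 0 \<le> s \<Longrightarrow> s \<le> t \<Longrightarrow> t \<le> T \<Longrightarrow> t - s < \<delta> \<Longrightarrow>
      L2_nrm D (\<lambda>x. pull s t k x - k x) < e / 2"
    using pull_compactly_inside_close[OF k(1), of "e / 2"] e by auto
  show ?thesis
  proof (rule that[OF \<delta>(1)])
    fix s t assume st: "0 \<le> s" "s \<le> t" "t \<le> T" and close: "t - s < \<delta>"
    have gk: "in_L2 D (\<lambda>x. g x - k x)" by (rule in_L2_diff[OF g kL])
    have pk: "in_L2 D (\<lambda>x. pull s t k x - k x)" by (rule in_L2_diff[OF in_L2_pull[OF st kL] kL])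
    have "L2_nrm D (\<lambda>x. pull s t g x - g x)
        = L2_nrm D (\<lambda>x. (pull s t (\<lambda>x. g x - k x) x + (pull s t k x - k x)) - (g x - k x))"
      by (simp add: pull_diff)
    also have "\<dots> \<le> L2_nrm D (\<lambda>x. pull s t (\<lambda>x. g x - k x) x + (pull s t k x - k x)) + L2_nrm D (\<lambda>x. g x - k x)"
      by (intro L2_nrm_triangle_diff in_L2_add in_L2_pull[OF st gk] pk gk)
    also have "L2_nrm D (\<lambda>x. pull s t (\<lambda>x. g x - k x) x + (pull s t k x - k x))
        \<le> L2_nrm D (pull s t (\<lambda>x. g x - k x)) + L2_nrm D (\<lambda>x. pull s t k x - k x)"
      by (rule L2_nrm_triangle[OF in_L2_pull[OF st gk] pk])
    also have "L2_nrm D (pull s t (\<lambda>x. g x - k x)) \<le> L2_factor * L2_nrm D (\<lambda>x. g x - k x)"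
      using L2_nrm_pull_le[OF st gk] mult_right_mono[OF exp_le_L2_factor[OF st]] by (rule order_trans) simp
    finally have "L2_nrm D (\<lambda>x. pull s t g x - g x)
        \<le> (L2_factor + 1) * L2_nrm D (\<lambda>x. g x - k x) + L2_nrm D (\<lambda>x. pull s t k x - k x)"
      by (simp add: distrib_right)
    also have "\<dots> < (L2_factor + 1) * ?\<epsilon> + e / 2"
      using k(2) \<delta>(2)[OF st close] L2_factor_pos by (intro add_strict_mono mult_strict_left_mono) auto
    also have "(L2_factor + 1) * ?\<epsilon> = e / 2" by (rule L2_factor_half)
    finally show "L2_nrm D (\<lambda>x. pull s t g x - g x) < e" by simp
  qed
qed


text \<open>A consequence of Brouwer's fixed point theorem: a continuous map that displaces the points of a
  closed ball about \<open>z\<close> by at most its radius takes the value \<open>z\<close>. Points well inside \<open>D\<close> are thus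
  reached by the flow, although no solution backwards in time is at hand.\<close>

lemma inside_image:
  assumes st: "0 \<le> s" "s \<le> t" "t \<le> T" and z: "cball z \<epsilon> \<subseteq> D" and \<epsilon>: "0 < \<epsilon>" "2 * (M * (t - s)) \<le> \<epsilon>"
  shows "z \<in> \<Phi> s t ` E s t"
proof -
  interpret volume_distortion "E s t" "\<Phi> s t" "\<alpha> t - \<alpha> s" by (rule distortion[OF st])
  have sub: "cball z (\<epsilon> / 2) \<subseteq> E s t"
  proof
    fix w assume w: "w \<in> cball z (\<epsilon> / 2)"
    have "cball w (M * (t - s)) \<subseteq> cball z \<epsilon>"
      using w \<epsilon> by (auto simp: subset_iff) (smt (verit) dist_triangle field_sum_of_halves)
    then show "w \<in> E s t" using E_large[OF st] z by blast
  qed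
  have "\<exists>w\<in>cball z (\<epsilon> / 2). \<Phi> s t w = z"
  proof (rule brouwer_surjective_cball[where S = "{z}"])
    show "continuous_on (cball z (\<epsilon> / 2)) (\<Phi> s t)" using cont sub by (rule continuous_on_subset)
    fix x w assume "x \<in> {z}" "w \<in> cball z (\<epsilon> / 2)"
    moreover from this have "dist w (\<Phi> s t w) \<le> \<epsilon> / 2"
      using \<Phi>_displacement[OF st, of w] sub \<epsilon> by force
    ultimately show "x + (w - \<Phi> s t w) \<in> cball z (\<epsilon> / 2)"
      by (simp add: dist_norm norm_minus_commute)
  qed (use \<epsilon> in auto)
  then show ?thesis using sub by blast
qed

lemma integral_abs_le_L2_nrm:
  assumes g: "in_L2 D g"
  shows "integrable (lebesgue_on D) g" "(LINT x|lebesgue_on D. \<bar>g x\<bar>) \<le> L2_nrm D g * L2_nrm D (\<lambda>_. 1)"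
  using L2_mult_integrable[OF g one_in_L2] L2_Cauchy_Schwarz_abs[OF g one_in_L2] by simp_all

text \<open>The substitution \<open>z = \<Phi> s t x\<close> moves the flow from \<open>g\<close> to \<open>k\<close>: up to a volume factor near one, the
  integral of \<open>g (\<Phi> s t x) * k x\<close> is that of \<open>g z * k (\<Psi> z)\<close>, where \<open>\<Psi>\<close> is the inverse of
  \<open>\<Phi> s t\<close>. As \<open>\<Psi> z\<close> is close to \<open>z\<close> and the points with \<open>k z \<noteq> 0\<close> lie in the image, the factor
  \<open>k (\<Psi> z)\<close> differs little from \<open>k z\<close>. The function \<open>g\<close> enters through its norm only, so the bound is
  uniform.\<close>

lemma pull_inner_compactly_inside_close:
  assumes k: "compactly_inside D k" and e: "0 < e"
  obtains \<delta> where "0 < \<delta>" "\<And>s t g. 0 \<le> s \<Longrightarrow> s \<le> t \<Longrightarrow> t \<le> T \<Longrightarrow> t - s < \<delta> \<Longrightarrow> in_L2 D g \<Longrightarrow>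
    \<bar>L2_inner D (pull s t g) k - L2_inner D g k\<bar> \<le> e * L2_nrm D g"
proof -
  obtain c where c: "0 \<le> c" "\<And>x. \<bar>k x\<bar> \<le> c"
    using compactly_inside_bounded[OF bounded_D k] by metis
  have kL: "in_L2 D k" by (rule compactly_inside_in_L2[OF open_D bounded_D k])
  have km[measurable]: "k \<in> borel_measurable borel"
    using k by (auto simp: compactly_inside_def intro: borel_measurable_continuous_onI)
  let ?m = "L2_nrm D (\<lambda>_. 1) + 1"
  have m: "0 < ?m" by (simp add: add_nonneg_pos)
  define \<eta> where "\<eta> = e / (2 * ?m)"
  have \<eta>: "0 < \<eta>" using e m by (simp add: \<eta>_def)
  obtain \<epsilon> d where \<epsilon>: "0 < \<epsilon>" "\<And>x. \<not> cball x \<epsilon> \<subseteq> D \<Longrightarrow> k x = 0" and d: "0 < d"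
    "\<And>x z. x \<in> D \<Longrightarrow> z \<in> D \<Longrightarrow> dist x z < d \<Longrightarrow> \<bar>k z - k x\<bar> < \<eta>"
    using compactly_inside_uniform[OF k \<eta>] by metis
  obtain \<delta>1 where \<delta>1: "0 < \<delta>1" "\<And>s t. t - s < \<delta>1 \<Longrightarrow> M * (t - s) < min (\<epsilon> / 2) d"
    using small_displacement[of "min (\<epsilon> / 2) d"] \<epsilon>(1) d(1) by auto
  \<comment> \<open>a distortion exponent with \<open>(exp a - 1) * c \<le> \<eta>\<close>\<close>
  define a where "a = ln (1 + e / (2 * ?m * (c + 1)))"
  have q: "0 < e / (2 * ?m * (c + 1))" using e m c(1) by simp
  have a: "0 < a" unfolding a_def using q by (intro ln_gt_zero) simp
  have expa: "exp a - 1 = e / (2 * ?m * (c + 1))" using q by (simp add: a_def)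
  have "uniformly_continuous_on {0..T} \<alpha>" by (intro compact_uniformly_continuous \<alpha>_cont compact_Icc)
  then obtain \<delta>2 where \<delta>2: "0 < \<delta>2" "\<And>s t. s \<in> {0..T} \<Longrightarrow> t \<in> {0..T} \<Longrightarrow> dist t s < \<delta>2 \<Longrightarrow> dist (\<alpha> t) (\<alpha> s) < a"
    using a unfolding uniformly_continuous_on_def by blast
  show ?thesis
  proof (rule that[of "min \<delta>1 \<delta>2"])
    fix s t g assume st: "0 \<le> s" "s \<le> t" "t \<le> T" and close: "t - s < min \<delta>1 \<delta>2" and g: "in_L2 D g"
    interpret volume_distortion "E s t" "\<Phi> s t" "\<alpha> t - \<alpha> s" by (rule distortion[OF st])
    have small: "M * (t - s) < d" "2 * (M * (t - s)) \<le> \<epsilon>" using \<delta>1(2)[of t s] close by auto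
    have "\<alpha> t - \<alpha> s < a" using \<delta>2(2)[of s t] st close by (auto simp: dist_real_def)
    then have expA: "exp (\<alpha> t - \<alpha> s) - 1 \<le> e / (2 * ?m * (c + 1))"
      unfolding expa[symmetric] by simp
    have gm: "g \<in> borel_measurable (lebesgue_on D)" using g by (simp add: in_L2_def)
    obtain g0 where g0[measurable]: "g0 \<in> borel_measurable borel" and out: "\<And>x. x \<notin> D \<Longrightarrow> g0 x = 0"
      and eq: "AE x in lebesgue_on D. g x = g0 x"
      using ex_borel_version[OF borel_D gm] by blast
    have g0L: "in_L2 D g0" "L2_nrm D g0 = L2_nrm D g"
      using L2_AE_cong[OF lebesgue_D gm eq] g by auto
    have g0i: "integrable lborel g0"
      using integral_abs_le_L2_nrm(1)[OF g0L(1)] integrable_lebesgue_on_iff_lborel[OF borel_D g0 out] by simp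
    have g0b: "(LINT z|lborel. \<bar>g0 z\<bar>) \<le> L2_nrm D g * L2_nrm D (\<lambda>_. 1)"
      using integral_abs_le_L2_nrm(2)[OF g0L(1)]
        integral_lebesgue_on_eq_lborel[OF borel_D, of "\<lambda>z. \<bar>g0 z\<bar>"] out g0L(2) by simp
    obtain \<Psi> where \<Psi>: "homeomorphism (E s t) (\<Phi> s t ` E s t) (\<Phi> s t) \<Psi>"
      using invariance_of_domain_homeomorphism[OF open_E cont order_refl inj] .
    have \<Psi>E: "\<Psi> z \<in> E s t" "\<Phi> s t (\<Psi> z) = z" if "z \<in> \<Phi> s t ` E s t" for z
      using homeomorphism_image2[OF \<Psi>] homeomorphism_apply2[OF \<Psi> that] that by blast+
    define H where "H z = g0 z * (if z \<in> \<Phi> s t ` E s t then k (\<Psi> z) else 0)" for z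
    have Hm[measurable]: "H \<in> borel_measurable borel"
    proof -
      have "continuous_on (\<Phi> s t ` E s t) (\<lambda>z. k (\<Psi> z))"
        by (rule continuous_on_compose2[of UNIV k, OF _ homeomorphism_cont2[OF \<Psi>]])
          (use k in \<open>auto simp: compactly_inside_def\<close>)
      then have "(\<lambda>z. if z \<in> \<Phi> s t ` E s t then k (\<Psi> z) else 0) \<in> borel_measurable borel"
        by (intro borel_measurable_continuous_on_if) auto
      then show ?thesis unfolding H_def by measurable
    qed
    have Hle: "\<bar>H z\<bar> \<le> c * \<bar>g0 z\<bar>" for z
      unfolding H_def abs_mult mult.commute[of c] using c by (intro mult_left_mono) auto
    have Hi: "integrable lborel H"
    proof (rule Bochner_Integration.integrable_bound)
      show "integrable lborel (\<lambda>z. c * g0 z)" using g0i by simp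
      show "AE z in lborel. norm (H z) \<le> norm (c * g0 z)" using Hle c(1) by (simp add: abs_mult)
    qed simp
    have pb: "pull s t g0 \<in> borel_measurable borel" by (rule pull_borel[OF st g0])
    have pull: "pull s t g0 x * k x = H (\<Phi> s t x) * indicator (E s t) x" for x
    proof (cases "x \<in> E s t")
      case True
      then have "\<Psi> (\<Phi> s t x) = x" using homeomorphism_apply1[OF \<Psi>] by simp
      then show ?thesis using True by (simp add: pull_def H_def)
    qed (simp add: pull_def)
    have "L2_inner D (pull s t g) k = L2_inner D (pull s t g0) k"
      using in_L2_pull[OF st g] by (intro L2_AE_cong(3)[OF lebesgue_D _ pull_AE_cong[OF st eq] kL]) (simp add: in_L2_def)
    also have "\<dots> = (LINT x|lborel. pull s t g0 x * k x)"
      unfolding L2_inner_def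
    proof (rule integral_lebesgue_on_eq_lborel[OF borel_D])
      show "(\<lambda>x. pull s t g0 x * k x) \<in> borel_measurable borel" using pb km by measurable
    qed (use E_subset[OF st] in \<open>auto simp: pull_def\<close>)
    also have "\<dots> = (LINT x|lborel. H (\<Phi> s t x) * indicator (E s t) x)"
      unfolding pull ..
    finally have inner1: "L2_inner D (pull s t g) k = (LINT x|lborel. H (\<Phi> s t x) * indicator (E s t) x)" .
    have "L2_inner D g k = L2_inner D g0 k"
      by (rule L2_AE_cong(3)[OF lebesgue_D gm eq kL])
    also have "\<dots> = (LINT z|lborel. g0 z * k z)"
      unfolding L2_inner_def by (rule integral_lebesgue_on_eq_lborel[OF borel_D]) (use out in auto)
    finally have inner2: "L2_inner D g k = (LINT z|lborel. g0 z * k z)" .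
    have gki: "integrable lborel (\<lambda>z. g0 z * k z)"
    proof (rule Bochner_Integration.integrable_bound)
      show "integrable lborel (\<lambda>z. c * g0 z)" using g0i by simp
      have "\<bar>g0 z\<bar> * \<bar>k z\<bar> \<le> \<bar>g0 z\<bar> * c" for z
        using c by (intro mult_left_mono) auto
      then show "AE z in lborel. norm (g0 z * k z) \<le> norm (c * g0 z)"
        using c(1) by (simp add: abs_mult mult.commute)
    qed simp
    have near: "\<bar>H z - g0 z * k z\<bar> \<le> \<eta> * \<bar>g0 z\<bar>" for z
    proof (cases "z \<in> \<Phi> s t ` E s t")
      case True
      have "dist (\<Psi> z) z < d" using \<Phi>_displacement[OF st \<Psi>E(1)[OF True]] \<Psi>E(2)[OF True] small by simp
      moreover have "\<Psi> z \<in> D" "z \<in> D"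
        using \<Psi>E[OF True] E_subset[OF st] \<Phi>_in_D[OF st \<Psi>E(1)[OF True]] by auto
      ultimately have "\<bar>k (\<Psi> z) - k z\<bar> \<le> \<eta>" using d(2)[of z "\<Psi> z"] by (simp add: dist_commute less_imp_le)
      then have "\<bar>g0 z\<bar> * \<bar>k (\<Psi> z) - k z\<bar> \<le> \<bar>g0 z\<bar> * \<eta>" by (rule mult_left_mono) simp
      then show ?thesis using True by (simp add: H_def abs_mult[symmetric] right_diff_distrib mult.commute)
    next
      case False
      then have "k z = 0" using inside_image[OF st _ \<epsilon>(1) small(2)] \<epsilon>(2) by blast
      then show ?thesis using False \<eta> by (simp add: H_def)
    qed
    have "\<bar>L2_inner D (pull s t g) k - (LINT z|lborel. H z)\<bar> \<le> (exp (\<alpha> t - \<alpha> s) - 1) * (LINT z|lborel. \<bar>H z\<bar>)"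
    proof -
      have eq: "(\<lambda>z. H z * indicator (\<Phi> s t ` E s t) z) = H"
          "(\<lambda>z. \<bar>H z\<bar> * indicator (\<Phi> s t ` E s t) z) = (\<lambda>z. \<bar>H z\<bar>)"
        by (auto simp: fun_eq_iff H_def indicator_def)
      show ?thesis
        using integral_image_close(2)[OF Hm] Hi unfolding inner1 eq by simp
    qed
    also have "\<dots> \<le> (e / (2 * ?m * (c + 1))) * (c * (LINT z|lborel. \<bar>g0 z\<bar>))"
    proof (intro mult_mono expA)
      have "(LINT z|lborel. \<bar>H z\<bar>) \<le> (LINT z|lborel. c * \<bar>g0 z\<bar>)"
        using Hi g0i Hle by (intro integral_mono) auto
      then show "(LINT z|lborel. \<bar>H z\<bar>) \<le> c * (LINT z|lborel. \<bar>g0 z\<bar>)" by simp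
    qed (use q in auto)
    also have "\<dots> = \<eta> * (c / (c + 1)) * (LINT z|lborel. \<bar>g0 z\<bar>)"
      using m c(1) by (simp add: \<eta>_def)
    also have "\<dots> \<le> \<eta> * 1 * (LINT z|lborel. \<bar>g0 z\<bar>)"
      using \<eta> c(1) by (intro mult_right_mono mult_left_mono) (auto simp: divide_le_eq)
    finally have 1: "\<bar>L2_inner D (pull s t g) k - (LINT z|lborel. H z)\<bar> \<le> \<eta> * (LINT z|lborel. \<bar>g0 z\<bar>)" by simp
    have "\<bar>(LINT z|lborel. H z) - L2_inner D g k\<bar> = \<bar>LINT z|lborel. H z - g0 z * k z\<bar>"
      unfolding inner2 using Hi gki by simp
    also have "\<dots> \<le> (LINT z|lborel. \<bar>H z - g0 z * k z\<bar>)" by (rule integral_abs_bound)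
    also have "\<dots> \<le> (LINT z|lborel. \<eta> * \<bar>g0 z\<bar>)"
      using Hi gki g0i near by (intro integral_mono) auto
    finally have 2: "\<bar>(LINT z|lborel. H z) - L2_inner D g k\<bar> \<le> \<eta> * (LINT z|lborel. \<bar>g0 z\<bar>)" by simp
    have "\<bar>L2_inner D (pull s t g) k - L2_inner D g k\<bar> \<le> 2 * \<eta> * (LINT z|lborel. \<bar>g0 z\<bar>)"
      using 1 2 by linarith
    also have "\<dots> \<le> 2 * \<eta> * (L2_nrm D g * ?m)"
      using g0b \<eta> by (intro mult_left_mono order_trans[OF g0b]) (auto intro: mult_left_mono)
    also have "\<dots> = e * L2_nrm D g"
    proof -
      have "b * (e / (2 * b)) = e / 2" if "0 < b" for b :: real using that by simp
      from this[OF m] have "?m * \<eta> = e / 2" unfolding \<eta>_def .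
      then have "e = 2 * (?m * \<eta>)" by simp
      then show ?thesis by (simp only: mult_ac)
    qed
    finally show "\<bar>L2_inner D (pull s t g) k - L2_inner D g k\<bar> \<le> e * L2_nrm D g" .
  qed (use \<delta>1 \<delta>2 in auto)
qed

lemma pull_inner_close:
  assumes \<xi>: "in_L2 D \<xi>" and e: "0 < e"
  obtains \<delta> where "0 < \<delta>" "\<And>s t g. 0 \<le> s \<Longrightarrow> s \<le> t \<Longrightarrow> t \<le> T \<Longrightarrow> t - s < \<delta> \<Longrightarrow> in_L2 D g \<Longrightarrow>
    \<bar>L2_inner D (pull s t g) \<xi> - L2_inner D g \<xi>\<bar> \<le> e * L2_nrm D g"
proof -
  let ?\<epsilon> = "e / (2 * (L2_factor + 1))"
  have \<epsilon>: "0 < ?\<epsilon>" using e L2_factor_pos by simp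
  then obtain k where k: "compactly_inside D k" "L2_nrm D (\<lambda>x. \<xi> x - k x) < ?\<epsilon>"
    using compactly_inside_dense_in_L2[OF open_D bounded_D \<xi>] by blast
  have kL: "in_L2 D k" by (rule compactly_inside_in_L2[OF open_D bounded_D k(1)])
  obtain \<delta> where \<delta>: "0 < \<delta>" "\<And>s t g. 0 \<le> s \<Longrightarrow> s \<le> t \<Longrightarrow> t \<le> T \<Longrightarrow> t - s < \<delta> \<Longrightarrow> in_L2 D g \<Longrightarrow>
      \<bar>L2_inner D (pull s t g) k - L2_inner D g k\<bar> \<le> e / 2 * L2_nrm D g"
    using pull_inner_compactly_inside_close[OF k(1), of "e / 2"] e by auto
  show ?thesis
  proof (rule that[OF \<delta>(1)])
    fix s t g assume st: "0 \<le> s" "s \<le> t" "t \<le> T" and close: "t - s < \<delta>" and g: "in_L2 D g"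
    have p: "in_L2 D (pull s t g)" by (rule in_L2_pull[OF st g])
    have \<xi>k: "in_L2 D (\<lambda>x. \<xi> x - k x)" by (rule in_L2_diff[OF \<xi> kL])
    have split: "L2_inner D h \<xi> = L2_inner D h k + L2_inner D h (\<lambda>x. \<xi> x - k x)" if "in_L2 D h" for h
      using L2_inner_diff[OF \<xi> kL that] by (simp add: L2_inner_commute[of D h])
    have "\<bar>L2_inner D (pull s t g) (\<lambda>x. \<xi> x - k x)\<bar> \<le> L2_nrm D (pull s t g) * L2_nrm D (\<lambda>x. \<xi> x - k x)"
      by (rule L2_Cauchy_Schwarz[OF p \<xi>k])
    also have "\<dots> \<le> (L2_factor * L2_nrm D g) * ?\<epsilon>"
      using L2_nrm_pull_le[OF st g] mult_right_mono[OF exp_le_L2_factor[OF st], of "L2_nrm D g"] k(2) L2_factor_pos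
      by (intro mult_mono) auto
    finally have 1: "\<bar>L2_inner D (pull s t g) (\<lambda>x. \<xi> x - k x)\<bar> \<le> (L2_factor * L2_nrm D g) * ?\<epsilon>" .
    have "\<bar>L2_inner D g (\<lambda>x. \<xi> x - k x)\<bar> \<le> L2_nrm D g * L2_nrm D (\<lambda>x. \<xi> x - k x)"
      by (rule L2_Cauchy_Schwarz[OF g \<xi>k])
    also have "\<dots> \<le> L2_nrm D g * ?\<epsilon>"
      using k(2) by (intro mult_left_mono) auto
    finally have 2: "\<bar>L2_inner D g (\<lambda>x. \<xi> x - k x)\<bar> \<le> L2_nrm D g * ?\<epsilon>" .
    have 3: "(L2_factor * L2_nrm D g) * ?\<epsilon> + L2_nrm D g * ?\<epsilon> = e / 2 * L2_nrm D g"
    proof -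
      have "(L2_factor * L2_nrm D g) * ?\<epsilon> + L2_nrm D g * ?\<epsilon> = L2_nrm D g * ((L2_factor + 1) * ?\<epsilon>)" by algebra
      also have "(L2_factor + 1) * ?\<epsilon> = e / 2" by (rule L2_factor_half)
      finally show ?thesis by simp
    qed
    show "\<bar>L2_inner D (pull s t g) \<xi> - L2_inner D g \<xi>\<bar> \<le> e * L2_nrm D g"
      using 1 2 3 \<delta>(2)[OF st close g] unfolding split[OF p] split[OF g] by linarith
  qed
qed


text \<open>The recursion relates two times \<open>s \<le> r\<close>. For fixed \<open>r\<close> and increasing \<open>s\<close> the operator acts on one
  function \<open>g r\<close>, and \<open>pull_L2_close\<close> gives strong convergence. For fixed \<open>s\<close> and decreasing \<open>r\<close> it
  acts on changing functions of bounded norm; then the uniform estimate \<open>pull_inner_close\<close> applies,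
  which is about inner products only.\<close>

lemma
  fixes g :: "'a \<Rightarrow> real \<Rightarrow> real" and w :: "real \<Rightarrow> real \<Rightarrow> 'a \<Rightarrow> real" and \<beta> :: "real \<Rightarrow> real"
  assumes g: "\<And>s. s \<in> {0..T} \<Longrightarrow> in_L2 D (\<lambda>x. g x s)"
    and g_le: "\<And>s. s \<in> {0..T} \<Longrightarrow> L2_nrm D (\<lambda>x. g x s) \<le> C"
    and w: "\<And>s r. 0 \<le> s \<Longrightarrow> s \<le> r \<Longrightarrow> r \<le> T \<Longrightarrow> in_L2 D (w s r)"
    and w_le: "\<And>s r. 0 \<le> s \<Longrightarrow> s \<le> r \<Longrightarrow> r \<le> T \<Longrightarrow> L2_nrm D (w s r) \<le> \<beta> r - \<beta> s"
    and \<beta>: "continuous_on {0..T} \<beta>"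
    and rec: "\<And>s r. 0 \<le> s \<Longrightarrow> s \<le> r \<Longrightarrow> r \<le> T \<Longrightarrow>
      AE x in lebesgue_on D. g x s = pull s r (\<lambda>x. g x r) x + w s r x"
  shows weakly_continuous_of_recursion: "weakly_continuous_L2 D T g"
    and strongly_left_continuous_of_recursion: "strongly_left_continuous_L2 D T g"
proof -
  have pull: "in_L2 D (pull s r (\<lambda>x. g x r))" if "0 \<le> s" "s \<le> r" "r \<le> T" for s r
    using in_L2_pull[OF that g] that by simp
  have gm: "(\<lambda>x. g x s) \<in> borel_measurable (lebesgue_on D)" if "s \<in> {0..T}" for s
    using g[OF that] by (simp add: in_L2_def)
  have "uniformly_continuous_on {0..T} \<beta>" by (intro compact_uniformly_continuous \<beta> compact_Icc)
  then have \<beta>_unif: "\<exists>\<delta>>0. \<forall>s\<in>{0..T}. \<forall>r\<in>{0..T}. \<bar>r - s\<bar> < \<delta> \<longrightarrow> \<bar>\<beta> r - \<beta> s\<bar> < e" if "0 < e" for e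
    using that unfolding uniformly_continuous_on_def dist_real_def by blast
  show "weakly_continuous_L2 D T g"
    unfolding weakly_continuous_L2_def
  proof (intro conjI ballI allI impI g)
    fix \<xi> assume \<xi>: "in_L2 D \<xi>"
    have "uniformly_continuous_on {0..T} (\<lambda>s. L2_inner D (\<lambda>x. g x s) \<xi>)"
      unfolding uniformly_continuous_on_def
    proof (intro allI impI)
      fix e :: real assume e: "0 < e"
      \<comment> \<open>adding \<open>1\<close> makes both divisors positive\<close>
      define c where "c = max C 0 + 1"
      define n where "n = L2_nrm D \<xi> + 1"
      have c: "0 < c" and n: "0 < n" by (simp_all add: c_def n_def add_nonneg_pos)
      have "0 < e / (2 * c)" "0 < e / (2 * n)" using e c n by simp_all
      obtain \<delta>1 where \<delta>1: "0 < \<delta>1" "\<And>s t g. 0 \<le> s \<Longrightarrow> s \<le> t \<Longrightarrow> t \<le> T \<Longrightarrow> t - s < \<delta>1 \<Longrightarrow> in_L2 D g \<Longrightarrow>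
          \<bar>L2_inner D (pull s t g) \<xi> - L2_inner D g \<xi>\<bar> \<le> e / (2 * c) * L2_nrm D g"
        using pull_inner_close[OF \<xi> \<open>0 < e / (2 * c)\<close>] by metis
      obtain \<delta>2 where \<delta>2: "0 < \<delta>2" "\<And>s r. s \<in> {0..T} \<Longrightarrow> r \<in> {0..T} \<Longrightarrow> \<bar>r - s\<bar> < \<delta>2 \<Longrightarrow> \<bar>\<beta> r - \<beta> s\<bar> < e / (2 * n)"
        using \<beta>_unif[OF \<open>0 < e / (2 * n)\<close>] by metis
      have main: "\<bar>L2_inner D (\<lambda>x. g x s) \<xi> - L2_inner D (\<lambda>x. g x r) \<xi>\<bar> < e"
        if st: "0 \<le> s" "s \<le> r" "r \<le> T" and close: "r - s < min \<delta>1 \<delta>2" for s r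
      proof -
        have "L2_inner D (\<lambda>x. g x s) \<xi> = L2_inner D (\<lambda>x. pull s r (\<lambda>x. g x r) x + w s r x) \<xi>"
          using st by (intro L2_AE_cong(3)[OF lebesgue_D gm rec \<xi>]) auto
        also have "\<dots> = L2_inner D (pull s r (\<lambda>x. g x r)) \<xi> + L2_inner D (w s r) \<xi>"
          by (rule L2_inner_add[OF pull[OF st] w[OF st] \<xi>])
        finally have 1: "L2_inner D (\<lambda>x. g x s) \<xi> = L2_inner D (pull s r (\<lambda>x. g x r)) \<xi> + L2_inner D (w s r) \<xi>" .
        have "\<bar>L2_inner D (w s r) \<xi>\<bar> \<le> L2_nrm D (w s r) * L2_nrm D \<xi>"
          by (rule L2_Cauchy_Schwarz[OF w[OF st] \<xi>])
        also have "\<dots> \<le> (e / (2 * n)) * L2_nrm D \<xi>"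
          using w_le[OF st] \<delta>2(2)[of s r] st close by (intro mult_right_mono) auto
        also have "\<dots> < (e / (2 * n)) * n"
          using \<open>0 < e / (2 * n)\<close> by (intro mult_strict_left_mono) (simp_all add: n_def)
        also have "\<dots> = e / 2" using n by simp
        finally have 2: "\<bar>L2_inner D (w s r) \<xi>\<bar> < e / 2" .
        have "\<bar>L2_inner D (pull s r (\<lambda>x. g x r)) \<xi> - L2_inner D (\<lambda>x. g x r) \<xi>\<bar>
            \<le> e / (2 * c) * L2_nrm D (\<lambda>x. g x r)"
          using st close by (intro \<delta>1(2) g) auto
        also have "\<dots> \<le> e / (2 * c) * c"
          using g_le[of r] st \<open>0 < e / (2 * c)\<close> by (intro mult_left_mono) (auto simp: c_def)
        also have "\<dots> = e / 2" using c by simp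
        finally show ?thesis using 1 2 by linarith
      qed
      show "\<exists>d>0. \<forall>s\<in>{0..T}. \<forall>r\<in>{0..T}. dist r s < d \<longrightarrow>
          dist (L2_inner D (\<lambda>x. g x r) \<xi>) (L2_inner D (\<lambda>x. g x s) \<xi>) < e"
      proof (intro exI[of _ "min \<delta>1 \<delta>2"] conjI ballI impI)
        fix s r assume "s \<in> {0..T}" "r \<in> {0..T}" "dist r s < min \<delta>1 \<delta>2"
        then show "dist (L2_inner D (\<lambda>x. g x r) \<xi>) (L2_inner D (\<lambda>x. g x s) \<xi>) < e"
          using main[of s r] main[of r s] by (cases "s \<le> r") (auto simp: dist_real_def abs_minus_commute)
      qed (use \<delta>1 \<delta>2 in auto)
    qed
    then show "continuous_on {0..T} (\<lambda>s. L2_inner D (\<lambda>x. g x s) \<xi>)"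
      by (rule uniformly_continuous_imp_continuous)
  qed
  show "strongly_left_continuous_L2 D T g"
    unfolding strongly_left_continuous_L2_def
  proof (intro conjI ballI g)
    fix \<theta> assume \<theta>: "\<theta> \<in> {0<..T}"
    then have g\<theta>: "in_L2 D (\<lambda>x. g x \<theta>)" by (intro g) auto
    show "((\<lambda>s. L2_nrm D (\<lambda>x. g x s - g x \<theta>)) \<longlongrightarrow> 0) (at_left \<theta>)"
    proof (rule tendstoI)
      fix e :: real assume "0 < e"
      then have e2: "0 < e / 2" by simp
      obtain \<delta>1 where \<delta>1: "0 < \<delta>1" "\<And>s t. 0 \<le> s \<Longrightarrow> s \<le> t \<Longrightarrow> t \<le> T \<Longrightarrow> t - s < \<delta>1 \<Longrightarrow>
          L2_nrm D (\<lambda>x. pull s t (\<lambda>x. g x \<theta>) x - g x \<theta>) < e / 2"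
        using pull_L2_close[OF g\<theta> e2] by metis
      obtain \<delta>2 where \<delta>2: "0 < \<delta>2" "\<And>s r. s \<in> {0..T} \<Longrightarrow> r \<in> {0..T} \<Longrightarrow> \<bar>r - s\<bar> < \<delta>2 \<Longrightarrow> \<bar>\<beta> r - \<beta> s\<bar> < e / 2"
        using \<beta>_unif[OF e2] by metis
      have "\<forall>\<^sub>F s in at_left \<theta>. s \<in> {max 0 (\<theta> - min \<delta>1 \<delta>2)<..<\<theta>}"
        by (rule eventually_at_left_real) (use \<theta> \<delta>1 \<delta>2 in auto)
      then show "\<forall>\<^sub>F s in at_left \<theta>. dist (L2_nrm D (\<lambda>x. g x s - g x \<theta>)) 0 < e"
      proof eventually_elim
        case (elim s)
        then have st: "0 \<le> s" "s \<le> \<theta>" "\<theta> \<le> T" and close: "\<theta> - s < \<delta>1" "\<theta> - s < \<delta>2"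
          using \<theta> by auto
        have diff: "in_L2 D (\<lambda>x. pull s \<theta> (\<lambda>x. g x \<theta>) x - g x \<theta>)"
          by (rule in_L2_diff[OF pull[OF st] g\<theta>])
        have gs: "in_L2 D (\<lambda>x. g x s - g x \<theta>)"
          using st by (intro in_L2_diff g g\<theta>) auto
        have "L2_nrm D (\<lambda>x. g x s - g x \<theta>)
            = L2_nrm D (\<lambda>x. (pull s \<theta> (\<lambda>x. g x \<theta>) x - g x \<theta>) + w s \<theta> x)"
        proof (rule L2_AE_cong(2)[OF lebesgue_D])
          show "(\<lambda>x. g x s - g x \<theta>) \<in> borel_measurable (lebesgue_on D)"
            using gs by (simp add: in_L2_def)
          show "AE x in lebesgue_on D. g x s - g x \<theta> = (pull s \<theta> (\<lambda>x. g x \<theta>) x - g x \<theta>) + w s \<theta> x"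
            using rec[OF st] by eventually_elim simp
        qed
        also have "\<dots> \<le> L2_nrm D (\<lambda>x. pull s \<theta> (\<lambda>x. g x \<theta>) x - g x \<theta>) + L2_nrm D (w s \<theta>)"
          by (rule L2_nrm_triangle[OF diff w[OF st]])
        also have "\<dots> < e / 2 + e / 2"
        proof -
          have "\<bar>\<beta> \<theta> - \<beta> s\<bar> < e / 2" using st close(2) by (intro \<delta>2(2)) auto
          then show ?thesis using \<delta>1(2)[OF st close(1)] w_le[OF st] by linarith
        qed
        finally show ?case by simp
      qed
    qed
  qed
qed

lemma
  assumes \<zeta>: "in_L2 D \<zeta>"
  defines "u \<equiv> \<lambda>x s. pull s T \<zeta> x"
  shows terminal_pull_weakly_continuous: "weakly_continuous_L2 D T u"
    and terminal_pull_strongly_left_continuous: "strongly_left_continuous_L2 D T u"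
    and terminal_pull_L2_nrm_le: "s \<in> {0..T} \<Longrightarrow> L2_nrm D (\<lambda>x. u x s) \<le> L2_factor * L2_nrm D \<zeta>"
proof -
  have g: "in_L2 D (\<lambda>x. u x s)" if "s \<in> {0..T}" for s
    using in_L2_pull[of s T, OF _ _ _ \<zeta>] that by (simp add: u_def)
  show g_le: "L2_nrm D (\<lambda>x. u x s) \<le> L2_factor * L2_nrm D \<zeta>" if "s \<in> {0..T}" for s
    using order_trans[OF L2_nrm_pull_le[of s T, OF _ _ _ \<zeta>] mult_right_mono[OF exp_le_L2_factor[of s T]]] that
    by (simp add: u_def)
  have rec: "u x s = pull s r (\<lambda>x. u x r) x + 0" if "0 \<le> s" "s \<le> r" "r \<le> T" for s r x
    using E_flow[OF that order_refl] \<Phi>_flow[OF that order_refl] by (auto simp: u_def pull_def)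
  have zero: "in_L2 D (\<lambda>x. 0)" "L2_nrm D (\<lambda>x. 0) \<le> 0 - (0::real)"
    by (simp_all add: in_L2_def L2_nrm_def)
  show "weakly_continuous_L2 D T u"
    by (rule weakly_continuous_of_recursion[where w = "\<lambda>s r x. 0" and \<beta> = "\<lambda>s. 0", OF g g_le zero])
      (use rec in auto)
  show "strongly_left_continuous_L2 D T u"
    by (rule strongly_left_continuous_of_recursion[where w = "\<lambda>s r x. 0" and \<beta> = "\<lambda>s. 0", OF g g_le zero])
      (use rec in auto)
qed

end

section \<open>Integrals along the paths of a killed flow\<close>

locale jointly_continuous_killed_flow = killed_flow +
  assumes joint_borel: "s \<in> {0..T} \<Longrightarrow> {p. snd p \<in> {s..T} \<and> fst p \<in> E s (snd p)} \<in> sets borel"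
    and joint_cont: "s \<in> {0..T} \<Longrightarrow>
      continuous_on {p. snd p \<in> {s..T} \<and> fst p \<in> E s (snd p)} (\<lambda>p. \<Phi> s (snd p) (fst p))"
begin

lemma pull_joint_borel:
  fixes k :: "'a \<times> real \<Rightarrow> 'b::{t1_space, zero}"
  assumes s: "s \<in> {0..T}" and k: "k \<in> borel_measurable borel"
  shows "(\<lambda>p. if snd p \<in> {s..T} \<and> fst p \<in> E s (snd p) then k (\<Phi> s (snd p) (fst p), snd p) else 0)
    \<in> borel_measurable borel"
proof -
  let ?G = "{p. snd p \<in> {s..T} \<and> fst p \<in> E s (snd p)}"
  note [measurable] = joint_borel[OF s] k
  define q where "q p = (if p \<in> ?G then (\<Phi> s (snd p) (fst p), snd p) else 0)" for p
  have [measurable]: "q \<in> borel_measurable borel"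
    unfolding q_def using joint_cont[OF s]
    by (intro borel_measurable_continuous_on_if continuous_on_Pair joint_borel[OF s]) (auto intro: continuous_intros)
  have "(\<lambda>p. if p \<in> ?G then k (q p) else 0) \<in> borel_measurable borel"
    by measurable
  also have "(\<lambda>p. if p \<in> ?G then k (q p) else 0)
      = (\<lambda>p. if snd p \<in> {s..T} \<and> fst p \<in> E s (snd p) then k (\<Phi> s (snd p) (fst p), snd p) else 0)"
    by (auto simp: q_def fun_eq_iff)
  finally show ?thesis .
qed

text \<open>A null set of space-time has null sections at almost all times, and the flow pulls them back to
  null sets. By Tonelli's theorem almost every path meets the given null set during a null set of
  times.\<close>

lemma AE_along_paths:
  assumes s: "s \<in> {0..T}" and Q: "AE p in lebesgue. Q p"
  shows "AE x in lborel. AE t in lborel. t \<in> {s..T} \<and> x \<in> E s t \<longrightarrow> Q (\<Phi> s t x, t)"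
proof -
  have "AE p in lborel. Q p" using Q by (simp add: AE_completion_iff)
  then obtain N where N: "N \<in> null_sets lborel" "\<forall>p. p \<notin> N \<longrightarrow> Q p"
    by (auto elim!: AE_E3)
  then have [measurable]: "N \<in> sets borel" by auto
  define k where "k p = (if snd p \<in> {s..T} \<and> fst p \<in> E s (snd p)
    then indicator N (\<Phi> s (snd p) (fst p), snd p) else (0::ennreal))" for p
  have "k \<in> borel_measurable borel"
    unfolding k_def using s by (intro pull_joint_borel) auto
  then have km[measurable]: "k \<in> borel_measurable (lborel \<Otimes>\<^sub>M lborel)"
    by (simp add: lborel_prod)
  have "(\<integral>\<^sup>+x. k (x, t) \<partial>lborel) \<le> ennreal (exp (\<alpha> t - \<alpha> s)) * (\<integral>\<^sup>+z. indicator N (z, t) \<partial>lborel)"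
    for t
  proof (cases "t \<in> {s..T}")
    case t: True
    have st: "0 \<le> s" "s \<le> t" "t \<le> T" using s t by auto
    interpret volume_distortion "E s t" "\<Phi> s t" "\<alpha> t - \<alpha> s" by (rule distortion[OF st])
    have "(\<integral>\<^sup>+x. k (x, t) \<partial>lborel) = (\<integral>\<^sup>+x. indicator N (\<Phi> s t x, t) * indicator (E s t) x \<partial>lborel)"
      using t by (intro nn_integral_cong) (auto simp: k_def indicator_def)
    also have "\<dots> \<le> ennreal (exp (\<alpha> t - \<alpha> s)) * (\<integral>\<^sup>+z. indicator N (z, t) * indicator (\<Phi> s t ` E s t) z \<partial>lborel)"
      by (rule nn_integral_image_le) measurable
    also have "\<dots> \<le> ennreal (exp (\<alpha> t - \<alpha> s)) * (\<integral>\<^sup>+z. indicator N (z, t) \<partial>lborel)"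
      by (intro mult_left_mono nn_integral_mono) (auto simp: indicator_def)
    finally show ?thesis .
  next
    case False
    then have eq: "(\<lambda>x. k (x, t)) = (\<lambda>x. 0)" by (auto simp: k_def fun_eq_iff)
    show ?thesis unfolding eq by simp
  qed
  note le = this
  have "AE t in lborel. (\<integral>\<^sup>+z. indicator N (z, t) \<partial>lborel) = 0"
  proof -
    have "(\<integral>\<^sup>+t. \<integral>\<^sup>+z. indicator N (z, t) \<partial>lborel \<partial>lborel) = (\<integral>\<^sup>+p. indicator N p \<partial>(lborel \<Otimes>\<^sub>M lborel))"
      by (rule lborel_pair.nn_integral_snd) (simp add: lborel_prod)
    also have "\<dots> = 0" using null_setsD1[OF N(1)] by (simp add: lborel_prod)
    finally show ?thesis
      by (subst (asm) nn_integral_0_iff_AE) (simp_all add: lborel_prod)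
  qed
  then have "AE t in lborel. (\<integral>\<^sup>+x. k (x, t) \<partial>lborel) = 0"
  proof eventually_elim
    case (elim t)
    then show ?case using le[of t] by simp
  qed
  then have "(\<integral>\<^sup>+t. \<integral>\<^sup>+x. k (x, t) \<partial>lborel \<partial>lborel) = 0"
    by (subst nn_integral_0_iff_AE) auto
  then have "(\<integral>\<^sup>+x. \<integral>\<^sup>+t. k (x, t) \<partial>lborel \<partial>lborel) = 0"
    by (simp add: lborel_pair.Fubini'[of "\<lambda>x t. k (x, t)"])
  then have "AE x in lborel. (\<integral>\<^sup>+t. k (x, t) \<partial>lborel) = 0"
    by (subst (asm) nn_integral_0_iff_AE) auto
  then show ?thesis
  proof eventually_elim
    case (elim x)
    then have "AE t in lborel. k (x, t) = 0"
      by (subst (asm) nn_integral_0_iff_AE) auto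
    then show ?case
      by eventually_elim (use N(2) in \<open>auto simp: k_def indicator_def split: if_splits\<close>)
  qed
qed

end

text \<open>The function \<open>b\<close> dominates the \<open>L\<^sub>2(D)\<close>-norms of the sections of \<open>\<phi>\<close>, which need not be finite at
  exceptional times.\<close>

locale killed_flow_source = jointly_continuous_killed_flow +
  fixes \<phi> :: "'a \<times> real \<Rightarrow> real" and b :: "real \<Rightarrow> real"
  assumes \<phi>_borel [measurable]: "\<phi> \<in> borel_measurable borel"
    and b_nonneg: "\<And>t. 0 \<le> b t" and b_integrable: "integrable lborel b"
    and \<phi>_le_b: "AE t in lborel. t \<in> {0..T} \<longrightarrow>
      (\<integral>\<^sup>+z. ennreal ((\<phi> (z, t))\<^sup>2) * indicator D z \<partial>lborel) \<le> ennreal ((b t)\<^sup>2)"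
begin

definition along :: "real \<Rightarrow> 'a \<Rightarrow> real \<Rightarrow> real" where
  "along s x t = (if t \<in> {s..T} \<and> x \<in> E s t then \<phi> (\<Phi> s t x, t) else 0)"

lemma along_borel:
  assumes s: "s \<in> {0..T}"
  shows "(\<lambda>p. along s (fst p) (snd p)) \<in> borel_measurable (lborel \<Otimes>\<^sub>M lborel)"
  using pull_joint_borel[OF s \<phi>_borel] by (simp add: along_def lborel_prod)

lemma b_borel [measurable]: "b \<in> borel_measurable borel"
  using b_integrable by auto

text \<open>At a fixed time \<open>t\<close> the integrand is the image of a section of \<open>\<phi>\<close> under \<open>pull s t\<close> and has norm
  at most \<open>L2_factor * b t\<close>.\<close>

lemma Minkowski_along:
  assumes s: "s \<in> {0..T}" and I[measurable]: "I \<in> sets borel"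
  shows "(\<integral>\<^sup>+x. (\<integral>\<^sup>+t. ennreal \<bar>along s x t * indicator I t\<bar> \<partial>lborel)\<^sup>2 \<partial>lborel)
    \<le> ennreal ((L2_factor * (LINT t|lborel. b t * indicator (I \<inter> {s..T}) t))\<^sup>2)"
proof -
  note [measurable] = along_borel[OF s]
  let ?\<beta> = "\<lambda>t. ennreal (L2_factor * (b t * indicator (I \<inter> {s..T}) t))"
  let ?h = "\<lambda>p. ennreal \<bar>along s (fst p) (snd p) * indicator I (snd p)\<bar>"
  have "(\<integral>\<^sup>+x. (\<integral>\<^sup>+t. ?h (x, t) \<partial>lborel)\<^sup>2 \<partial>lborel) \<le> (\<integral>\<^sup>+t. ?\<beta> t \<partial>lborel)\<^sup>2"
  proof (rule nn_integral_Minkowski_square)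
    show "AE t in lborel. (\<integral>\<^sup>+x. (?h (x, t))\<^sup>2 \<partial>lborel) \<le> (?\<beta> t)\<^sup>2"
      using \<phi>_le_b
    proof eventually_elim
      case (elim t)
      show ?case
      proof (cases "t \<in> I \<inter> {s..T}")
        case True
        then have st: "0 \<le> s" "s \<le> t" "t \<le> T" using s by auto
        have [measurable]: "(\<lambda>z. \<phi> (z, t)) \<in> borel_measurable borel" by measurable
        have "(\<integral>\<^sup>+x. (?h (x, t))\<^sup>2 \<partial>lborel) = (\<integral>\<^sup>+x. ennreal ((pull s t (\<lambda>z. \<phi> (z, t)) x)\<^sup>2) \<partial>lborel)"
          using True by (intro nn_integral_cong) (auto simp: along_def pull_def ennreal_power)
        also have "\<dots> \<le> ennreal (exp (\<alpha> t - \<alpha> s)) * (\<integral>\<^sup>+z. ennreal ((\<phi> (z, t))\<^sup>2) * indicator D z \<partial>lborel)"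
          by (rule nn_integral_pull_le[OF st]) measurable
        also have "\<dots> \<le> ennreal (exp (\<alpha> t - \<alpha> s)) * ennreal ((b t)\<^sup>2)"
          using elim st by (intro mult_left_mono) auto
        also have "\<dots> = ennreal ((exp ((\<alpha> t - \<alpha> s) / 2) * b t)\<^sup>2)"
          by (simp add: ennreal_mult[symmetric] power_mult_distrib exp_double[symmetric])
        also have "\<dots> \<le> ennreal ((L2_factor * b t)\<^sup>2)"
          using exp_le_L2_factor[OF st] b_nonneg by (intro ennreal_leI power_mono mult_right_mono) auto
        also have "\<dots> = (?\<beta> t)\<^sup>2"
          using True L2_factor_pos b_nonneg by (simp add: ennreal_power)
        finally show ?thesis .
      next
        case False
        then have eq: "(\<lambda>x. (?h (x, t))\<^sup>2) = (\<lambda>x. 0)" by (auto simp: along_def fun_eq_iff)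
        show ?thesis unfolding eq by simp
      qed
    qed
  qed (auto intro: sigma_finite_lborel)
  also have "(\<integral>\<^sup>+t. ?\<beta> t \<partial>lborel) = ennreal (L2_factor * (LINT t|lborel. b t * indicator (I \<inter> {s..T}) t))"
  proof -
    have "integrable lborel (\<lambda>t. b t * indicator (I \<inter> {s..T}) t)"
      using integrable_real_mult_indicator[of "I \<inter> {s..T}" lborel b] b_integrable by simp
    then show ?thesis
      using L2_factor_pos b_nonneg by (subst nn_integral_eq_integral) auto
  qed
  also have "(ennreal (L2_factor * (LINT t|lborel. b t * indicator (I \<inter> {s..T}) t)))\<^sup>2
      = ennreal ((L2_factor * (LINT t|lborel. b t * indicator (I \<inter> {s..T}) t))\<^sup>2)"
    using L2_factor_pos b_nonneg by (intro ennreal_power mult_nonneg_nonneg Bochner_Integration.integral_nonneg) auto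
  finally show ?thesis by simp
qed

lemma
  assumes s: "s \<in> {0..T}" and I[measurable]: "I \<in> sets borel"
  shows AE_integrable_along: "AE x in lborel. integrable lborel (\<lambda>t. along s x t * indicator I t)"
    and integral_along_in_L2: "in_L2 D (\<lambda>x. LINT t|lborel. along s x t * indicator I t)"
    and integral_along_L2_nrm_le: "L2_nrm D (\<lambda>x. LINT t|lborel. along s x t * indicator I t)
      \<le> L2_factor * (LINT t|lborel. b t * indicator (I \<inter> {s..T}) t)"
proof -
  let ?h = "\<lambda>p. along s (fst p) (snd p) * indicator I (snd p)"
  note [measurable] = along_borel[OF s]
  let ?N = "\<lambda>x. \<integral>\<^sup>+t. ennreal \<bar>along s x t * indicator I t\<bar> \<partial>lborel"
  let ?c = "L2_factor * (LINT t|lborel. b t * indicator (I \<inter> {s..T}) t)"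
  have c: "0 \<le> ?c"
    using L2_factor_pos b_nonneg by (intro mult_nonneg_nonneg Bochner_Integration.integral_nonneg) auto
  have hm[measurable]: "?h \<in> borel_measurable (lborel \<Otimes>\<^sub>M lborel)" by measurable
  have Nm[measurable]: "?N \<in> borel_measurable lborel"
    using lborel.borel_measurable_nn_integral_fst[of "\<lambda>p. ennreal \<bar>?h p\<bar>" lborel] by simp
  have N: "(\<integral>\<^sup>+x. (?N x)\<^sup>2 \<partial>lborel) \<le> ennreal (?c\<^sup>2)" by (rule Minkowski_along[OF s I])
  have "AE x in lborel. (?N x)\<^sup>2 \<noteq> \<infinity>"
    using N by (intro nn_integral_PInf_AE) (auto simp: top_unique)
  then show int: "AE x in lborel. integrable lborel (\<lambda>t. along s x t * indicator I t)"
  proof eventually_elim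
    case (elim x)
    have "(\<lambda>t. ?h (x, t)) \<in> borel_measurable lborel" by measurable
    moreover have "?N x < \<infinity>" using elim by (auto simp: less_top[symmetric])
    ultimately show ?case by (intro integrableI_bounded) auto
  qed
  let ?F = "\<lambda>x. LINT t|lborel. along s x t * indicator I t"
  have Fm: "?F \<in> borel_measurable borel"
    using lborel.borel_measurable_lebesgue_integral[of "\<lambda>x t. ?h (x, t)" lborel] by simp
  then have Fl: "?F \<in> borel_measurable (lebesgue_on D)"
    by (intro measurable_restrict_space1 measurable_completion) simp
  have "(\<integral>\<^sup>+x. ennreal ((?F x)\<^sup>2) \<partial>lebesgue_on D) \<le> (\<integral>\<^sup>+x. ennreal ((?F x)\<^sup>2) \<partial>lborel)"
    unfolding nn_integral_lebesgue_on_eq_lborel[OF borel_D]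
    by (intro nn_integral_mono) (auto simp: indicator_def)
  also have "\<dots> \<le> (\<integral>\<^sup>+x. (?N x)\<^sup>2 \<partial>lborel)"
  proof (rule nn_integral_mono_AE)
    show "AE x in lborel. ennreal ((?F x)\<^sup>2) \<le> (?N x)\<^sup>2"
      using int
    proof eventually_elim
      case (elim x)
      have "ennreal \<bar>?F x\<bar> \<le> ?N x"
        using integral_norm_bound_ennreal[OF elim] by simp
      then have "(ennreal \<bar>?F x\<bar>)\<^sup>2 \<le> (?N x)\<^sup>2" by (rule power_mono) simp
      then show ?case by (simp add: ennreal_power)
    qed
  qed
  also have "\<dots> \<le> ennreal (?c\<^sup>2)" by (rule N)
  finally show "in_L2 D ?F" "L2_nrm D ?F \<le> ?c"
    using in_L2_bound[OF Fl c] by auto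
qed

definition path_integral :: "'a \<Rightarrow> real \<Rightarrow> real" where
  "path_integral x s = (LINT t|lborel. along s x t)"

text \<open>From time \<open>r\<close> on, a surviving point continues like a point started at its position at that time,
  and a removed point collects nothing.\<close>

lemma path_integral_recursion:
  assumes sr: "0 \<le> s" "s \<le> r" "r \<le> T"
  shows "AE x in lebesgue_on D. path_integral x s =
    pull s r (\<lambda>x. path_integral x r) x + (LINT t|lborel. along s x t * indicator {..<r} t)"
proof -
  have s: "s \<in> {0..T}" using sr by auto
  have later: "(LINT t|lborel. along s x t * indicator {r..} t) = pull s r (\<lambda>x. path_integral x r) x" for x
  proof (cases "x \<in> E s r")
    case True
    have "along s x t * indicator {r..} t = along r (\<Phi> s r x) t" for t
      using True sr E_flow[of s r t x] \<Phi>_flow[of s r t x] by (auto simp: along_def indicator_def)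
    then show ?thesis using True by (simp add: pull_def path_integral_def)
  next
    case False
    then have "along s x t * indicator {r..} t = 0" for t
      using sr E_flow[of s r t x] by (auto simp: along_def indicator_def)
    then have eq: "(\<lambda>t. along s x t * indicator {r..} t) = (\<lambda>t. 0)"
      by (rule ext)
    show ?thesis unfolding eq using False by (simp add: pull_def)
  qed
  have "AE x in lborel. integrable lborel (\<lambda>t. along s x t * indicator {..<r} t)"
    "AE x in lborel. integrable lborel (\<lambda>t. along s x t * indicator {r..} t)"
    by (rule AE_integrable_along[OF s]; simp)+
  then have "AE x in lborel. path_integral x s =
      pull s r (\<lambda>x. path_integral x r) x + (LINT t|lborel. along s x t * indicator {..<r} t)"
  proof eventually_elim
    case (elim x)
    have "along s x t = along s x t * indicator {..<r} t + along s x t * indicator {r..} t" for t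
      by (auto simp: indicator_def)
    then have "path_integral x s = (LINT t|lborel. along s x t * indicator {..<r} t + along s x t * indicator {r..} t)"
      unfolding path_integral_def by (rule Bochner_Integration.integral_cong[OF refl])
    then show ?case using elim by (simp add: later)
  qed
  then show ?thesis
    unfolding AE_lebesgue_on_iff[OF lebesgue_D] AE_completion_iff by eventually_elim simp
qed

text \<open>In the recursion the remainder between the times \<open>s\<close> and \<open>r\<close> has norm at most the increment of
  the continuous function \<open>L2_factor * integral {0..r} b\<close> of \<open>r\<close>.\<close>

lemma
  shows path_integral_weakly_continuous: "weakly_continuous_L2 D T path_integral"
    and path_integral_strongly_left_continuous: "strongly_left_continuous_L2 D T path_integral"
    and path_integral_L2_nrm_le: "s \<in> {0..T} \<Longrightarrow>
      L2_nrm D (\<lambda>x. path_integral x s) \<le> L2_factor * (LINT t|lborel. b t * indicator {0..T} t)"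
proof -
  have bi: "integrable lborel (\<lambda>t. b t * indicator S t)" if "S \<in> sets borel" for S
    using integrable_real_mult_indicator[of S lborel b] b_integrable that by simp
  define B where "B r = L2_factor * integral {0..r} b" for r
  have bHK: "b integrable_on S" if "S \<in> sets borel" for S
    using bi[OF that] set_borel_integral_eq_integral(1)[of S b]
    by (simp add: set_integrable_def mult.commute)
  have bHK_eq: "(LINT t|lborel. b t * indicator S t) = integral S b" if "S \<in> sets borel" for S
    using bi[OF that] set_borel_integral_eq_integral(2)[of S b]
    by (simp add: set_integrable_def set_lebesgue_integral_def mult.commute)
  have B_cont: "continuous_on {0..T} B"
    unfolding B_def by (intro continuous_intros indefinite_integral_continuous_1 bHK) simp
  have full: "path_integral x s = (LINT t|lborel. along s x t * indicator UNIV t)" for x s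
    by (simp add: path_integral_def)
  have g: "in_L2 D (\<lambda>x. path_integral x s)" if "s \<in> {0..T}" for s
    unfolding full using that by (intro integral_along_in_L2) auto
  show g_le: "L2_nrm D (\<lambda>x. path_integral x s) \<le> L2_factor * (LINT t|lborel. b t * indicator {0..T} t)"
    if s: "s \<in> {0..T}" for s
  proof -
    have "L2_nrm D (\<lambda>x. path_integral x s) \<le> L2_factor * (LINT t|lborel. b t * indicator (UNIV \<inter> {s..T}) t)"
      unfolding full using s by (intro integral_along_L2_nrm_le) auto
    also have "\<dots> \<le> L2_factor * (LINT t|lborel. b t * indicator {0..T} t)"
      using L2_factor_pos b_nonneg s by (intro mult_left_mono integral_mono bi) (auto simp: indicator_def)
    finally show ?thesis .
  qed
  let ?w = "\<lambda>s r x. LINT t|lborel. along s x t * indicator {..<r} t"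
  have w: "in_L2 D (?w s r)" if "0 \<le> s" "s \<le> r" "r \<le> T" for s r
    using that by (intro integral_along_in_L2) auto
  have w_le: "L2_nrm D (?w s r) \<le> B r - B s" if sr: "0 \<le> s" "s \<le> r" "r \<le> T" for s r
  proof -
    have "L2_nrm D (?w s r) \<le> L2_factor * (LINT t|lborel. b t * indicator ({..<r} \<inter> {s..T}) t)"
      using sr by (intro integral_along_L2_nrm_le) auto
    also have "\<dots> \<le> L2_factor * (LINT t|lborel. b t * indicator {s..r} t)"
      using L2_factor_pos b_nonneg sr by (intro mult_left_mono integral_mono bi) (auto simp: indicator_def)
    also have "(LINT t|lborel. b t * indicator {s..r} t) = integral {s..r} b" by (simp add: bHK_eq)
    also have "\<dots> = integral {0..r} b - integral {0..s} b"
      using Henstock_Kurzweil_Integration.integral_combine[of 0 s r b] sr bHK[of "{0..r}"] by simp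
    finally show ?thesis by (simp add: B_def right_diff_distrib)
  qed
  show "weakly_continuous_L2 D T path_integral"
    by (rule weakly_continuous_of_recursion[OF g g_le w w_le B_cont path_integral_recursion])
  show "strongly_left_continuous_L2 D T path_integral"
    by (rule strongly_left_continuous_of_recursion[OF g g_le w w_le B_cont path_integral_recursion])
qed

end

section \<open>The flow killed at the boundary of a bounded domain\<close>

locale flow_in_bounded_domain = bounded_flow D T f J y M L R
  for D :: "(real^'n) set" and T f J y M L R +
  assumes bounded_D: "bounded D" and D_nonempty: "D \<noteq> {}"
begin

definition staying :: "real \<Rightarrow> real \<Rightarrow> (real^'n) set" where
  "staying s t = {x \<in> D. \<forall>r\<in>{s..t}. y x s r \<in> D}"

definition sup_div :: "real \<Rightarrow> real" where
  "sup_div t = (SUP x\<in>D. \<bar>field_div x t\<bar>)"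

definition total_div :: "real \<Rightarrow> real" where
  "total_div t = integral {0..t} sup_div"

lemma field_div_cont: "continuous_on S (\<lambda>p. field_div (fst p) (snd p))"
  unfolding field_div_def
  by (intro continuous_on_sum continuous_on_subset[OF J_cont]) auto

lemma field_div_bounded:
  assumes t: "t \<in> {0..T}"
  shows "bdd_above ((\<lambda>x. \<bar>field_div x t\<bar>) ` D)"
proof -
  have "continuous_on (closure D) (\<lambda>x. \<bar>field_div x t\<bar>)"
    using continuous_on_compose2[OF field_div_cont[of UNIV], of "closure D" "\<lambda>x. (x, t)"]
    by (intro continuous_on_rabs) (simp add: continuous_on_Pair)
  then have "compact ((\<lambda>x. \<bar>field_div x t\<bar>) ` closure D)"
    using bounded_D by (intro compact_continuous_image) auto
  then show ?thesis
    by (meson bdd_above_mono bounded_imp_bdd_above closure_subset compact_imp_bounded image_mono)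
qed

lemma field_div_le: "x \<in> D \<Longrightarrow> t \<in> {0..T} \<Longrightarrow> \<bar>field_div x t\<bar> \<le> sup_div t"
  unfolding sup_div_def using field_div_bounded by (intro cSUP_upper)

lemma sup_div_nonneg: "t \<in> {0..T} \<Longrightarrow> 0 \<le> sup_div t"
  using D_nonempty field_div_le by (meson abs_ge_zero all_not_in_conv order_trans)

lemma sup_div_cont: "continuous_on {0..T} sup_div"
proof (rule uniformly_continuous_imp_continuous, unfold uniformly_continuous_on_def, intro allI impI)
  fix e :: real assume e: "0 < e"
  then have e2: "0 < e / 2" by simp
  have "uniformly_continuous_on (closure D \<times> {0..T}) (\<lambda>p. field_div (fst p) (snd p))"
    using bounded_D by (intro compact_uniformly_continuous field_div_cont compact_Times) auto
  then obtain \<delta> where \<delta>: "0 < \<delta>" "\<And>p q. p \<in> closure D \<times> {0..T} \<Longrightarrow> q \<in> closure D \<times> {0..T} \<Longrightarrow>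
      dist q p < \<delta> \<Longrightarrow> dist (field_div (fst q) (snd q)) (field_div (fst p) (snd p)) < e / 2"
    using e2 unfolding uniformly_continuous_on_def by blast
  have le: "sup_div t \<le> sup_div t' + e / 2" if t: "t \<in> {0..T}" "t' \<in> {0..T}" "dist t t' < \<delta>" for t t'
    unfolding sup_div_def[of t]
  proof (rule cSUP_least[OF D_nonempty])
    fix x assume x: "x \<in> D"
    then have "dist (field_div x t) (field_div x t') < e / 2"
      using \<delta>(2)[of "(x, t')" "(x, t)"] t closure_subset[of D] by (auto simp: dist_Pair_Pair)
    then show "\<bar>field_div x t\<bar> \<le> sup_div t' + e / 2"
      using field_div_le[OF x t(2)] unfolding dist_real_def by linarith
  qed
  show "\<exists>d>0. \<forall>s\<in>{0..T}. \<forall>t\<in>{0..T}. dist t s < d \<longrightarrow> dist (sup_div t) (sup_div s) < e"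
  proof (intro exI[of _ \<delta>] conjI ballI impI \<delta>(1))
    fix s t assume "s \<in> {0..T}" "t \<in> {0..T}" "dist t s < \<delta>"
    then show "dist (sup_div t) (sup_div s) < e"
      using le[of s t] le[of t s] e by (simp add: dist_commute dist_real_def)
  qed
qed

lemma sup_div_integrable: "S \<subseteq> {0..T} \<Longrightarrow> S = {a..b} \<Longrightarrow> sup_div integrable_on S"
  using integrable_continuous_interval[OF continuous_on_subset[OF sup_div_cont]] by blast

lemma total_div_diff:
  assumes "0 \<le> s" "s \<le> t" "t \<le> T"
  shows "total_div t - total_div s = integral {s..t} sup_div"
  using Henstock_Kurzweil_Integration.integral_combine[of 0 s t sup_div] assms
    sup_div_integrable[of "{0..t}" 0 t] by (simp add: total_div_def)

text \<open>The path of \<open>x\<close> up to time \<open>t\<close> is compact, so \<open>D\<close> contains a tube of some radius \<open>\<rho>\<close> about it.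
  Neighbouring paths stay in the tube until \<open>t\<close>, and afterwards for as long as the bound of the
  speed ensures. The two inequalities cover times \<open>t'\<close> on either side of \<open>t\<close>.\<close>

lemma staying_neighbourhood:
  assumes x: "x \<in> staying s t" and st: "0 \<le> s" "s \<le> t" "t \<le> T"
  obtains \<rho> where "0 < \<rho>"
    "\<And>z t'. z \<in> D \<Longrightarrow> t' \<in> {s..T} \<Longrightarrow> growth * norm (z - x) < \<rho> \<Longrightarrow> growth * norm (z - x) + M * (t' - t) < \<rho> \<Longrightarrow>
      z \<in> staying s t'"
proof -
  have xD: "x \<in> D" using x by (simp add: staying_def)
  have sT: "s \<in> {0..T}" using st by auto
  have "compact (y x s ` {s..t})"
    by (intro compact_continuous_image y_continuous[OF xD sT] compact_Icc) auto
  moreover have "y x s ` {s..t} \<subseteq> D" using x by (auto simp: staying_def)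
  ultimately obtain \<rho> where \<rho>: "0 < \<rho>" "(\<Union>w\<in>y x s ` {s..t}. ball w \<rho>) \<subseteq> D"
    using compact_subset_open_imp_ball_epsilon_subset[OF _ open_D] by metis
  show ?thesis
  proof (rule that[OF \<rho>(1)])
    fix z t' assume z: "z \<in> D" and t': "t' \<in> {s..T}" and less: "growth * norm (z - x) < \<rho>"
        "growth * norm (z - x) + M * (t' - t) < \<rho>"
    show "z \<in> staying s t'"
      unfolding staying_def
    proof (intro CollectI conjI ballI z)
      fix r assume r: "r \<in> {s..t'}"
      \<comment> \<open>the tube follows the path of \<open>x\<close> only until time \<open>t\<close>\<close>
      let ?q = "min r t"
      have "norm (y z s r - y x s r) \<le> growth * norm (z - x)"
        using r t' by (intro y_close z xD sT) auto
      moreover have "norm (y x s r - y x s ?q) \<le> M * (r - ?q)"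
        using r st by (intro y_speed xD sT) auto
      moreover have "growth * norm (z - x) + M * (r - ?q) < \<rho>"
      proof (cases "r \<le> t")
        case False
        then have "M * (r - ?q) \<le> M * (t' - t)" using r M_nonneg by (intro mult_left_mono) auto
        then show ?thesis using less by linarith
      qed (use less in simp)
      ultimately have "norm (y z s r - y x s ?q) < \<rho>"
        using norm_triangle_ineq[of "y z s r - y x s r" "y x s r - y x s ?q"] by simp
      then have "y z s r \<in> ball (y x s ?q) \<rho>" by (simp add: dist_norm norm_minus_commute)
      moreover have "?q \<in> {s..t}" using r st by auto
      ultimately show "y z s r \<in> D" using \<rho>(2) by blast
    qed
  qed
qed

lemma open_staying:
  assumes st: "0 \<le> s" "s \<le> t" "t \<le> T"
  shows "open (staying s t)"
  unfolding open_dist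
proof
  fix x assume x: "x \<in> staying s t"
  then have xD: "x \<in> D" by (simp add: staying_def)
  obtain \<rho> where \<rho>: "0 < \<rho>" "\<And>z t'. z \<in> D \<Longrightarrow> t' \<in> {s..T} \<Longrightarrow> growth * norm (z - x) < \<rho> \<Longrightarrow>
      growth * norm (z - x) + M * (t' - t) < \<rho> \<Longrightarrow> z \<in> staying s t'"
    using staying_neighbourhood[OF x st] by metis
  obtain \<epsilon> where \<epsilon>: "0 < \<epsilon>" "ball x \<epsilon> \<subseteq> D" using open_D xD by (meson openE)
  show "\<exists>e>0. \<forall>z. dist z x < e \<longrightarrow> z \<in> staying s t"
  proof (intro exI[of _ "min \<epsilon> (\<rho> / growth)"] conjI allI impI)
    show "0 < min \<epsilon> (\<rho> / growth)" using \<epsilon> \<rho> growth_pos by simp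
    fix z assume "dist z x < min \<epsilon> (\<rho> / growth)"
    then have "z \<in> D" "growth * norm (z - x) < \<rho>"
      using \<epsilon>(2) growth_pos by (auto simp: dist_norm norm_minus_commute subset_iff field_simps)
    then show "z \<in> staying s t" using \<rho>(2)[of z t] st by simp
  qed
qed

lemma staying_flow:
  assumes "0 \<le> s" "s \<le> r" "r \<le> t" "t \<le> T"
  shows "x \<in> staying s t \<longleftrightarrow> x \<in> staying s r \<and> y x s r \<in> staying r t"
proof -
  have "x \<in> staying s t \<longleftrightarrow> x \<in> D \<and> (\<forall>\<rho>\<in>{s..r}. y x s \<rho> \<in> D) \<and> (\<forall>\<rho>\<in>{r..t}. y x s \<rho> \<in> D)"
  proof -
    have "{s..t} = {s..r} \<union> {r..t}" using assms by auto
    then show ?thesis by (simp add: staying_def ball_Un)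
  qed
  also have "\<dots> \<longleftrightarrow> x \<in> staying s r \<and> y x s r \<in> staying r t"
    using assms y_flow[of x s r] by (auto simp: staying_def)
  finally show ?thesis .
qed

lemma det_bounds:
  assumes st: "0 \<le> s" "s \<le> t" "t \<le> T" and x: "x \<in> staying s t"
  shows "\<bar>integral {s..t} (\<lambda>r. field_div (y x s r) r)\<bar> \<le> total_div t - total_div s"
proof -
  have xD: "x \<in> D" and sT: "s \<in> {0..T}" using x st by (auto simp: staying_def)
  have "norm (integral {s..t} (\<lambda>r. field_div (y x s r) r)) \<le> integral {s..t} sup_div"
  proof (rule integral_norm_bound_integral)
    show "(\<lambda>r. field_div (y x s r) r) integrable_on {s..t}"
      using st by (intro integrable_continuous_interval field_div_along_y_continuous xD sT) auto
    show "sup_div integrable_on {s..t}" using st by (intro sup_div_integrable[of _ s t]) auto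
    show "norm (field_div (y x s r) r) \<le> sup_div r" if "r \<in> {s..t}" for r
      using x that st by (auto simp: staying_def intro!: field_div_le)
  qed
  then show ?thesis using total_div_diff[OF st] by simp
qed

text \<open>The path of a point of \<open>staying s t\<close> runs in \<open>D\<close>, where \<open>\<bar>field_div\<bar>\<close> is at most \<open>sup_div\<close>. By
  Liouville's formula this bounds the Jacobian determinant from both sides.\<close>

lemma staying_volume_distortion:
  assumes st: "0 \<le> s" "s \<le> t" "t \<le> T"
  shows "volume_distortion (staying s t) (\<lambda>x. y x s t) (total_div t - total_div s)"
proof
  have sT: "s \<in> {0..T}" and tT: "t \<in> {s..T}" using st by auto
  have sub: "staying s t \<subseteq> D" "(\<lambda>x. y x s t) ` staying s t \<subseteq> D"
    using st by (auto simp: staying_def)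
  show "open (staying s t)" by (rule open_staying[OF st])
  show "bounded (staying s t)" "bounded ((\<lambda>x. y x s t) ` staying s t)"
    using sub bounded_D by (auto intro: bounded_subset)
  have cont: "continuous_on D (\<lambda>x. y x s t)"
  proof (rule continuous_on_subset[OF lipschitz_on_continuous_on])
    show "growth-lipschitz_on D (\<lambda>x. y x s t)"
      using y_close[OF _ _ sT tT] growth_pos by (auto intro!: lipschitz_onI simp: dist_norm)
  qed simp
  then show cont': "continuous_on (staying s t) (\<lambda>x. y x s t)"
    using sub(1) by (rule continuous_on_subset)
  show inj: "inj_on (\<lambda>x. y x s t) (staying s t)"
    using y_inj[OF _ _ sT tT] sub(1) by (auto simp: inj_on_def)
  have "0 \<le> integral {s..t} sup_div"
    using st by (intro Henstock_Kurzweil_Integration.integral_nonneg sup_div_integrable[of _ s t]) (auto intro: sup_div_nonneg)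
  then show A: "0 \<le> total_div t - total_div s" using total_div_diff[OF st] by simp
  fix B assume B: "B \<in> sets borel" "B \<subseteq> staying s t"
  obtain e :: "'n idx \<Rightarrow> 'n" where e: "bij e" using ex_bij_idx by blast
  let ?P = "\<lambda>x L'. ((\<lambda>z. y z s t) has_derivative L') (at x within D) \<and>
      det (matrix (reindex e \<circ> L' \<circ> reindex (inv e))) = exp (integral {s..t} (\<lambda>r. field_div (y x s r) r))"
  have "\<forall>x\<in>D. \<exists>L'. ?P x L'"
  proof
    fix x assume "x \<in> D"
    then show "\<exists>L'. ?P x L'" by (rule y_derivative_and_det[OF e _ sT tT]) blast
  qed
  from bchoice[OF this] obtain L' where "\<forall>x\<in>D. ?P x (L' x)" ..
  then have L': "?P x (L' x)" if "x \<in> D" for x using that by blast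
  let ?A = "total_div t - total_div s"
  have BD: "B \<subseteq> D" using B sub by blast
  have bounds: "exp (- ?A) \<le> \<bar>det (matrix (reindex e \<circ> L' x \<circ> reindex (inv e)))\<bar>"
    "\<bar>det (matrix (reindex e \<circ> L' x \<circ> reindex (inv e)))\<bar> \<le> exp ?A" if "x \<in> B" for x
  proof -
    have x: "x \<in> D" "x \<in> staying s t" using that BD B(2) by auto
    have det: "det (matrix (reindex e \<circ> L' x \<circ> reindex (inv e))) = exp (integral {s..t} (\<lambda>r. field_div (y x s r) r))"
      using L'[OF x(1)] by simp
    have "- ?A \<le> integral {s..t} (\<lambda>r. field_div (y x s r) r)" "integral {s..t} (\<lambda>r. field_div (y x s r) r) \<le> ?A"
      using det_bounds[OF st x(2)] by (simp_all add: abs_le_iff)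
    then show "exp (- ?A) \<le> \<bar>det (matrix (reindex e \<circ> L' x \<circ> reindex (inv e)))\<bar>"
      "\<bar>det (matrix (reindex e \<circ> L' x \<circ> reindex (inv e)))\<bar> \<le> exp ?A"
      unfolding det by simp_all
  qed
  have "(\<lambda>x. y x s t) ` B \<in> sets borel"
    by (rule borel_image_open_injective[OF open_staying[OF st] cont' inj B])
  moreover have "bounded B" "bounded ((\<lambda>x. y x s t) ` B)"
    using B(2) sub bounded_D by (blast intro: bounded_subset)+
  moreover have "((\<lambda>z. y z s t) has_derivative L' x) (at x within B)" if "x \<in> B" for x
    using L'[of x] that BD has_derivative_subset by blast
  moreover have "inj_on (\<lambda>x. y x s t) B" using inj B(2) by (rule inj_on_subset)
  ultimately show "exp (- ?A) * measure lborel B \<le> measure lborel ((\<lambda>x. y x s t) ` B) \<and>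
      measure lborel ((\<lambda>x. y x s t) ` B) \<le> exp ?A * measure lborel B"
    using measure_image_two_sided[OF e B(1), of "\<lambda>x. y x s t" L' "exp (- ?A)" "exp ?A"] bounds by simp
qed

lemma jointly_continuous_killed_flow_staying:
  "jointly_continuous_killed_flow D T staying (\<lambda>s t x. y x s t) total_div M"
proof (intro jointly_continuous_killed_flow.intro killed_flow.intro jointly_continuous_killed_flow_axioms.intro)
  fix s r t x
  assume st: "0 \<le> s" "s \<le> t" "t \<le> T"
  then have sT: "s \<in> {0..T}" by auto
  show "staying s t \<subseteq> D" by (auto simp: staying_def)
  show "x \<in> staying s t \<Longrightarrow> y x s t \<in> D" using st by (auto simp: staying_def)
  show "dist x (y x s t) \<le> M * (t - s)" if "x \<in> staying s t"
    using y_speed[of x s s t] y_start[of x s] that st sT by (simp add: staying_def dist_norm norm_minus_commute)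
  show "x \<in> staying s t" if sub: "cball x (M * (t - s)) \<subseteq> D"
  proof -
    have "0 \<le> M * (t - s)" using M_nonneg st by simp
    then have xD: "x \<in> D" using sub by auto
    have "y x s r \<in> D" if r: "r \<in> {s..t}" for r
    proof -
      have "norm (y x s r - y x s s) \<le> M * (r - s)" using r by (intro y_speed xD sT) auto
      also have "\<dots> \<le> M * (t - s)" using r M_nonneg by (intro mult_left_mono) auto
      finally show ?thesis using sub y_start[OF xD sT] by (auto simp: dist_norm norm_minus_commute)
    qed
    then show ?thesis using xD by (simp add: staying_def)
  qed
  show "volume_distortion (staying s t) (\<lambda>x. y x s t) (total_div t - total_div s)"
    by (rule staying_volume_distortion[OF st])
next
  fix s r t x assume st: "0 \<le> s" "s \<le> r" "r \<le> t" "t \<le> T"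
  show "x \<in> staying s t \<longleftrightarrow> x \<in> staying s r \<and> y x s r \<in> staying r t" by (rule staying_flow[OF st])
  show "y x s t = y (y x s r) r t" if "x \<in> staying s t"
    using y_flow[of x s r t] that st by (auto simp: staying_def)
next
  show "continuous_on {0..T} total_div"
    unfolding total_div_def
    by (intro indefinite_integral_continuous_1 sup_div_integrable[of _ 0 T]) auto
next
  fix s assume s: "s \<in> {0..T}"
  let ?G = "{p. snd p \<in> {s..T} \<and> fst p \<in> staying s (snd p)}"
  have cover: "\<exists>U. open U \<and> p \<in> U \<and> U \<inter> (D \<times> {s..T}) \<subseteq> ?G" if p: "p \<in> ?G" for p
  proof -
    obtain x t where xt: "p = (x, t)" "x \<in> staying s t" "t \<in> {s..T}" using p by (cases p) auto
    obtain \<rho> where \<rho>: "0 < \<rho>" "\<And>z t'. z \<in> D \<Longrightarrow> t' \<in> {s..T} \<Longrightarrow> growth * norm (z - x) < \<rho> \<Longrightarrow>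
        growth * norm (z - x) + M * (t' - t) < \<rho> \<Longrightarrow> z \<in> staying s t'"
      using staying_neighbourhood[OF xt(2)] xt(3) s by (metis atLeastAtMost_iff)
    let ?U = "{q. growth * norm (fst q - x) < \<rho>} \<inter> {q. growth * norm (fst q - x) + M * (snd q - t) < \<rho>}"
    have "open ?U" by (intro open_Int open_Collect_less continuous_intros)
    moreover have "p \<in> ?U" using \<rho>(1) xt(1) by simp
    moreover have "?U \<inter> (D \<times> {s..T}) \<subseteq> ?G" using \<rho>(2) by auto
    ultimately show ?thesis by blast
  qed
  let ?O = "\<Union>{U. open U \<and> U \<inter> (D \<times> {s..T}) \<subseteq> ?G}"
  have "open ?O" by (intro open_Union) auto
  then have "?O \<inter> (D \<times> {s..T}) \<in> sets borel"
    using open_D by (intro sets.Int borel_Times) auto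
  moreover have "?G = ?O \<inter> (D \<times> {s..T})"
  proof (intro equalityI subsetI)
    fix p assume p: "p \<in> ?G"
    have "p \<in> D \<times> {s..T}" using p by (cases p) (auto simp: staying_def)
    moreover have "p \<in> ?O" using cover[OF p] by blast
    ultimately show "p \<in> ?O \<inter> (D \<times> {s..T})" by blast
  qed blast
  ultimately show "?G \<in> sets borel" by simp
  show "continuous_on ?G (\<lambda>p. y (fst p) s (snd p))"
    unfolding continuous_on_iff
  proof (intro ballI allI impI)
    fix p e assume p: "p \<in> ?G" and e: "(0::real) < e"
    let ?d = "e / (growth + M)"
    have gM: "0 < growth + M" using growth_pos M_nonneg by simp
    show "\<exists>d>0. \<forall>q\<in>?G. dist q p < d \<longrightarrow> dist (y (fst q) s (snd q)) (y (fst p) s (snd p)) < e"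
    proof (intro exI[of _ ?d] conjI ballI impI)
      show "0 < ?d" using e gM by simp
      fix q assume q: "q \<in> ?G" and close: "dist q p < ?d"
      have D: "fst p \<in> D" "fst q \<in> D" using p q by (auto simp: staying_def)
      have 1: "norm (y (fst q) s (snd q) - y (fst p) s (snd q)) \<le> growth * norm (fst q - fst p)"
        using q by (intro y_close D s) auto
      have 2: "norm (y (fst p) s (snd q) - y (fst p) s (snd p)) \<le> M * \<bar>snd q - snd p\<bar>"
      proof (cases "snd p \<le> snd q")
        case True
        then show ?thesis using y_speed[OF D(1) s, of "snd p" "snd q"] p by simp
      next
        case False
        then show ?thesis using y_speed[OF D(1) s, of "snd q" "snd p"] q by (simp add: norm_minus_commute)
      qed
      have "norm (fst q - fst p) \<le> dist q p" "\<bar>snd q - snd p\<bar> \<le> dist q p"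
        using dist_fst_le[of q p] dist_snd_le[of q p] by (auto simp: dist_norm)
      then have "growth * norm (fst q - fst p) + M * \<bar>snd q - snd p\<bar> \<le> (growth + M) * dist q p"
        unfolding distrib_right using growth_pos M_nonneg by (intro add_mono mult_left_mono) auto
      also have "\<dots> < (growth + M) * ?d"
        using close gM by (intro mult_strict_left_mono)
      also have "\<dots> = e" using gM by simp
      finally show "dist (y (fst q) s (snd q)) (y (fst p) s (snd p)) < e"
        using 1 2 norm_triangle_ineq[of "y (fst q) s (snd q) - y (fst p) s (snd q)" "y (fst p) s (snd q) - y (fst p) s (snd p)"]
        by (simp add: dist_norm)
    qed
  qed
qed (use open_D bounded_D T_nonneg M_nonneg in auto)

end

section \<open>Exit times, Borel representatives and the continuity theorem\<close>

text \<open>If the path is in the open set \<open>D\<close> at time \<open>t\<close>, it remains there for a positive time. This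
  makes the inequality strict.\<close>

lemma exit_time_gt_iff:
  fixes \<eta> :: "real \<Rightarrow> 'a::metric_space"
  assumes D: "open D" and \<eta>: "continuous_on {s..} \<eta>" and st: "s \<le> t"
  shows "exit_time D s \<eta> > ereal t \<longleftrightarrow> (\<forall>r\<in>{s..t}. \<eta> r \<in> D)"
proof
  assume gt: "exit_time D s \<eta> > ereal t"
  show "\<forall>r\<in>{s..t}. \<eta> r \<in> D"
  proof (rule ballI, rule ccontr)
    fix r assume r: "r \<in> {s..t}" "\<eta> r \<notin> D"
    then have "exit_time D s \<eta> \<le> ereal r"
      unfolding exit_time_def by (intro INF_lower) auto
    also have "\<dots> \<le> ereal t" using r by simp
    finally show False using gt by simp
  qed
next
  assume stay: "\<forall>r\<in>{s..t}. \<eta> r \<in> D"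
  obtain \<epsilon> where \<epsilon>: "0 < \<epsilon>" "ball (\<eta> t) \<epsilon> \<subseteq> D"
    using D stay st by (metis atLeastAtMost_iff openE order_refl)
  obtain d where d: "0 < d" "\<And>r. r \<in> {s..} \<Longrightarrow> dist r t < d \<Longrightarrow> dist (\<eta> r) (\<eta> t) < \<epsilon>"
    using \<eta> \<epsilon>(1) st unfolding continuous_on_iff by (metis atLeast_iff)
  have "ereal (t + d) \<le> exit_time D s \<eta>"
    unfolding exit_time_def
  proof (rule INF_greatest)
    fix r assume r: "r \<in> {t. t \<ge> s \<and> \<eta> t \<notin> D}"
    show "ereal (t + d) \<le> ereal r"
    proof (rule ccontr)
      assume "\<not> ereal (t + d) \<le> ereal r"
      then have "r < t + d" by simp
      moreover have "r > t" using r stay by force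
      ultimately have "dist (\<eta> r) (\<eta> t) < \<epsilon>"
        using r by (intro d(2)) (auto simp: dist_real_def)
      then show False using \<epsilon>(2) r by (auto simp: dist_commute)
    qed
  qed
  moreover have "ereal t < ereal (t + d)" using d(1) by simp
  ultimately show "exit_time D s \<eta> > ereal t"
    by (rule less_le_trans[rotated])
qed

text \<open>The time \<open>\<tau>\<close> itself is excepted: there the path is in \<open>D\<close> if it does not leave \<open>D\<close> before or at
  time \<open>T\<close>, and outside \<open>D\<close> otherwise.\<close>

lemma truncated_exit_time:
  fixes \<eta> :: "real \<Rightarrow> 'a::metric_space"
  assumes D: "open D" and \<eta>: "continuous_on {s..} \<eta>" and sT: "s \<le> T"
  defines "\<tau> \<equiv> truncated_exit_time D T s \<eta>"
  shows "s \<le> \<tau>" "\<tau> \<le> T" "t \<in> {s..T} \<Longrightarrow> t \<noteq> \<tau> \<Longrightarrow> t < \<tau> \<longleftrightarrow> (\<forall>r\<in>{s..t}. \<eta> r \<in> D)"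
proof -
  let ?m = "min (ereal T) (exit_time D s \<eta>)"
  have "ereal s \<le> exit_time D s \<eta>"
    unfolding exit_time_def by (rule INF_greatest) auto
  then have "ereal s \<le> ?m" using sT by simp
  moreover have "?m \<le> ereal T" by simp
  ultimately obtain m where "?m = ereal m"
    by (cases ?m) auto
  then have \<tau>: "ereal \<tau> = ?m"
    by (simp add: \<tau>_def truncated_exit_time_def)
  show "s \<le> \<tau>" "\<tau> \<le> T"
    using \<open>ereal s \<le> ?m\<close> \<open>?m \<le> ereal T\<close> unfolding \<tau>[symmetric] by auto
  assume t: "t \<in> {s..T}" "t \<noteq> \<tau>"
  have "ereal t < exit_time D s \<eta> \<longleftrightarrow> t < \<tau>"
  proof
    assume "ereal t < exit_time D s \<eta>"
    then have "ereal t \<le> ereal \<tau>" unfolding \<tau> using t by auto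
    then show "t < \<tau>" using t by simp
  next
    assume "t < \<tau>"
    then have "ereal t < ereal \<tau>" by simp
    then show "ereal t < exit_time D s \<eta>" unfolding \<tau> by simp
  qed
  then show "t < \<tau> \<longleftrightarrow> (\<forall>r\<in>{s..t}. \<eta> r \<in> D)"
    using exit_time_gt_iff[OF D \<eta>, of t] t by simp
qed

text \<open>The bound \<open>b\<close> is computed from the Borel measurable representative \<open>\<psi>\<close>, and is therefore Borel
  measurable itself; for almost every \<open>t\<close> it is the norm of the section of \<open>\<phi>\<close>.\<close>

lemma X1_borel_representative:
  fixes \<phi> :: "'a::euclidean_space \<Rightarrow> real \<Rightarrow> real"
  assumes D: "open D" "bounded D"
    and \<phi>_meas: "(\<lambda>(x, t). \<phi> x t) \<in> borel_measurable (lebesgue_on (closure D \<times> {0..T}))"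
    and \<phi>_X1: "in_X1 D T \<phi>"
  obtains \<psi> :: "'a \<times> real \<Rightarrow> real" and b :: "real \<Rightarrow> real" where
    "\<psi> \<in> borel_measurable borel"
    "AE p in lebesgue. p \<in> closure D \<times> {0..T} \<longrightarrow> \<phi> (fst p) (snd p) = \<psi> p"
    "\<forall>t. 0 \<le> b t" "integrable lborel b"
    "AE t in lborel. t \<in> {0..T} \<longrightarrow> (\<integral>\<^sup>+z. ennreal ((\<psi> (z, t))\<^sup>2) * indicator D z \<partial>lborel) \<le> ennreal ((b t)\<^sup>2)"
    "(LINT t|lborel. b t * indicator {0..T} t) = X1_nrm D T \<phi>"
proof -
  let ?K = "closure D \<times> {0..T}"
  have K: "?K \<in> sets borel" by (intro borel_Times) auto
  have Db[measurable]: "D \<in> sets borel" and Dl: "D \<in> sets lebesgue" using D by auto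
  obtain \<psi> where \<psi>[measurable]: "\<psi> \<in> borel_measurable borel"
      and eq: "AE p in lebesgue_on ?K. (\<lambda>(x, t). \<phi> x t) p = \<psi> p"
    using ex_borel_version[OF K \<phi>_meas] by metis
  have eq': "AE p in lebesgue. p \<in> ?K \<longrightarrow> \<phi> (fst p) (snd p) = \<psi> p"
    using eq K by (simp add: AE_lebesgue_on_iff case_prod_beta)
  have slice: "AE t in lborel. AE x in lborel. (x, t) \<in> ?K \<longrightarrow> \<phi> x t = \<psi> (x, t)"
  proof -
    have "AE p in lborel. p \<in> ?K \<longrightarrow> \<phi> (fst p) (snd p) = \<psi> p"
      using eq' by (simp add: AE_completion_iff)
    then obtain N where N: "N \<in> null_sets lborel" "\<forall>p. p \<notin> N \<longrightarrow> p \<in> ?K \<longrightarrow> \<phi> (fst p) (snd p) = \<psi> p"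
      by (auto elim!: AE_E3)
    then have N': "N \<in> sets (lborel \<Otimes>\<^sub>M lborel)" unfolding lborel_prod by auto
    have "AE p in lborel \<Otimes>\<^sub>M lborel. p \<notin> N"
      using N(1) by (simp add: lborel_prod AE_not_in)
    then have "AE x in lborel. AE t in lborel. (x, t) \<notin> N"
      by (rule lborel_pair.AE_pair)
    moreover have "{p \<in> space (lborel \<Otimes>\<^sub>M lborel). (fst p, snd p) \<notin> N} \<in> sets (lborel \<Otimes>\<^sub>M lborel)"
    proof -
      have "{p \<in> space (lborel \<Otimes>\<^sub>M lborel). (fst p, snd p) \<notin> N} = space (lborel \<Otimes>\<^sub>M lborel) - N"
        by auto
      then show ?thesis using sets.compl_sets[OF N'] by simp
    qed
    ultimately have "AE t in lborel. AE x in lborel. (x, t) \<notin> N"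
      using lborel_pair.AE_commute[of "\<lambda>x t. (x, t) \<notin> N"] by blast
    then show ?thesis
    proof eventually_elim
      case (elim t)
      then show ?case by eventually_elim (use N(2) in force)
    qed
  qed
  define I where "I t = (\<integral>\<^sup>+z. ennreal ((\<psi> (z, t))\<^sup>2) * indicator D z \<partial>lborel)" for t
  have I_meas[measurable]: "I \<in> borel_measurable borel"
  proof -
    have [measurable]: "\<psi> \<in> borel_measurable (borel \<Otimes>\<^sub>M borel)"
      using \<psi> by (simp add: borel_prod)
    have "(\<lambda>p. ennreal ((\<psi> (snd p, fst p))\<^sup>2) * indicator D (snd p)) \<in> borel_measurable (lborel \<Otimes>\<^sub>M lborel)"
      by measurable
    from lborel.borel_measurable_nn_integral_fst[OF this] show ?thesis by (simp add: I_def[abs_def])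
  qed
  define b where "b t = (if t \<in> {0..T} then sqrt (enn2real (I t)) else 0)" for t
  have b_meas[measurable]: "b \<in> borel_measurable borel" unfolding b_def by measurable
  have in_L2: "AE t in lborel. t \<in> {0..T} \<longrightarrow> in_L2 D (\<lambda>x. \<phi> x t)"
    using \<phi>_X1 by (simp add: in_X1_def AE_lebesgue_on_iff AE_completion_iff)
  have I_eq: "AE t in lborel. t \<in> {0..T} \<longrightarrow> I t = ennreal ((L2_nrm D (\<lambda>x. \<phi> x t))\<^sup>2)"
    using slice in_L2
  proof eventually_elim
    case (elim t)
    show ?case
    proof
      assume t: "t \<in> {0..T}"
      have "I t = (\<integral>\<^sup>+z. ennreal ((\<psi> (z, t))\<^sup>2) \<partial>lebesgue_on D)"
        unfolding I_def by (rule nn_integral_lebesgue_on_eq_lborel[OF Db, symmetric])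
      also have "\<dots> = (\<integral>\<^sup>+z. ennreal ((\<phi> z t)\<^sup>2) \<partial>lebesgue_on D)"
      proof (rule nn_integral_cong_AE)
        have "AE x in lebesgue. (x, t) \<in> ?K \<longrightarrow> \<phi> x t = \<psi> (x, t)"
          using elim(1) by (rule AE_completion)
        then show "AE x in lebesgue_on D. ennreal ((\<psi> (x, t))\<^sup>2) = ennreal ((\<phi> x t)\<^sup>2)"
          unfolding AE_lebesgue_on_iff[OF Dl]
          by eventually_elim (use t closure_subset[of D] in auto)
      qed
      also have "\<dots> = ennreal ((L2_nrm D (\<lambda>x. \<phi> x t))\<^sup>2)"
        using elim(2) t by (intro nn_integral_power2_L2) simp
      finally show "I t = ennreal ((L2_nrm D (\<lambda>x. \<phi> x t))\<^sup>2)" .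
    qed
  qed
  have b_eq: "AE t in lborel. t \<in> {0..T} \<longrightarrow> b t = L2_nrm D (\<lambda>x. \<phi> x t)"
    using I_eq by eventually_elim (simp add: b_def)
  have Tl: "{0..T} \<in> sets lebesgue" by simp
  have b_eq': "AE t in lebesgue_on {0..T}. L2_nrm D (\<lambda>x. \<phi> x t) = b t"
    unfolding AE_lebesgue_on_iff[OF Tl] using AE_completion[OF b_eq] by eventually_elim simp
  have bm: "b \<in> borel_measurable (lebesgue_on {0..T})"
    by (intro measurable_restrict_space1 measurable_completion) simp
  have ni: "integrable (lebesgue_on {0..T}) (\<lambda>t. L2_nrm D (\<lambda>x. \<phi> x t))"
    using \<phi>_X1 by (simp add: in_X1_def)
  have "integrable (lebesgue_on {0..T}) b"
    using ni by (subst integrable_cong_AE[OF bm _ b_eq'[THEN eventually_mono]]) auto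
  then have bi: "integrable lborel b"
    by (subst (asm) integrable_lebesgue_on_iff_lborel) (auto simp: b_def)
  have "X1_nrm D T \<phi> = (LINT t|lebesgue_on {0..T}. b t)"
    unfolding X1_nrm_def using ni bm b_eq' by (intro integral_cong_AE) auto
  also have "\<dots> = (LINT t|lborel. b t)"
    by (rule integral_lebesgue_on_eq_lborel) (auto simp: b_def)
  also have "\<dots> = (LINT t|lborel. b t * indicator {0..T} t)"
    by (intro Bochner_Integration.integral_cong) (auto simp: b_def indicator_def)
  finally have nrm: "(LINT t|lborel. b t * indicator {0..T} t) = X1_nrm D T \<phi>" ..
  have le: "AE t in lborel. t \<in> {0..T} \<longrightarrow> (\<integral>\<^sup>+z. ennreal ((\<psi> (z, t))\<^sup>2) * indicator D z \<partial>lborel) \<le> ennreal ((b t)\<^sup>2)"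
    using I_eq b_eq by eventually_elim (simp add: I_def)
  show ?thesis
    by (rule that[OF \<psi> eq' _ bi le nrm]) (simp add: b_def)
qed

context flow_in_bounded_domain
begin

lemma U_fun_eq:
  assumes "x \<in> D" "s \<in> {0..T}"
  shows "U_fun D T y \<zeta> x s = killed_flow.pull staying (\<lambda>s t x. y x s t) s T \<zeta> x"
proof -
  interpret K: jointly_continuous_killed_flow D T staying "\<lambda>s t x. y x s t" total_div M
    by (rule jointly_continuous_killed_flow_staying)
  show ?thesis
    using exit_time_gt_iff[OF open_D y_continuous[OF assms order_refl], of T] assms
    by (simp add: U_fun_def K.pull_def staying_def)
qed

text \<open>For almost every starting point the representative \<open>\<psi>\<close> may replace \<open>\<phi>\<close> along the path at almost
  all times. The path being in \<open>D\<close> up to time \<open>t\<close> means \<open>t < \<tau>\<close>, except at the single time \<open>\<tau>\<close>.\<close>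

lemma V_fun_eq:
  assumes s: "s \<in> {0..T}"
    and src: "killed_flow_source D T staying (\<lambda>s t x. y x s t) total_div M \<psi> b"
    and eq: "AE p in lebesgue. p \<in> closure D \<times> {0..T} \<longrightarrow> \<phi> (fst p) (snd p) = \<psi> p"
  shows "AE x in lebesgue_on D. set_integrable lebesgue {s..truncated_exit_time D T s (y x s)} (\<lambda>t. \<phi> (y x s t) t)
      \<and> V_fun D T y \<phi> x s = killed_flow_source.path_integral T staying (\<lambda>s t x. y x s t) \<psi> x s"
proof -
  interpret K: killed_flow_source D T staying "\<lambda>s t x. y x s t" total_div M \<psi> b by (rule src)
  have "AE x in lborel. integrable lborel (\<lambda>t. K.along s x t * indicator UNIV t)"
    by (rule K.AE_integrable_along[OF s]) simp
  then have "AE x in lborel. x \<in> D \<longrightarrow>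
      set_integrable lebesgue {s..truncated_exit_time D T s (y x s)} (\<lambda>t. \<phi> (y x s t) t)
      \<and> V_fun D T y \<phi> x s = K.path_integral x s"
    using K.AE_along_paths[OF s eq]
  proof eventually_elim
    case (elim x)
    show ?case
    proof
      assume x: "x \<in> D"
      let ?\<tau> = "truncated_exit_time D T s (y x s)"
      let ?f = "\<lambda>t. indicator {s..?\<tau>} t *\<^sub>R \<phi> (y x s t) t"
      note \<tau> = truncated_exit_time[OF open_D y_continuous[OF x s order_refl], of T]
      have int: "integrable lborel (K.along s x)" using elim(1) by simp
      have ae: "AE t in lborel. ?f t = K.along s x t"
        using elim(2) AE_lborel_singleton[of ?\<tau>]
      proof eventually_elim
        case (elim t)
        show ?case
        proof (cases "t \<in> {s..T}")
          case True
          then have iff: "t < ?\<tau> \<longleftrightarrow> x \<in> staying s t"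
            using \<tau>(3)[of t] s x elim(2) by (simp add: staying_def)
          show ?thesis
          proof (cases "t < ?\<tau>")
            case stay: True
            then have "y x s t \<in> D" using iff True by (simp add: staying_def)
            then have "(y x s t, t) \<in> closure D \<times> {0..T}" using True s closure_subset[of D] by auto
            then show ?thesis using elim(1) True stay iff by (simp add: K.along_def)
          next
            case False
            then show ?thesis using iff elim(2) by (simp add: K.along_def)
          qed
        next
          case False
          then have "t \<notin> {s..?\<tau>}" using \<tau>(2) s by auto
          then show ?thesis using False by (auto simp: K.along_def)
        qed
      qed
      have m: "K.along s x \<in> borel_measurable lebesgue"
        using int by (intro measurable_completion) auto
      have ae': "AE t in lebesgue. K.along s x t = ?f t"
        using AE_completion[OF ae] by eventually_elim simp
      have fm: "?f \<in> borel_measurable lebesgue" by (rule borel_measurable_AE[OF m ae'])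
      have "integrable lebesgue (K.along s x)" using int by (simp add: integrable_completion)
      then have "integrable lebesgue ?f"
        using integrable_cong_AE[OF m fm ae'] by simp
      moreover have "(LINT t|lebesgue. ?f t) = (LINT t|lborel. K.along s x t)"
        using integral_cong_AE[OF m fm ae'] int by (simp add: integral_completion)
      ultimately show "set_integrable lebesgue {s..?\<tau>} (\<lambda>t. \<phi> (y x s t) t)
          \<and> V_fun D T y \<phi> x s = K.path_integral x s"
        by (simp add: set_integrable_def V_fun_def set_lebesgue_integral_def K.path_integral_def)
    qed
  qed
  then show ?thesis
    unfolding AE_lebesgue_on_iff[OF K.lebesgue_D] AE_completion_iff .
qed

end

theorem corollary4p1:
  fixes D :: "(real^'n) set"
    and T :: real
    and f :: "real^'n \<Rightarrow> real \<Rightarrow> real^'n"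
    and y :: "real^'n \<Rightarrow> real \<Rightarrow> real \<Rightarrow> real^'n"
    and \<phi> :: "real^'n \<Rightarrow> real \<Rightarrow> real"
    and \<zeta> :: "real^'n \<Rightarrow> real"
  assumes D: "open D" "connected D" "D \<noteq> {}" "bounded D" "simply_connected D" "C1_boundary D"
    and T: "T > 0"
    and f_bounded: "bounded (range (\<lambda>(x, t). f x t))"
    and f_cont: "continuous_on UNIV (\<lambda>(x, t). f x t)"
    and f_partials: "\<And>i j x t. has_partial_deriv (\<lambda>z. f z t $ i) j x"
    and f_partials_cont:
      "\<And>i j. continuous_on UNIV (\<lambda>(x, t). partial_deriv (\<lambda>z. f z t $ i) j x)"
    and y: "\<And>x s. x \<in> D \<Longrightarrow> s \<in> {0..T} \<Longrightarrow> solves_ivp f x s (y x s)"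
    and \<phi>_meas: "(\<lambda>(x, t). \<phi> x t) \<in> borel_measurable (lebesgue_on (closure D \<times> {0..T}))"
    and \<phi>_X1: "in_X1 D T \<phi>"
    and \<zeta>_meas: "\<zeta> \<in> borel_measurable (lebesgue_on (closure D))"
    and \<zeta>_L2: "in_L2 D \<zeta>"
  shows "(\<forall>s\<in>{0..T}. AE x in lebesgue_on D.
            set_integrable lebesgue {s..truncated_exit_time D T s (y x s)} (\<lambda>t. \<phi> (y x s t) t))
       \<and> weakly_continuous_L2 D T (V_fun D T y \<phi>)
       \<and> strongly_left_continuous_L2 D T (V_fun D T y \<phi>)
       \<and> weakly_continuous_L2 D T (U_fun D T y \<zeta>)
       \<and> strongly_left_continuous_L2 D T (U_fun D T y \<zeta>)
       \<and> (SUP s\<in>{0..T}. ereal (L2_nrm D (\<lambda>x. V_fun D T y \<phi> x s))) \<le> ereal (const_c0 D T f * X1_nrm D T \<phi>)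
       \<and> (SUP s\<in>{0..T}. ereal (L2_nrm D (\<lambda>x. U_fun D T y \<zeta> x s))) \<le> ereal (const_c0 D T f * L2_nrm D \<zeta>)"
proof -
  interpret C1_field f by unfold_locales (fact f_partials f_partials_cont)+
  obtain M where M: "0 \<le> M" "\<And>x t. norm (f x t) \<le> M"
  proof -
    obtain M where "\<And>x t. norm (f x t) \<le> M"
      using f_bounded by (auto simp: bounded_iff)
    then show ?thesis using that[of M] norm_ge_zero order_trans by blast
  qed
  obtain R0 where R0: "\<And>x. x \<in> D \<Longrightarrow> norm x \<le> R0"
    using D(4) by (auto simp: bounded_iff)
  \<comment> \<open>up to time \<open>T\<close> the paths started in \<open>D\<close> stay in the ball of radius \<open>R\<close>\<close>
  define R where "R = R0 + M * T"
  obtain L where L: "0 \<le> L" "\<And>x t h. x \<in> cball 0 R \<Longrightarrow> t \<in> {0..T} \<Longrightarrow> norm (space_jacobian f x t *v h) \<le> L * norm h"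
    using jacobian_uniform_bound[of "cball 0 R" T] by (metis compact_cball)
  interpret F: flow_in_bounded_domain D T f "space_jacobian f" y M L R
  proof
    show "norm x + M * T \<le> R" if "x \<in> D" for x using R0[OF that] by (simp add: R_def)
    show "norm (f x t - f z t) \<le> L * norm (x - z)"
      if "x \<in> cball 0 R" "z \<in> cball 0 R" "t \<in> {0..T}" for x z t
      by (rule field_Lipschitz[OF convex_cball that(3,1,2)]) (rule L(2)[OF _ that(3)])
    show "\<exists>d>0. \<forall>x\<in>cball 0 R. \<forall>z\<in>cball 0 R. \<forall>t\<in>{0..T}.
        norm (z - x) < d \<longrightarrow> norm (f z t - f x t - space_jacobian f x t *v (z - x)) \<le> \<epsilon> * norm (z - x)"
      if "0 < \<epsilon>" for \<epsilon>
      using uniform_linearisation[OF compact_cball convex_cball that, of 0 R T] by metis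
  qed (use D T M L y continuous_on_jacobian_component in auto)
  interpret K: jointly_continuous_killed_flow D T F.staying "\<lambda>s t x. y x s t" F.total_div M
    by (rule F.jointly_continuous_killed_flow_staying)
  have c0: "K.L2_factor = const_c0 D T f"
  proof -
    have "F.sup_div t = (SUP x\<in>D. \<bar>\<Sum>i\<in>UNIV. partial_deriv (\<lambda>z. f z t $ i) i x\<bar>)" for t
      by (simp add: F.sup_div_def F.field_div_def space_jacobian_def)
    moreover have "F.total_div T - F.total_div 0 = (LINT t:{0..T}|lebesgue. F.sup_div t)"
    proof -
      have "set_integrable lebesgue {0..T} F.sup_div"
        using absolutely_integrable_continuous_real[OF F.sup_div_cont] .
      then show ?thesis
        by (simp add: set_lebesgue_integral_eq_integral F.total_div_def)
    qed
    ultimately show ?thesis by (simp add: K.L2_factor_def const_c0_def)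
  qed
  obtain \<psi> b where \<psi>: "\<psi> \<in> borel_measurable borel"
    "AE p in lebesgue. p \<in> closure D \<times> {0..T} \<longrightarrow> \<phi> (fst p) (snd p) = \<psi> p"
    "\<forall>t. 0 \<le> b t" "integrable lborel b"
    "AE t in lborel. t \<in> {0..T} \<longrightarrow> (\<integral>\<^sup>+z. ennreal ((\<psi> (z, t))\<^sup>2) * indicator D z \<partial>lborel) \<le> ennreal ((b t)\<^sup>2)"
    "(LINT t|lborel. b t * indicator {0..T} t) = X1_nrm D T \<phi>"
    by (rule X1_borel_representative[OF D(1,4) \<phi>_meas \<phi>_X1])
  interpret S: killed_flow_source D T F.staying "\<lambda>s t x. y x s t" F.total_div M \<psi> b
    by unfold_locales (fact \<psi>(1) \<psi>(3)[rule_format] \<psi>(4) \<psi>(5))+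
  have V: "AE x in lebesgue_on D. set_integrable lebesgue {s..truncated_exit_time D T s (y x s)} (\<lambda>t. \<phi> (y x s t) t)"
    "AE x in lebesgue_on D. S.path_integral x s = V_fun D T y \<phi> x s" if "s \<in> {0..T}" for s
    using F.V_fun_eq[OF that S.killed_flow_source_axioms \<psi>(2)] by (eventually_elim, simp)+
  have U: "AE x in lebesgue_on D. K.pull s T \<zeta> x = U_fun D T y \<zeta> x s" if "s \<in> {0..T}" for s
    using F.U_fun_eq[OF _ that] by (intro AE_I2) simp
  have Vm: "(\<lambda>x. S.path_integral x s) \<in> borel_measurable (lebesgue_on D)" if "s \<in> {0..T}" for s
    using S.path_integral_weakly_continuous that by (auto simp: weakly_continuous_L2_def in_L2_def)
  have Um: "K.pull s T \<zeta> \<in> borel_measurable (lebesgue_on D)" if "s \<in> {0..T}" for s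
    using K.in_L2_pull[of s T, OF _ _ _ \<zeta>_L2] that by (auto simp: in_L2_def)
  have "L2_nrm D (\<lambda>x. V_fun D T y \<phi> x s) \<le> const_c0 D T f * X1_nrm D T \<phi>" if "s \<in> {0..T}" for s
    using S.path_integral_L2_nrm_le[OF that] L2_AE_cong(2)[OF K.lebesgue_D Vm[OF that] V(2)[OF that]] \<psi>(6)
    by (simp add: c0)
  moreover have "L2_nrm D (\<lambda>x. U_fun D T y \<zeta> x s) \<le> const_c0 D T f * L2_nrm D \<zeta>" if "s \<in> {0..T}" for s
    using K.terminal_pull_L2_nrm_le[OF \<zeta>_L2 that] L2_AE_cong(2)[OF K.lebesgue_D Um[OF that] U[OF that]]
    by (simp add: c0)
  ultimately show ?thesis
    using V(1) weakly_continuous_L2_AE_cong[OF K.lebesgue_D S.path_integral_weakly_continuous V(2)]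
      strongly_left_continuous_L2_AE_cong[OF K.lebesgue_D S.path_integral_strongly_left_continuous V(2)]
      weakly_continuous_L2_AE_cong[OF K.lebesgue_D K.terminal_pull_weakly_continuous[OF \<zeta>_L2] U]
      strongly_left_continuous_L2_AE_cong[OF K.lebesgue_D K.terminal_pull_strongly_left_continuous[OF \<zeta>_L2] U]
    by (intro conjI ballI SUP_least) (simp_all only: ereal_less_eq)
qed

end
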